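(* Let $K\subset\mathbb{R}^n$ be a closed convex set, $\mu_0\in K$, $h\sim\mathcal{N}(0,I_n)$. For $\sigma>0$ let $\hat\mu_K^{\mathrm{seq}}(\sigma)=\Pi_K(\mu_0+\sigma h)$, $\mathrm{err}(\sigma)=\|\hat\mu_K^{\mathrm{seq}}(\sigma)-\mu_0\|^2$, and $\mathrm{lrt}(\sigma)=\|\sigma h\|^2-\|\mu_0+\sigma h-\hat\mu_K^{\mathrm{seq}}(\sigma)\|^2$. The following hold. (1) $\mathbb{E}\,\mathrm{lrt}(\sigma)\le2\sigma^2\,\mathbb{E}\,\mathrm{div}\,\hat\mu_K^{\mathrm{seq}}(\sigma)\le2\sigma^2n$. (2) For any $\sigma>0$, $$\mathrm{err}(\sigma)\le\mathrm{lrt}(\sigma)\le\mathrm{err}(\sigma)+2\sigma\int_0^\sigma\bigg(\frac{\mathrm{err}(\tau)}{\tau^2}-\frac{\mathrm{err}(\sigma)}{\sigma^2}\bigg)\,\mathrm{d}\tau.$$ Suppose further that $K$ is a closed convex cone. Then for any $\sigma>0$ and any (possibly random) $\nu$ such that $K+\nu\subset K$ and $\hat\mu_K^{\mathrm{seq}}(\sigma)-\nu\in K$, $$\mathrm{err}(\sigma)\le\mathrm{lrt}(\sigma)\le\mathrm{err}(\sigma)+2\big\langle\hat\mu_K^{\mathrm{seq}}(\sigma)-\mu_0-\sigma h,\ \mu_0-\nu\big\rangle,$$ and the right inequality is an equality when $\nu=\hat\mu_K^{\mathrm{seq}}(\sigma)$. (3) $\mathrm{Var}(\mathrm{lrt}(\sigma))\le4\sigma^2\,\mathbb{E}\,\mathrm{err}(\sigma)$.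 (4) For any $\lambda\in\mathbb{R}$ with $\lambda^2<\mathbb{E}\,\mathrm{err}(\sigma)/(8\sigma^2)$, $$\mathbb{E}\exp\bigg[\lambda\cdot\frac{\mathrm{lrt}(\sigma)-\mathbb{E}\,\mathrm{lrt}(\sigma)}{\sigma\,(\mathbb{E}\,\mathrm{err}(\sigma))^{1/2}}\bigg]\le\exp\bigg(\frac{4\lambda^2}{1-8(\sigma^2/\mathbb{E}\,\mathrm{err}(\sigma))\lambda^2}\bigg).$$ Consequently, there exists an absolute constant $L>0$ such that for all $t\ge0$, $$\mathbb{P}\Big(L^{-1}|\mathrm{lrt}(\sigma)-\mathbb{E}\,\mathrm{lrt}(\sigma)|\ge\sqrt{\sigma^2\,\mathbb{E}\,\mathrm{err}(\sigma)\,t}+\sigma^2t\Big)\le Le^{-t/L}.$$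
   Context: $\Pi_K$ is the metric projection onto $K$; $\|\cdot\|$ is the Euclidean norm. $\mathrm{div}\,\hat\mu_K^{\mathrm{seq}}(\sigma)$ denotes the divergence $\sum_{i=1}^n\partial(\Pi_K)_i/\partial y_i$ of the ($1$-Lipschitz, hence a.e. differentiable) map $\Pi_K$ evaluated at $y=\mu_0+\sigma h$. *)

theory Defs
  imports "HOL-Probability.Probability" "HOL-Library.Function_Algebras"
begin

text \<open>The last assertion of the theorem involves a constant that does not depend on the dimension.
  So the dimension \<open>n\<close> must be a bound variable and cannot be a type: a vector of \<open>\<real>\<^sup>n\<close> is a
  function \<open>nat \<Rightarrow> real\<close> that vanishes at all indices \<open>i \<ge> n\<close>, i.e. an element of the topological
  space \<^const>\<open>Euclidean_space\<close>\<open> n\<close> of HOL-Analysis. The following instance gives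
  such functions their pointwise vector space structure, so that \<^const>\<open>convex\<close> and \<^const>\<open>cone\<close>
  apply.\<close>

instantiation "fun" :: (type, real_vector) real_vector
begin

definition scaleR_fun :: "real \<Rightarrow> ('a \<Rightarrow> 'b) \<Rightarrow> 'a \<Rightarrow> 'b"
  where "scaleR_fun c f = (\<lambda>x. c *\<^sub>R f x)"

instance
  by standard (auto simp: scaleR_fun_def fun_eq_iff scaleR_add_right scaleR_add_left)

end

definition vinner :: "nat \<Rightarrow> (nat \<Rightarrow> real) \<Rightarrow> (nat \<Rightarrow> real) \<Rightarrow> real"
  where "vinner n x y = (\<Sum>i<n. x i * y i)"

abbreviation vnorm :: "nat \<Rightarrow> (nat \<Rightarrow> real) \<Rightarrow> real"
  where "vnorm n x \<equiv> L2_set x {..<n}"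

definition metric_proj :: "nat \<Rightarrow> (nat \<Rightarrow> real) set \<Rightarrow> (nat \<Rightarrow> real) \<Rightarrow> nat \<Rightarrow> real"
  where "metric_proj n K y = arg_min_on (\<lambda>z. vnorm n (y - z)) K"

text \<open>Where a partial derivative does not exist (a null set of points \<open>y\<close> when \<open>F\<close> is Lipschitz),
  \<^const>\<open>deriv\<close> takes a fixed unspecified value.\<close>

definition divergence :: "nat \<Rightarrow> ((nat \<Rightarrow> real) \<Rightarrow> nat \<Rightarrow> real) \<Rightarrow> (nat \<Rightarrow> real) \<Rightarrow> real"
  where "divergence n F y = (\<Sum>i<n. deriv (\<lambda>t. F (y(i := t)) i) (y i))"

text \<open>The law \<open>N(0, I\<^sub>n)\<close>, as a measure on \<open>nat \<Rightarrow> real\<close> carried by \<open>\<real>\<^sup>n\<close>.\<close>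

definition std_gaussian :: "nat \<Rightarrow> (nat \<Rightarrow> real) measure"
  where "std_gaussian n =
    distr (\<Pi>\<^sub>M i\<in>{..<n}. std_normal_distribution) borel (\<lambda>x i. if i < n then x i else 0)"

lemma measurable_zero_extend:
  fixes n :: nat
  shows "(\<lambda>x i. if i < n then x i else 0) \<in> borel_measurable (\<Pi>\<^sub>M i\<in>{..<n}. std_normal_distribution)"
proof (rule measurable_coordinatewise_then_product)
  fix i
  show "(\<lambda>x. if i < n then x i else 0) \<in> borel_measurable (\<Pi>\<^sub>M i\<in>{..<n}. std_normal_distribution)"
  proof (cases "i < n")
    case True
    then have "(\<lambda>x. x i) \<in> (\<Pi>\<^sub>M i\<in>{..<n}. std_normal_distribution) \<rightarrow>\<^sub>M std_normal_distribution"
      by (intro measurable_component_singleton) auto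
    then show ?thesis using True by simp
  qed simp
qed

lemma prob_space_std_gaussian: "prob_space (std_gaussian n)"
proof -
  interpret prob_space "\<Pi>\<^sub>M i\<in>{..<n}. std_normal_distribution"
    by (intro prob_space_PiM prob_space_normal_density) simp
  show ?thesis
    unfolding std_gaussian_def by (intro prob_space_distr measurable_zero_extend)
qed

lemma AE_std_gaussian_Euclidean_space: "AE h in std_gaussian n. h \<in> topspace (Euclidean_space n)"
proof -
  have "AE h in std_gaussian n. \<forall>i\<in>{n..}. h i = 0"
  proof (subst AE_ball_countable)
    show "\<forall>i\<in>{n..}. AE h in std_gaussian n. h i = 0"
    proof
      fix i assume "i \<in> {n..}"
      then show "AE h in std_gaussian n. h i = 0"
        unfolding std_gaussian_def
        by (subst AE_distr_iff[OF measurable_zero_extend])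
          (auto intro!: borel_measurable_eq measurable_product_coordinates)
    qed
  qed auto
  then show ?thesis by (simp add: topspace_Euclidean_space Ball_def)
qed

definition mu_seq ::
    "nat \<Rightarrow> (nat \<Rightarrow> real) set \<Rightarrow> (nat \<Rightarrow> real) \<Rightarrow> real \<Rightarrow> (nat \<Rightarrow> real) \<Rightarrow> nat \<Rightarrow> real"
  where "mu_seq n K \<mu>\<^sub>0 \<sigma> h = metric_proj n K (\<mu>\<^sub>0 + \<sigma> *\<^sub>R h)"

definition div_mu_seq ::
    "nat \<Rightarrow> (nat \<Rightarrow> real) set \<Rightarrow> (nat \<Rightarrow> real) \<Rightarrow> real \<Rightarrow> (nat \<Rightarrow> real) \<Rightarrow> real"
  where "div_mu_seq n K \<mu>\<^sub>0 \<sigma> h = divergence n (metric_proj n K) (\<mu>\<^sub>0 + \<sigma> *\<^sub>R h)"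

definition err ::
    "nat \<Rightarrow> (nat \<Rightarrow> real) set \<Rightarrow> (nat \<Rightarrow> real) \<Rightarrow> real \<Rightarrow> (nat \<Rightarrow> real) \<Rightarrow> real"
  where "err n K \<mu>\<^sub>0 \<sigma> h = (vnorm n (mu_seq n K \<mu>\<^sub>0 \<sigma> h - \<mu>\<^sub>0))\<^sup>2"

definition lrt ::
    "nat \<Rightarrow> (nat \<Rightarrow> real) set \<Rightarrow> (nat \<Rightarrow> real) \<Rightarrow> real \<Rightarrow> (nat \<Rightarrow> real) \<Rightarrow> real"
  where "lrt n K \<mu>\<^sub>0 \<sigma> h =
    (vnorm n (\<sigma> *\<^sub>R h))\<^sup>2 - (vnorm n (\<mu>\<^sub>0 + \<sigma> *\<^sub>R h - mu_seq n K \<mu>\<^sub>0 \<sigma> h))\<^sup>2"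

end

theory Submission
  imports Defs
begin

text \<open>Write \<open>F(h) = lrt(\<sigma>)\<close>, \<open>p(h) = \<mu>(h) - \<mu>\<^sub>0\<close> and \<open>m = E err(\<sigma>)\<close>. The function \<open>F\<close> is
  convex with gradient \<open>2 \<sigma> p\<close>, and
  \<open>F(x) \<le> F(y) + 2 \<sigma> \<langle>x - y, p(y)\<rangle> + \<sigma>\<^sup>2 |x - y|\<^sup>2\<close>. Along a ray, \<open>lrt(\<tau>) / \<tau>\<close> has
  derivative \<open>err(\<tau>) / \<tau>\<^sup>2\<close>, which gives (2) from \<open>err \<le> lrt\<close>.

  For (1), \<open>F \<le> 2 \<sigma> \<langle>h, p(h)\<rangle>\<close>, and Stein's identity turns the expectation of the
  right-hand side into \<open>2 \<sigma>\<^sup>2 E div\<close>. Along a coordinate line the corresponding component of the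
  projection is monotone and 1-Lipschitz, hence differentiable almost everywhere with derivative
  in \<open>[0, 1]\<close>.

  For (3) and (4) a transport inequality replaces the logarithmic Sobolev inequality, so that no
  derivative of the merely Lipschitz function \<open>err\<close> is needed: if
  \<open>u(x) \<le> f(y) + |x - y|\<^sup>2 / 2\<close> for all \<open>x\<close>, \<open>y\<close>, then \<open>E exp u \<le> exp (E f)\<close>. In
  dimension one this is the limit \<open>t \<rightarrow> 0\<close> of the Prekopa--Leindler inequality for
  \<open>exp (- t f)\<close>, \<open>exp ((1 - t) u)\<close> and \<open>1\<close> against the Gaussian density. With \<open>u = \<theta> F\<close>,
  the bounds on \<open>F\<close> allow \<open>f = \<theta> F + (\<theta>\<^sup>2 \<sigma>\<^sup>2 / b) err\<close> whenever
  \<open>0 < b \<le> 1/2 - max(0, \<theta>) \<sigma>\<^sup>2\<close>. Hence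
  \<open>E exp (\<theta> (F - E F)) \<le> exp (\<theta>\<^sup>2 \<sigma>\<^sup>2 m / b)\<close>; letting \<open>\<theta> \<rightarrow> 0\<close> and \<open>b \<rightarrow> 1/2\<close> gives
  (3), and \<open>b = (1 - 8 (\<theta> \<sigma>\<^sup>2)\<^sup>2) / 4\<close> gives (4).\<close>

section \<open>Euclidean projections\<close>

text \<open>Three obstacles shape the details. The dimension is a bound variable, so vectors are
  functions with the product topology; \<open>vnorm n\<close> and \<open>vinner n\<close> see only
  the first n coordinates, and the Gaussian law is reached through finite product measures, one
  coordinate at a time. The infimum convolution of f with the quadratic cost, the usual object of a
  dual transport inequality, raises a measurability question; a measurable function below it is used
  instead, and this form survives partial integration. Stein's identity needs partial derivatives
  that are measurable in all coordinates jointly before Fubini can integrate out one of them, so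
  differentiability is rewritten as countably many conditions. The parameter b is the share of the
  cost held back to complete a square: the curvature of \<theta> F may take (1/2 - b) |x - y|^2, and
  b |x - y|^2 absorbs the cross term 2 \<theta> \<sigma> <x - y, p(y)> at the price \<theta>^2
  \<sigma>^2 |p(y)|^2 / b.\<close>

lemma vinner_commute: "vinner n x y = vinner n y x"
  by (simp add: vinner_def mult.commute)

lemma vinner_add_left: "vinner n (x + y) z = vinner n x z + vinner n y z"
  by (simp add: vinner_def algebra_simps sum.distrib)

lemma vinner_diff_left: "vinner n (x - y) z = vinner n x z - vinner n y z"
  by (simp add: vinner_def algebra_simps sum_subtractf)

lemma vinner_scaleR_left: "vinner n (c *\<^sub>R x) y = c * vinner n x y"
  by (simp add: vinner_def scaleR_fun_def sum_distrib_left mult.assoc)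

lemma vinner_add_right: "vinner n z (x + y) = vinner n z x + vinner n z y"
  by (metis vinner_add_left vinner_commute)

lemma vinner_diff_right: "vinner n z (x - y) = vinner n z x - vinner n z y"
  by (metis vinner_diff_left vinner_commute)

lemma vinner_scaleR_right: "vinner n y (c *\<^sub>R x) = c * vinner n y x"
  by (metis vinner_scaleR_left vinner_commute)

lemmas vinner_simps = vinner_add_left vinner_diff_left vinner_scaleR_left
  vinner_add_right vinner_diff_right vinner_scaleR_right

lemma vnorm_square: "(vnorm n x)\<^sup>2 = vinner n x x"
  by (simp add: L2_set_def vinner_def sum_nonneg power2_eq_square)

lemma vinner_self_nonneg: "0 \<le> vinner n x x"
  by (simp add: vinner_def sum_nonneg)

lemma vinner_Cauchy_Schwarz: "\<bar>vinner n x y\<bar> \<le> vnorm n x * vnorm n y"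
proof -
  have "\<bar>vinner n x y\<bar> \<le> (\<Sum>i<n. \<bar>x i\<bar> * \<bar>y i\<bar>)"
    unfolding vinner_def by (rule order_trans[OF sum_abs]) (simp add: abs_mult)
  also have "\<dots> \<le> vnorm n x * vnorm n y"
    by (rule L2_set_mult_ineq)
  finally show ?thesis .
qed

lemma continuous_on_vnorm [continuous_intros]:
  assumes "continuous_on S f"
  shows "continuous_on S (\<lambda>x. vnorm n (f x))"
proof -
  have "continuous_on S (\<lambda>x. f x i)" for i
    using assms by (simp add: continuous_on_product_then_coordinatewise)
  then show ?thesis
    unfolding L2_set_def by (intro continuous_intros)
qed

lemma continuous_on_fun_diff [continuous_intros]:
  fixes f g :: "'a::topological_space \<Rightarrow> 'b \<Rightarrow> real"
  assumes "continuous_on S f" "continuous_on S g"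
  shows "continuous_on S (\<lambda>x. f x - g x)"
proof (rule continuous_on_coordinatewise_then_product)
  fix i
  have "continuous_on S (\<lambda>x. f x i)" "continuous_on S (\<lambda>x. g x i)"
    using assms by (simp_all add: continuous_on_product_then_coordinatewise)
  then show "continuous_on S (\<lambda>x. (f x - g x) i)"
    by (simp add: continuous_on_diff)
qed

text \<open>Tychonoff's theorem: every coordinate ranges over a compact set, which is {0} from index
  n on.\<close>

lemma compact_box_Euclidean_space:
  "compact {x::nat \<Rightarrow> real. (\<forall>i<n. \<bar>x i\<bar> \<le> (R::real)) \<and> (\<forall>i\<ge>n. x i = 0)}"
proof -
  have "compactin (product_topology (\<lambda>i. euclidean) UNIV)
      (PiE UNIV (\<lambda>i::nat. if i < n then {-R..R} else {0::real}))"
    by (subst compactin_PiE) auto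
  then have "compact (PiE UNIV (\<lambda>i::nat. if i < n then {-R..R} else {0::real}))"
    by (simp add: euclidean_product_topology compactin_euclidean_iff)
  also have "PiE UNIV (\<lambda>i::nat. if i < n then {-R..R} else {0::real}) =
      {x. (\<forall>i<n. \<bar>x i\<bar> \<le> R) \<and> (\<forall>i\<ge>n. x i = 0)}"
    by (force simp: PiE_def Pi_def split: if_splits)
  finally show ?thesis .
qed

lemma abs_le_vnorm: "i < n \<Longrightarrow> \<bar>x i\<bar> \<le> vnorm n x"
proof -
  assume "i < n"
  then have "\<bar>x i\<bar> \<le> L2_set (\<lambda>i. \<bar>x i\<bar>) {..<n}"
    by (intro member_le_L2_set) auto
  then show ?thesis by (simp add: L2_set_def)
qed

locale closed_convex_set =
  fixes n :: nat and K :: "(nat \<Rightarrow> real) set" and \<mu>\<^sub>0 :: "nat \<Rightarrow> real"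
  assumes closedin_K: "closedin (Euclidean_space n) K"
    and convex_K: "convex K"
    and center_in_K: "\<mu>\<^sub>0 \<in> K"
begin

abbreviation proj where "proj \<equiv> metric_proj n K"

lemma K_zero: "x \<in> K \<Longrightarrow> n \<le> i \<Longrightarrow> x i = 0"
  using closedin_subset[OF closedin_K] by (auto simp: topspace_Euclidean_space)

text \<open>\<open>arg_min_on\<close> is a choice, so one minimiser has to be exhibited. The points
  of K no farther from y than \<open>\<mu>\<^sub>0\<close> lie in a compact box, on which the
  continuous distance attains its infimum.\<close>

lemma proj_minimizes: "proj y \<in> K \<and> (\<forall>z\<in>K. vnorm n (y - proj y) \<le> vnorm n (y - z))"
proof -
  define R where "R = vnorm n y + vnorm n (y - \<mu>\<^sub>0)"
  define C where "C = K \<inter> {x. (\<forall>i<n. \<bar>x i\<bar> \<le> R) \<and> (\<forall>i\<ge>n. x i = 0)}"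
  have near: "z \<in> C" if "z \<in> K" "vnorm n (y - z) \<le> vnorm n (y - \<mu>\<^sub>0)" for z
  proof -
    have "\<bar>z i\<bar> \<le> R" if "i < n" for i
    proof -
      have "\<bar>z i\<bar> \<le> \<bar>y i\<bar> + \<bar>(y - z) i\<bar>" by simp
      also have "\<dots> \<le> vnorm n y + vnorm n (y - z)"
        using \<open>i < n\<close> by (intro add_mono abs_le_vnorm)
      finally show ?thesis
        using \<open>vnorm n (y - z) \<le> vnorm n (y - \<mu>\<^sub>0)\<close> by (simp add: R_def)
    qed
    then show ?thesis using \<open>z \<in> K\<close> by (auto simp: C_def K_zero)
  qed
  have "compact C"
    unfolding C_def using closedin_Euclidean_imp_closed[OF closedin_K]
    by (intro closed_Int_compact compact_box_Euclidean_space)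
  moreover have "\<mu>\<^sub>0 \<in> C" by (rule near) (simp_all add: center_in_K)
  moreover have "continuous_on C (\<lambda>z. vnorm n (y - z))"
    by (intro continuous_on_vnorm continuous_on_fun_diff continuous_on_id continuous_on_const)
  ultimately obtain p where p: "p \<in> C" "\<And>z. z \<in> C \<Longrightarrow> vnorm n (y - p) \<le> vnorm n (y - z)"
    using continuous_attains_inf[of C "\<lambda>z. vnorm n (y - z)"] by blast
  have "is_arg_min (\<lambda>z. vnorm n (y - z)) (\<lambda>z. z \<in> K) p"
    unfolding is_arg_min_linorder
  proof safe
    show "p \<in> K" using p(1) by (simp add: C_def)
    fix z assume "z \<in> K"
    show "vnorm n (y - p) \<le> vnorm n (y - z)"
      using p(2)[OF \<open>\<mu>\<^sub>0 \<in> C\<close>] p(2)[OF near[OF \<open>z \<in> K\<close>]] by linarith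
  qed
  then have "is_arg_min (\<lambda>z. vnorm n (y - z)) (\<lambda>z. z \<in> K) (proj y)"
    unfolding metric_proj_def arg_min_on_def arg_min_def by (rule someI[of "is_arg_min _ _"])
  then show ?thesis unfolding is_arg_min_linorder by blast
qed

lemma proj_in: "proj y \<in> K"
  using proj_minimizes by blast

lemma proj_obtuse:
  assumes "z \<in> K"
  shows "vinner n (y - proj y) (z - proj y) \<le> 0"
proof (rule ccontr)
  define p where "p = proj y"
  define a where "a = vinner n (y - p) (z - p)"
  define b where "b = vinner n (z - p) (z - p)"
  assume "\<not> vinner n (y - proj y) (z - proj y) \<le> 0"
  then have "a > 0" by (simp add: a_def p_def)
  have "b \<ge> 0" by (simp add: b_def vinner_self_nonneg)
  \<comment> \<open>Step length from p towards z. The bound 1 keeps the new point in K; the other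
    bound makes the quadratic term e^2 b at most e a, so that the gain 2 e a prevails. The summand 1
    avoids a division by zero.\<close>
  define e where "e = min 1 (a / (b + 1))"
  have e: "0 < e" "e \<le> 1" "e * (b + 1) \<le> a"
  proof -
    have "e * (b + 1) \<le> a / (b + 1) * (b + 1)"
      unfolding e_def using \<open>b \<ge> 0\<close> by (intro mult_right_mono) auto
    then show "e * (b + 1) \<le> a" using \<open>b \<ge> 0\<close> by simp
  qed (use \<open>a > 0\<close> \<open>b \<ge> 0\<close> in \<open>auto simp: e_def\<close>)
  have "(1 - e) *\<^sub>R p + e *\<^sub>R z \<in> K"
    using convex_K proj_in[of y] assms e unfolding p_def convex_alt by auto
  moreover have eq: "y - ((1 - e) *\<^sub>R p + e *\<^sub>R z) = (y - p) - e *\<^sub>R (z - p)"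
    by (auto simp: fun_eq_iff scaleR_fun_def algebra_simps)
  ultimately have "vnorm n (y - p) \<le> vnorm n ((y - p) - e *\<^sub>R (z - p))"
    using proj_minimizes[of y] unfolding p_def by metis
  then have "(vnorm n (y - p))\<^sup>2 \<le> (vnorm n ((y - p) - e *\<^sub>R (z - p)))\<^sup>2"
    by (intro power_mono L2_set_nonneg)
  also have "\<dots> = (vnorm n (y - p))\<^sup>2 - 2 * e * a + e * (e * b)"
    unfolding vnorm_square a_def b_def
    by (simp add: vinner_simps vinner_commute algebra_simps)
  finally have "e * (2 * a) \<le> e * (e * b)" by (simp add: algebra_simps)
  then have "2 * a \<le> e * b" using e by simp
  moreover have "e * b \<le> e * (b + 1)" using e by (simp add: algebra_simps)
  ultimately show False using e \<open>a > 0\<close> by linarith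
qed

text \<open>Firm nonexpansiveness: the sum of the obtuse angle inequalities at y tested with
  \<open>proj x\<close> and at x tested with \<open>proj y\<close>. Both the Lipschitz bound and the
  monotonicity along coordinate lines follow from it.\<close>

lemma proj_monotone:
  "vinner n (proj x - proj y) (proj x - proj y) \<le> vinner n (x - y) (proj x - proj y)"
proof -
  have "vinner n (y - proj y) (proj x - proj y) + vinner n (x - proj x) (proj y - proj x) \<le> 0"
    using proj_obtuse[OF proj_in[of x], of y] proj_obtuse[OF proj_in[of y], of x] by linarith
  moreover have "vinner n (y - proj y) (proj x - proj y) + vinner n (x - proj x) (proj y - proj x)
      = vinner n (proj x - proj y) (proj x - proj y) - vinner n (x - y) (proj x - proj y)"
    unfolding vinner_simps by simp
  ultimately show ?thesis by simp
qed

lemma proj_nonexpansive: "vnorm n (proj x - proj y) \<le> vnorm n (x - y)"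
proof -
  have "(vnorm n (proj x - proj y))\<^sup>2 \<le> vnorm n (x - y) * vnorm n (proj x - proj y)"
    using proj_monotone[of x y] vinner_Cauchy_Schwarz[of n "x - y" "proj x - proj y"]
    by (simp add: vnorm_square)
  moreover have "0 \<le> vnorm n (proj x - proj y)" "0 \<le> vnorm n (x - y)"
    by (simp_all add: L2_set_nonneg)
  ultimately show ?thesis
    unfolding power2_eq_square by (cases "vnorm n (proj x - proj y) = 0") simp_all
qed

lemma proj_component_lipschitz: "\<bar>proj x i - proj y i\<bar> \<le> vnorm n (x - y)"
proof (cases "i < n")
  case True
  then show ?thesis
    using abs_le_vnorm[of i n "proj x - proj y"] proj_nonexpansive[of x y] by simp
next
  case False
  then show ?thesis
    using K_zero[OF proj_in, of i] L2_set_nonneg[of "x - y" "{..<n}"] by simp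
qed

text \<open>Continuity refers to the product topology. The seminorm \<open>vnorm n\<close> does not
  define it, but \<open>vnorm n (y - x)\<close> is continuous in y and dominates each coordinate of
  the increment.\<close>

lemma continuous_on_proj: "continuous_on S proj"
proof (rule continuous_on_coordinatewise_then_product)
  fix i
  show "continuous_on S (\<lambda>x. proj x i)"
    unfolding continuous_on_def
  proof
    fix x assume "x \<in> S"
    have "continuous_on S (\<lambda>y. vnorm n (y - x))"
      by (intro continuous_on_vnorm continuous_on_fun_diff continuous_on_id continuous_on_const)
    then have "((\<lambda>y. vnorm n (y - x)) \<longlongrightarrow> vnorm n (x - x)) (at x within S)"
      using \<open>x \<in> S\<close> unfolding continuous_on_def by blast
    then have "((\<lambda>y. vnorm n (y - x)) \<longlongrightarrow> 0) (at x within S)"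
      by (simp add: L2_set_def)
    then have "((\<lambda>y. proj y i - proj x i) \<longlongrightarrow> 0) (at x within S)"
      by (rule Lim_null_comparison[rotated]) (simp add: proj_component_lipschitz)
    then show "((\<lambda>y. proj y i) \<longlongrightarrow> proj x i) (at x within S)"
      by (simp add: LIM_zero_iff)
  qed
qed

end

section \<open>The likelihood ratio statistic as a convex function of the noise\<close>

lemma lrt_rescale: "lrt n K \<mu>\<^sub>0 \<sigma> h = lrt n K \<mu>\<^sub>0 1 (\<sigma> *\<^sub>R h)"
  by (simp add: lrt_def mu_seq_def)

lemma err_nonneg: "0 \<le> err n K \<mu>\<^sub>0 \<sigma> h"
  by (simp add: err_def)

lemma vnorm_scaleR_square: "(vnorm n (c *\<^sub>R x))\<^sup>2 = c\<^sup>2 * (vnorm n x)\<^sup>2"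
  unfolding vnorm_square vinner_simps by (simp add: power2_eq_square)

lemma lrt_le_vnorm: "lrt n K \<mu>\<^sub>0 \<sigma> h \<le> \<sigma>\<^sup>2 * (vnorm n h)\<^sup>2"
  by (simp add: lrt_def vnorm_scaleR_square)

lemma lrt_eq_err_plus:
  "lrt n K \<mu>\<^sub>0 \<sigma> h = err n K \<mu>\<^sub>0 \<sigma> h +
    2 * vinner n (mu_seq n K \<mu>\<^sub>0 \<sigma> h - \<mu>\<^sub>0 - \<sigma> *\<^sub>R h) (\<mu>\<^sub>0 - mu_seq n K \<mu>\<^sub>0 \<sigma> h)"
  unfolding lrt_def err_def vnorm_square
  by (simp add: vinner_simps vinner_commute algebra_simps)

text \<open>Expansion of |\<sigma> h - p|^2 with p the estimation error. Dropping \<open>err\<close>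
  gives the bound that Stein's identity evaluates; keeping it identifies the numerator in the
  derivative of lrt(\<tau>) / \<tau>.\<close>

lemma lrt_eq_minus_err:
  "lrt n K \<mu>\<^sub>0 \<sigma> h = 2 * \<sigma> * vinner n h (mu_seq n K \<mu>\<^sub>0 \<sigma> h - \<mu>\<^sub>0) - err n K \<mu>\<^sub>0 \<sigma> h"
  unfolding lrt_def err_def vnorm_square
  by (simp add: vinner_simps vinner_commute algebra_simps)

context closed_convex_set
begin

lemma mu_seq_in: "mu_seq n K \<mu>\<^sub>0 \<sigma> h \<in> K"
  by (simp add: mu_seq_def proj_in)

lemma mu_seq_obtuse:
  "z \<in> K \<Longrightarrow> vinner n (mu_seq n K \<mu>\<^sub>0 \<sigma> h - \<mu>\<^sub>0 - \<sigma> *\<^sub>R h) (z - mu_seq n K \<mu>\<^sub>0 \<sigma> h) \<ge> 0"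
  using proj_obtuse[of z "\<mu>\<^sub>0 + \<sigma> *\<^sub>R h"] by (simp add: mu_seq_def vinner_simps)

lemma err_le_lrt: "err n K \<mu>\<^sub>0 \<sigma> h \<le> lrt n K \<mu>\<^sub>0 \<sigma> h"
  using mu_seq_obtuse[OF center_in_K] by (simp add: lrt_eq_err_plus)

lemma lrt_nonneg: "0 \<le> lrt n K \<mu>\<^sub>0 \<sigma> h"
  using err_le_lrt err_nonneg order_trans by blast

text \<open>Convexity: F is the supremum over z in K of the affine functions 2 \<sigma> <h, z - mu0>
  - |z - mu0|^2, and z = p supports it at x. The gap is twice the obtuse angle inequality at y
  tested with p, plus |p - q|^2.\<close>

lemma lrt_lower_tangent:
  "lrt n K \<mu>\<^sub>0 \<sigma> x + 2 * \<sigma> * vinner n (y - x) (mu_seq n K \<mu>\<^sub>0 \<sigma> x - \<mu>\<^sub>0) \<le> lrt n K \<mu>\<^sub>0 \<sigma> y"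
proof -
  define p q where "p = mu_seq n K \<mu>\<^sub>0 \<sigma> x" and "q = mu_seq n K \<mu>\<^sub>0 \<sigma> y"
  have "lrt n K \<mu>\<^sub>0 \<sigma> y - (lrt n K \<mu>\<^sub>0 \<sigma> x + 2 * \<sigma> * vinner n (y - x) (p - \<mu>\<^sub>0))
      = 2 * vinner n (q - \<mu>\<^sub>0 - \<sigma> *\<^sub>R y) (p - q) + vinner n (p - q) (p - q)"
    unfolding lrt_def vnorm_square p_def[symmetric] q_def[symmetric]
    by (simp add: vinner_simps vinner_commute algebra_simps)
  also have "\<dots> \<ge> 0"
    using mu_seq_obtuse[OF mu_seq_in[of \<sigma> x], of \<sigma> y] vinner_self_nonneg[of n "p - q"]
    by (simp add: p_def q_def)
  finally show ?thesis by (simp add: p_def)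
qed

text \<open>The projection is 1-Lipschitz, so the gradient 2 \<sigma> (mu - mu0) of F is Lipschitz
  with constant 2 \<sigma>^2. The gap is twice the obtuse angle inequality at x tested with q, plus
  |\<sigma> (y - x) - (q - p)|^2.\<close>

lemma lrt_upper_tangent:
  "lrt n K \<mu>\<^sub>0 \<sigma> y \<le> lrt n K \<mu>\<^sub>0 \<sigma> x
    + 2 * \<sigma> * vinner n (y - x) (mu_seq n K \<mu>\<^sub>0 \<sigma> x - \<mu>\<^sub>0) + \<sigma>\<^sup>2 * (vnorm n (y - x))\<^sup>2"
proof -
  define p q where "p = mu_seq n K \<mu>\<^sub>0 \<sigma> x" and "q = mu_seq n K \<mu>\<^sub>0 \<sigma> y"
  define d where "d = \<sigma> *\<^sub>R (y - x) - (q - p)"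
  have "lrt n K \<mu>\<^sub>0 \<sigma> x + 2 * \<sigma> * vinner n (y - x) (p - \<mu>\<^sub>0) + \<sigma>\<^sup>2 * (vnorm n (y - x))\<^sup>2
      - lrt n K \<mu>\<^sub>0 \<sigma> y = 2 * vinner n (p - \<mu>\<^sub>0 - \<sigma> *\<^sub>R x) (q - p) + vinner n d d"
    unfolding lrt_def vnorm_square p_def[symmetric] q_def[symmetric] d_def
    by (simp add: vinner_simps vinner_commute algebra_simps power2_eq_square)
  also have "\<dots> \<ge> 0"
    using mu_seq_obtuse[OF mu_seq_in[of \<sigma> y], of \<sigma> x] vinner_self_nonneg[of n d]
    by (simp add: p_def q_def)
  finally show ?thesis by (simp add: p_def)
qed

text \<open>The two tangent bounds squeeze the difference quotient to within |e| |h|^2 of its limit,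
  without differentiating the projection. The scale is moved into the noise: both bounds are taken
  at scale 1, at the points \<tau> h and (\<tau> + e) h.\<close>

lemma lrt_has_derivative_ray:
  "((\<lambda>\<tau>. lrt n K \<mu>\<^sub>0 \<tau> h) has_real_derivative 2 * vinner n h (mu_seq n K \<mu>\<^sub>0 \<tau> h - \<mu>\<^sub>0)) (at \<tau>)"
proof -
  define D where "D = 2 * vinner n h (mu_seq n K \<mu>\<^sub>0 \<tau> h - \<mu>\<^sub>0)"
  have eq: "mu_seq n K \<mu>\<^sub>0 1 (\<tau> *\<^sub>R h) = mu_seq n K \<mu>\<^sub>0 \<tau> h"
    by (simp add: mu_seq_def)
  have diff: "(\<tau> + e) *\<^sub>R h - \<tau> *\<^sub>R h = e *\<^sub>R h" for e
    by (simp add: scaleR_fun_def fun_eq_iff algebra_simps)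
  have lo: "lrt n K \<mu>\<^sub>0 \<tau> h + e * D \<le> lrt n K \<mu>\<^sub>0 (\<tau> + e) h" for e
    using lrt_lower_tangent[of 1 "\<tau> *\<^sub>R h" "(\<tau> + e) *\<^sub>R h"]
    unfolding lrt_rescale[of _ _ _ "\<tau> + e"] lrt_rescale[of _ _ _ \<tau>] diff eq
    by (simp add: vinner_simps D_def algebra_simps)
  have up: "lrt n K \<mu>\<^sub>0 (\<tau> + e) h \<le> lrt n K \<mu>\<^sub>0 \<tau> h + e * D + e\<^sup>2 * (vnorm n h)\<^sup>2" for e
    using lrt_upper_tangent[of 1 "(\<tau> + e) *\<^sub>R h" "\<tau> *\<^sub>R h"]
    unfolding lrt_rescale[of _ _ _ "\<tau> + e"] lrt_rescale[of _ _ _ \<tau>] diff eq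
    by (simp add: vnorm_scaleR_square) (simp add: vinner_simps D_def algebra_simps)
  have "\<bar>(lrt n K \<mu>\<^sub>0 (\<tau> + e) h - lrt n K \<mu>\<^sub>0 \<tau> h) / e - D\<bar> \<le> \<bar>e\<bar> * (vnorm n h)\<^sup>2" if "e \<noteq> 0" for e
  proof -
    have "\<bar>lrt n K \<mu>\<^sub>0 (\<tau> + e) h - lrt n K \<mu>\<^sub>0 \<tau> h - e * D\<bar> \<le> e\<^sup>2 * (vnorm n h)\<^sup>2"
      using lo[of e] up[of e] by linarith
    then have "\<bar>lrt n K \<mu>\<^sub>0 (\<tau> + e) h - lrt n K \<mu>\<^sub>0 \<tau> h - e * D\<bar> / \<bar>e\<bar> \<le> e\<^sup>2 * (vnorm n h)\<^sup>2 / \<bar>e\<bar>"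
      by (intro divide_right_mono) auto
    also have "e\<^sup>2 * (vnorm n h)\<^sup>2 / \<bar>e\<bar> = \<bar>e\<bar> * (vnorm n h)\<^sup>2"
      using that by (simp add: power2_eq_square[of e] field_simps flip: abs_mult)
    also have "\<bar>lrt n K \<mu>\<^sub>0 (\<tau> + e) h - lrt n K \<mu>\<^sub>0 \<tau> h - e * D\<bar> / \<bar>e\<bar> =
        \<bar>(lrt n K \<mu>\<^sub>0 (\<tau> + e) h - lrt n K \<mu>\<^sub>0 \<tau> h) / e - D\<bar>"
      using that by (simp add: diff_divide_distrib flip: abs_divide)
    finally show ?thesis .
  qed
  then have "eventually (\<lambda>e. norm ((lrt n K \<mu>\<^sub>0 (\<tau> + e) h - lrt n K \<mu>\<^sub>0 \<tau> h) / e - D)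
      \<le> \<bar>e\<bar> * (vnorm n h)\<^sup>2) (at 0)"
    by (auto simp: eventually_at intro!: exI[of _ 1])
  moreover have "((\<lambda>e. \<bar>e\<bar> * (vnorm n h)\<^sup>2) \<longlongrightarrow> 0) (at 0)"
    by (auto intro!: tendsto_eq_intros)
  ultimately have "((\<lambda>e. (lrt n K \<mu>\<^sub>0 (\<tau> + e) h - lrt n K \<mu>\<^sub>0 \<tau> h) / e - D) \<longlongrightarrow> 0) (at 0)"
    by (rule Lim_null_comparison)
  then show ?thesis
    unfolding DERIV_def D_def by (simp add: LIM_zero_iff)
qed

lemma lrt_over_scale_has_derivative:
  assumes "0 < \<tau>"
  shows "((\<lambda>\<tau>. lrt n K \<mu>\<^sub>0 \<tau> h / \<tau>) has_real_derivative err n K \<mu>\<^sub>0 \<tau> h / \<tau>\<^sup>2) (at \<tau>)"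
proof -
  have "2 * vinner n h (mu_seq n K \<mu>\<^sub>0 \<tau> h - \<mu>\<^sub>0) * \<tau> - lrt n K \<mu>\<^sub>0 \<tau> h * 1 = err n K \<mu>\<^sub>0 \<tau> h"
    by (simp add: lrt_eq_minus_err)
  then show ?thesis
    using DERIV_divide[OF lrt_has_derivative_ray DERIV_ident, of \<tau> h] assms
    by (simp add: power2_eq_square)
qed

lemma lrt_integral_formula:
  assumes "0 < \<sigma>"
  shows "((\<lambda>\<tau>. err n K \<mu>\<^sub>0 \<tau> h / \<tau>\<^sup>2) has_integral lrt n K \<mu>\<^sub>0 \<sigma> h / \<sigma>) {0..\<sigma>}"
proof -
  define F where "F = (\<lambda>\<tau>. lrt n K \<mu>\<^sub>0 \<tau> h / \<tau>)"
  \<comment> \<open>Division by zero makes \<open>F 0 = 0\<close>, and \<open>lrt_le_vnorm\<close>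
    gives F \<tau> = O(\<tau>). So F is continuous at the end point 0, where the interior form of
    the fundamental theorem asks for no derivative.\<close>
  have at0: "(F \<longlongrightarrow> F 0) (at 0 within {0..\<sigma>})"
  proof -
    have "norm (F \<tau> - F 0) \<le> \<tau> * (vnorm n h)\<^sup>2" if "\<tau> \<in> {0..\<sigma>}" for \<tau>
    proof (cases "\<tau> = 0")
      case False
      then have "\<tau> > 0" using that by simp
      then show ?thesis
        using lrt_le_vnorm[of n K \<mu>\<^sub>0 \<tau> h] lrt_nonneg[of \<tau> h]
        by (simp add: F_def field_simps power2_eq_square)
    qed (simp add: F_def)
    then have "eventually (\<lambda>\<tau>. norm (F \<tau> - F 0) \<le> \<tau> * (vnorm n h)\<^sup>2) (at 0 within {0..\<sigma>})"
      by (auto simp: eventually_at intro!: exI[of _ 1])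
    moreover have "((\<lambda>\<tau>. \<tau> * (vnorm n h)\<^sup>2) \<longlongrightarrow> 0) (at 0 within {0..\<sigma>})"
      by (auto intro!: tendsto_eq_intros)
    ultimately have "((\<lambda>\<tau>. F \<tau> - F 0) \<longlongrightarrow> 0) (at 0 within {0..\<sigma>})"
      by (rule Lim_null_comparison)
    then show ?thesis by (simp add: LIM_zero_iff)
  qed
  have cont: "continuous_on {0..\<sigma>} F"
    unfolding continuous_on_def
  proof
    fix \<tau> assume "\<tau> \<in> {0..\<sigma>}"
    show "(F \<longlongrightarrow> F \<tau>) (at \<tau> within {0..\<sigma>})"
    proof (cases "\<tau> = 0")
      case True then show ?thesis using at0 by simp
    next
      case False
      then have "isCont F \<tau>"
        using lrt_over_scale_has_derivative[of \<tau> h] \<open>\<tau> \<in> {0..\<sigma>}\<close> unfolding F_def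
        by (intro DERIV_isCont) auto
      then show ?thesis
        by (simp add: isCont_def tendsto_within_subset[of F _ _ UNIV])
    qed
  qed
  have "((\<lambda>\<tau>. err n K \<mu>\<^sub>0 \<tau> h / \<tau>\<^sup>2) has_integral (F \<sigma> - F 0)) {0..\<sigma>}"
    using assms cont
    by (intro fundamental_theorem_of_calculus_interior)
      (auto simp: F_def has_real_derivative_iff_has_vector_derivative[symmetric]
        intro!: lrt_over_scale_has_derivative)
  then show ?thesis by (simp add: F_def)
qed

text \<open>The integral evaluates exactly and turns the right-hand side into 2 lrt - err, so the
  inequality is \<open>err_le_lrt\<close> again.\<close>

lemma lrt_upper_integral:
  assumes "0 < \<sigma>"
  shows "(\<lambda>\<tau>. err n K \<mu>\<^sub>0 \<tau> h / \<tau>\<^sup>2 - err n K \<mu>\<^sub>0 \<sigma> h / \<sigma>\<^sup>2) integrable_on {0..\<sigma>}"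
    and "lrt n K \<mu>\<^sub>0 \<sigma> h \<le> err n K \<mu>\<^sub>0 \<sigma> h + 2 * \<sigma> *
      integral {0..\<sigma>} (\<lambda>\<tau>. err n K \<mu>\<^sub>0 \<tau> h / \<tau>\<^sup>2 - err n K \<mu>\<^sub>0 \<sigma> h / \<sigma>\<^sup>2)"
proof -
  let ?J = "lrt n K \<mu>\<^sub>0 \<sigma> h / \<sigma> - \<sigma> * (err n K \<mu>\<^sub>0 \<sigma> h / \<sigma>\<^sup>2)"
  have "((\<lambda>\<tau>. err n K \<mu>\<^sub>0 \<tau> h / \<tau>\<^sup>2 - err n K \<mu>\<^sub>0 \<sigma> h / \<sigma>\<^sup>2) has_integral ?J) {0..\<sigma>}"
    using has_integral_const_real[of "err n K \<mu>\<^sub>0 \<sigma> h / \<sigma>\<^sup>2" 0 \<sigma>] assms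
    by (intro has_integral_diff lrt_integral_formula) (auto simp: content_real)
  note * = this
  then show "(\<lambda>\<tau>. err n K \<mu>\<^sub>0 \<tau> h / \<tau>\<^sup>2 - err n K \<mu>\<^sub>0 \<sigma> h / \<sigma>\<^sup>2) integrable_on {0..\<sigma>}"
    by (rule has_integral_integrable)
  have "2 * \<sigma> * ?J = 2 * lrt n K \<mu>\<^sub>0 \<sigma> h - 2 * err n K \<mu>\<^sub>0 \<sigma> h"
    using assms by (simp add: field_simps power2_eq_square)
  then show "lrt n K \<mu>\<^sub>0 \<sigma> h \<le> err n K \<mu>\<^sub>0 \<sigma> h + 2 * \<sigma> *
      integral {0..\<sigma>} (\<lambda>\<tau>. err n K \<mu>\<^sub>0 \<tau> h / \<tau>\<^sup>2 - err n K \<mu>\<^sub>0 \<sigma> h / \<sigma>\<^sup>2)"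
    unfolding integral_unique[OF *] using err_le_lrt[of \<sigma> h] by linarith
qed

lemma lrt_upper_cone:
  assumes "cone K" "mu_seq n K \<mu>\<^sub>0 \<sigma> h - \<nu> \<in> K"
  shows "lrt n K \<mu>\<^sub>0 \<sigma> h \<le> err n K \<mu>\<^sub>0 \<sigma> h +
    2 * vinner n (mu_seq n K \<mu>\<^sub>0 \<sigma> h - \<mu>\<^sub>0 - \<sigma> *\<^sub>R h) (\<mu>\<^sub>0 - \<nu>)"
proof -
  define p where "p = mu_seq n K \<mu>\<^sub>0 \<sigma> h"
  define r where "r = p - \<mu>\<^sub>0 - \<sigma> *\<^sub>R h"
  have pK: "p \<in> K" by (simp add: p_def mu_seq_in)
  have ob: "vinner n r (z - p) \<ge> 0" if "z \<in> K" for z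
    using mu_seq_obtuse[OF that] by (simp add: p_def r_def)
  \<comment> \<open>Testing the obtuse angle inequality with 0 and 2 p shows that the residual r is
    orthogonal to p. Testing it with p - \<nu> then gives <r, \<nu>> \<le> 0.\<close>
  have "0 *\<^sub>R p \<in> K"
    using \<open>cone K\<close> pK unfolding cone_def by (metis order_refl)
  then have "vinner n r p \<le> 0"
    using ob[of "0 *\<^sub>R p"] by (simp add: vinner_simps del: scaleR_zero_left)
  moreover have "vinner n r ((p - \<nu>) - p) \<ge> 0"
    using assms(2) unfolding p_def[symmetric] by (rule ob)
  moreover have "2 *\<^sub>R p \<in> K"
    using \<open>cone K\<close> pK unfolding cone_def by simp
  then have "vinner n r p \<ge> 0"
    using ob[of "2 *\<^sub>R p"] by (simp add: vinner_simps)
  ultimately have "vinner n r (\<mu>\<^sub>0 - p) \<le> vinner n r (\<mu>\<^sub>0 - \<nu>)"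
    unfolding vinner_simps by linarith
  then show ?thesis by (simp add: lrt_eq_err_plus p_def r_def)
qed

end

section \<open>The Prekopa--Leindler inequality on the line\<close>

text \<open>Substitute for the maximum of A, which a Borel set of finite measure may lack: almost
  none of A lies to the right of a.\<close>

lemma small_upper_tail:
  fixes A :: "real set"
  assumes A: "A \<in> sets borel" "A \<noteq> {}" "emeasure lborel A < \<infinity>" and "0 < e"
  obtains a where "a \<in> A" "emeasure lborel (A \<inter> {a<..}) \<le> ennreal e"
proof -
  have "(\<lambda>k. emeasure lborel (A \<inter> {real k<..})) \<longlonglongrightarrow> emeasure lborel (\<Inter>k. A \<inter> {real k<..})"
  proof (rule Lim_emeasure_decseq)
    show "emeasure lborel (A \<inter> {real i<..}) \<noteq> \<infinity>" for i
      using emeasure_mono[of "A \<inter> {real i<..}" A lborel] A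
      by (auto simp: top_unique less_top[symmetric])
  qed (use A in \<open>auto simp: decseq_def\<close>)
  also have "(\<Inter>k. A \<inter> {real k<..}) = {}"
  proof -
    have "\<exists>k. \<not> real k < x" for x
      using reals_Archimedean2[of x] by (auto intro: less_asym)
    then show ?thesis by auto
  qed
  finally have "(\<lambda>k. emeasure lborel (A \<inter> {real k<..})) \<longlonglongrightarrow> 0" by simp
  then have "eventually (\<lambda>k. emeasure lborel (A \<inter> {real k<..}) < ennreal e) sequentially"
    using \<open>0 < e\<close> by (intro order_tendstoD(2)) auto
  then obtain k where k: "emeasure lborel (A \<inter> {real k<..}) < ennreal e"
    by (auto simp: eventually_sequentially)
  show thesis
  \<comment> \<open>Little of A lies beyond k. Either a point of A can be taken there, or A is
    bounded above and a point within e of its supremum leaves a tail inside an interval shorter than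
    e.\<close>
  proof (cases "A \<inter> {real k<..} = {}")
    case False
    then obtain a where a: "a \<in> A" "real k < a" by auto
    have "emeasure lborel (A \<inter> {a<..}) \<le> emeasure lborel (A \<inter> {real k<..})"
      using a A by (intro emeasure_mono) auto
    then show thesis using k by (intro that[OF a(1)]) auto
  next
    case True
    then have bdd: "bdd_above A" by (intro bdd_aboveI[of _ "real k"]) (auto simp: not_less[symmetric] disjoint_iff)
    obtain a where a: "a \<in> A" "Sup A - e < a"
      using less_cSup_iff[OF A(2) bdd, of "Sup A - e"] \<open>0 < e\<close> by auto
    have "a \<le> Sup A" using a bdd by (simp add: cSup_upper)
    have "A \<inter> {a<..} \<subseteq> {a..Sup A}"
      using bdd by (auto simp: cSup_upper)
    then have "emeasure lborel (A \<inter> {a<..}) \<le> emeasure lborel {a..Sup A}"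
      by (intro emeasure_mono) auto
    also have "\<dots> \<le> ennreal e" using a \<open>a \<le> Sup A\<close> by (simp add: ennreal_leI)
    finally show thesis using that a by blast
  qed
qed

lemma small_lower_tail:
  fixes A :: "real set"
  assumes A: "A \<in> sets borel" "A \<noteq> {}" "emeasure lborel A < \<infinity>" and "0 < e"
  obtains a where "a \<in> A" "emeasure lborel (A \<inter> {..<a}) \<le> ennreal e"
proof -
  have refl: "emeasure lborel (uminus -` S) = emeasure lborel S" if "S \<in> sets borel" for S :: "real set"
  proof -
    have "emeasure lborel S = emeasure (distr lborel borel uminus) S"
      by (simp add: lborel_distr_uminus)
    also have "\<dots> = emeasure lborel (uminus -` S)"
      using that by (subst emeasure_distr) auto
    finally show ?thesis ..
  qed
  have mu: "uminus -` S \<in> sets borel" if "S \<in> sets borel" for S :: "real set"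
    using that by (intro measurable_sets_borel[of _ borel]) auto
  have "uminus -` A \<noteq> {}" using A(2) by (auto simp: ex_in_conv[symmetric] intro: exI[of _ "- _"])
  then obtain b where b: "b \<in> uminus -` A" "emeasure lborel (uminus -` A \<inter> {b<..}) \<le> ennreal e"
    using small_upper_tail[of "uminus -` A" e] A mu[OF A(1)] \<open>0 < e\<close> by (auto simp: refl[OF A(1)])
  have "uminus -` A \<inter> {b<..} = uminus -` (A \<inter> {..<-b})" by auto
  then have "emeasure lborel (A \<inter> {..<-b}) \<le> ennreal e"
    using b(2) refl[of "A \<inter> {..<-b}"] A(1) by simp
  then show thesis using that[of "-b"] b by auto
qed

lemma emeasure_affine_image:
  fixes S :: "real set"
  assumes "S \<in> sets borel"
  shows "emeasure lebesgue ((\<lambda>x. m * x + c) ` S) = ennreal \<bar>m\<bar> * emeasure lborel S"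
  using emeasure_lebesgue_affine[of m c S] assms by (simp add: emeasure_completion)

text \<open>With a almost the right end of A and b almost the left end of B, C contains the affine
  copies (1 - t) A + t b, up to the common point p, and (1 - t) a + t B, from p on. These are
  essentially disjoint, so their measures add up.\<close>

lemma Brunn_Minkowski_real:
  fixes A B C :: "real set"
  assumes A: "A \<in> sets borel" "A \<noteq> {}" "emeasure lborel A < \<infinity>"
    and B: "B \<in> sets borel" "B \<noteq> {}" "emeasure lborel B < \<infinity>"
    and C: "C \<in> sets borel" and t: "0 < t" "t < 1"
    and sub: "\<And>x y. x \<in> A \<Longrightarrow> y \<in> B \<Longrightarrow> (1 - t) * x + t * y \<in> C"
  shows "ennreal (1 - t) * emeasure lborel A + ennreal t * emeasure lborel B \<le> emeasure lborel C"
proof (rule ennreal_le_epsilon)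
  fix e :: real assume "0 < e"
  obtain a where a: "a \<in> A" "emeasure lborel (A \<inter> {a<..}) \<le> ennreal e"
    using small_upper_tail[OF A \<open>0 < e\<close>] .
  obtain b where b: "b \<in> B" "emeasure lborel (B \<inter> {..<b}) \<le> ennreal e"
    using small_lower_tail[OF B \<open>0 < e\<close>] .
  define p where "p = (1 - t) * a + t * b"
  have "ennreal (1 - t) * emeasure lborel (A \<inter> {..a}) =
      emeasure lebesgue ((\<lambda>x. (1 - t) * x + t * b) ` (A \<inter> {..a}))"
    using A t by (subst emeasure_affine_image) auto
  also have "\<dots> \<le> emeasure lebesgue (C \<inter> {..p})"
    using C t b by (intro emeasure_mono) (auto simp: p_def intro!: sub mult_left_mono)
  finally have 1: "ennreal (1 - t) * emeasure lborel (A \<inter> {..a}) \<le> emeasure lborel (C \<inter> {..p})"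
    using C by (simp add: emeasure_completion)
  have "ennreal t * emeasure lborel (B \<inter> {b..}) =
      emeasure lebesgue ((\<lambda>x. t * x + (1 - t) * a) ` (B \<inter> {b..}))"
    using B t by (subst emeasure_affine_image) auto
  also have "\<dots> \<le> emeasure lebesgue (C \<inter> {p..})"
    using C t a
    by (intro emeasure_mono) (auto simp: p_def add.commute[of "t * _"] intro!: sub mult_left_mono)
  also have "\<dots> = emeasure lborel (C \<inter> {p..})"
    using C by (simp add: emeasure_completion)
  \<comment> \<open>Both copies contain p; this null point is given to the left one so that C splits
    disjointly.\<close>
  also have "\<dots> \<le> emeasure lborel ((C \<inter> {p<..}) \<union> {p})"
    using C by (intro emeasure_mono) auto
  also have "\<dots> \<le> emeasure lborel (C \<inter> {p<..}) + emeasure lborel {p}"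
    using C by (intro emeasure_subadditive) auto
  finally have 2: "ennreal t * emeasure lborel (B \<inter> {b..}) \<le> emeasure lborel (C \<inter> {p<..})" by simp
  have "emeasure lborel C = emeasure lborel ((C \<inter> {..p}) \<union> (C \<inter> {p<..}))"
    by (rule arg_cong[of _ _ "emeasure lborel"]) auto
  also have "\<dots> = emeasure lborel (C \<inter> {..p}) + emeasure lborel (C \<inter> {p<..})"
    using C by (subst plus_emeasure) auto
  finally have 3: "emeasure lborel C = emeasure lborel (C \<inter> {..p}) + emeasure lborel (C \<inter> {p<..})" .
  have "emeasure lborel A \<le> emeasure lborel (A \<inter> {..a}) + emeasure lborel (A \<inter> {a<..})"
    using A by (subst plus_emeasure) (auto intro!: emeasure_mono)
  then have 4: "emeasure lborel A \<le> emeasure lborel (A \<inter> {..a}) + ennreal e"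
    using a(2) by (meson add_left_mono order_trans)
  have "emeasure lborel B \<le> emeasure lborel (B \<inter> {b..}) + emeasure lborel (B \<inter> {..<b})"
    using B by (subst plus_emeasure) (auto intro!: emeasure_mono)
  then have 5: "emeasure lborel B \<le> emeasure lborel (B \<inter> {b..}) + ennreal e"
    using b(2) by (meson add_left_mono order_trans)
  have "ennreal (1 - t) * emeasure lborel A + ennreal t * emeasure lborel B
      \<le> ennreal (1 - t) * (emeasure lborel (A \<inter> {..a}) + ennreal e)
        + ennreal t * (emeasure lborel (B \<inter> {b..}) + ennreal e)"
    by (intro add_mono mult_left_mono 4 5) auto
  also have "\<dots> = (ennreal (1 - t) * emeasure lborel (A \<inter> {..a}) + ennreal t * emeasure lborel (B \<inter> {b..}))
      + (ennreal (1 - t) * ennreal e + ennreal t * ennreal e)"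
    by (simp add: distrib_left add_ac)
  \<comment> \<open>The two discarded tails carry the weights 1 - t and t, so the total loss is
    e.\<close>
  also have "ennreal (1 - t) * ennreal e + ennreal t * ennreal e = ennreal e"
    using t \<open>0 < e\<close> by (simp add: ennreal_mult[symmetric] ennreal_plus[symmetric] algebra_simps
        del: ennreal_plus)
  also have "ennreal (1 - t) * emeasure lborel (A \<inter> {..a}) + ennreal t * emeasure lborel (B \<inter> {b..})
      \<le> emeasure lborel C"
    unfolding 3 by (intro add_mono 1 2)
  finally show "ennreal (1 - t) * emeasure lborel A + ennreal t * emeasure lborel B
      \<le> emeasure lborel C + ennreal e" by (simp add: add_right_mono)
qed

text \<open>Tonelli's theorem for the region between the axis and the graph of f.\<close>

lemma nn_integral_layer_cake:
  fixes f :: "real \<Rightarrow> real"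
  assumes [measurable]: "f \<in> borel_measurable borel" and nonneg: "\<And>x. 0 \<le> f x"
  shows "(\<integral>\<^sup>+x. f x \<partial>lborel) = (\<integral>\<^sup>+l. emeasure lborel {x. l < f x} * indicator {0<..} l \<partial>lborel)"
proof -
  have "(\<integral>\<^sup>+x. f x \<partial>lborel) = (\<integral>\<^sup>+x. (\<integral>\<^sup>+l. indicator {y. 0 < snd y \<and> snd y < f (fst y)} (x, l) \<partial>lborel) \<partial>lborel)"
  proof (rule nn_integral_cong)
    fix x
    have "(\<integral>\<^sup>+l. indicator {y. 0 < snd y \<and> snd y < f (fst y)} (x, l) \<partial>lborel)
        = (\<integral>\<^sup>+l. indicator {0<..<f x} l \<partial>lborel)"
      by (intro nn_integral_cong) (auto simp: indicator_def)
    also have "\<dots> = ennreal (f x)" using nonneg by simp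
    finally show "ennreal (f x) = (\<integral>\<^sup>+l. indicator {y. 0 < snd y \<and> snd y < f (fst y)} (x, l) \<partial>lborel)" ..
  qed
  also have "\<dots> = (\<integral>\<^sup>+l. (\<integral>\<^sup>+x. indicator {y. 0 < snd y \<and> snd y < f (fst y)} (x, l) \<partial>lborel) \<partial>lborel)"
    by (rule lborel_pair.Fubini'[symmetric]) measurable
  also have "\<dots> = (\<integral>\<^sup>+l. emeasure lborel {x. l < f x} * indicator {0<..} l \<partial>lborel)"
  proof (rule nn_integral_cong)
    fix l
    have "(\<integral>\<^sup>+x. indicator {y. 0 < snd y \<and> snd y < f (fst y)} (x, l) \<partial>lborel)
        = (\<integral>\<^sup>+x. indicator {x. l < f x} x * indicator {0<..} l \<partial>lborel)"
      by (intro nn_integral_cong) (auto simp: indicator_def)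
    also have "\<dots> = emeasure lborel {x. l < f x} * indicator {0<..} l"
      by (subst nn_integral_multc) auto
    finally show "(\<integral>\<^sup>+x. indicator {y. 0 < snd y \<and> snd y < f (fst y)} (x, l) \<partial>lborel)
        = emeasure lborel {x. l < f x} * indicator {0<..} l" .
  qed
  finally show ?thesis .
qed

text \<open>Markov's inequality. It supplies the finite measures that Brunn--Minkowski asks for, at
  every positive level.\<close>

lemma emeasure_superlevel_finite:
  fixes f :: "real \<Rightarrow> real"
  assumes f: "integrable lborel f" and nonneg: "\<And>x. 0 \<le> f x" and "0 < l"
  shows "emeasure lborel {x. l < f x} < \<infinity>"
proof -
  have [measurable]: "f \<in> borel_measurable borel" using f by auto
  have "emeasure lborel {x. l < f x} = (\<integral>\<^sup>+x. indicator {x. l < f x} x \<partial>lborel)"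
    by (simp add: nn_integral_indicator)
  also have "\<dots> \<le> (\<integral>\<^sup>+x. ennreal (f x / l) \<partial>lborel)"
    using \<open>0 < l\<close> nonneg by (intro nn_integral_mono) (auto simp: indicator_def)
  also have "\<dots> = ennreal (\<integral>x. f x / l \<partial>lborel)"
    using \<open>0 < l\<close> nonneg f by (intro nn_integral_eq_integral) auto
  also have "\<dots> < \<infinity>" by simp
  finally show ?thesis .
qed

text \<open>Under the normalisation \<open>sup f = sup g = 1\<close> the superlevel sets of \<open>f\<close> and \<open>g\<close> are
  non-empty for the same levels, and one-dimensional Brunn--Minkowski applies to each of them.\<close>

lemma Prekopa_Leindler_normalized:
  fixes f g h :: "real \<Rightarrow> real"
  assumes f: "integrable lborel f" "\<And>x. 0 \<le> f x" "\<And>x. f x \<le> 1" "\<And>l. l < 1 \<Longrightarrow> \<exists>x. l < f x"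
    and g: "integrable lborel g" "\<And>x. 0 \<le> g x" "\<And>x. g x \<le> 1" "\<And>l. l < 1 \<Longrightarrow> \<exists>x. l < g x"
    and h: "integrable lborel h" "\<And>x. 0 \<le> h x"
    and t: "0 < t" "t < 1"
    and le: "\<And>x y l. 0 < l \<Longrightarrow> l < f x \<Longrightarrow> l < g y \<Longrightarrow> l < h ((1 - t) * x + t * y)"
  shows "(1 - t) * (\<integral>x. f x \<partial>lborel) + t * (\<integral>x. g x \<partial>lborel) \<le> (\<integral>x. h x \<partial>lborel)"
proof -
  have [measurable]: "f \<in> borel_measurable borel" "g \<in> borel_measurable borel" "h \<in> borel_measurable borel"
    using f g h by auto
  have level: "ennreal (1 - t) * emeasure lborel {x. l < f x} + ennreal t * emeasure lborel {x. l < g x}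
      \<le> emeasure lborel {x. l < h x}" if "0 < l" for l
  proof (cases "l < 1")
    case True
    then show ?thesis
      using f(4) g(4) t le that emeasure_superlevel_finite[OF f(1,2) that]
        emeasure_superlevel_finite[OF g(1,2) that]
      by (intro Brunn_Minkowski_real) auto
  next
    case False
    then have "\<not> l < f x" "\<not> l < g x" for x
      using f(3)[of x] g(3)[of x] by auto
    then show ?thesis by simp
  qed
  have "ennreal (1 - t) * (\<integral>\<^sup>+x. f x \<partial>lborel) + ennreal t * (\<integral>\<^sup>+x. g x \<partial>lborel) =
      (\<integral>\<^sup>+l. ennreal (1 - t) * (emeasure lborel {x. l < f x} * indicator {0<..} l)
        + ennreal t * (emeasure lborel {x. l < g x} * indicator {0<..} l) \<partial>lborel)"
    unfolding nn_integral_layer_cake[OF \<open>f \<in> _\<close> f(2)] nn_integral_layer_cake[OF \<open>g \<in> _\<close> g(2)]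
    by (subst nn_integral_add) (auto simp: nn_integral_cmult)
  also have "\<dots> \<le> (\<integral>\<^sup>+l. emeasure lborel {x. l < h x} * indicator {0<..} l \<partial>lborel)"
    using level by (intro nn_integral_mono) (auto simp: indicator_def)
  also have "\<dots> = (\<integral>\<^sup>+x. h x \<partial>lborel)"
    using h by (intro nn_integral_layer_cake[symmetric]) auto
  finally have "ennreal (1 - t) * (\<integral>\<^sup>+x. f x \<partial>lborel) + ennreal t * (\<integral>\<^sup>+x. g x \<partial>lborel)
      \<le> (\<integral>\<^sup>+x. h x \<partial>lborel)" .
  then have "ennreal ((1 - t) * (\<integral>x. f x \<partial>lborel) + t * (\<integral>x. g x \<partial>lborel)) \<le> ennreal (\<integral>x. h x \<partial>lborel)"
    using f g h t by (simp add: nn_integral_eq_integral ennreal_mult ennreal_plus)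
  then show ?thesis
    using h by (subst (asm) ennreal_le_iff) auto
qed

text \<open>Division of f and g by their suprema F and G, and of h by F^(1-t) G^t, preserves the
  pointwise hypothesis. The normalised case gives an arithmetic mean of integrals, which Young's
  inequality bounds below by the geometric mean; the normalising factors then cancel.\<close>

lemma Prekopa_Leindler_real:
  fixes f g h :: "real \<Rightarrow> real"
  assumes f: "integrable lborel f" "\<And>x. 0 \<le> f x" "bdd_above (range f)"
    and g: "integrable lborel g" "\<And>x. 0 \<le> g x" "bdd_above (range g)"
    and h: "integrable lborel h" "\<And>x. 0 \<le> h x"
    and t: "0 < t" "t < 1"
    and le: "\<And>x y. f x powr (1 - t) * g y powr t \<le> h ((1 - t) * x + t * y)"
  shows "(\<integral>x. f x \<partial>lborel) powr (1 - t) * (\<integral>x. g x \<partial>lborel) powr t \<le> (\<integral>x. h x \<partial>lborel)"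
proof -
  define F G where "F = Sup (range f)" and "G = Sup (range g)"
  have fF: "f x \<le> F" and gG: "g x \<le> G" for x
    using f(3) g(3) by (auto simp: F_def G_def intro: cSup_upper)
  have "0 \<le> F" "0 \<le> G" using order_trans[OF f(2) fF] order_trans[OF g(2) gG] by auto
  have h_int: "0 \<le> (\<integral>x. h x \<partial>lborel)" using h by simp
  show ?thesis
  proof (cases "F = 0 \<or> G = 0")
    case True
    then have "(\<forall>x. f x = 0) \<or> (\<forall>x. g x = 0)"
      using fF gG f(2) g(2) by (metis order_antisym)
    then show ?thesis using h_int by auto
  next
    case False
    then have "F > 0" "G > 0" using \<open>0 \<le> F\<close> \<open>0 \<le> G\<close> by auto
    define H where "H = F powr (1 - t) * G powr t"
    have "H > 0" using \<open>F > 0\<close> \<open>G > 0\<close> by (simp add: H_def)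
    define a b where "a = (\<integral>x. f x / F \<partial>lborel)" and "b = (\<integral>x. g x / G \<partial>lborel)"
    have "(1 - t) * a + t * b \<le> (\<integral>x. h x / H \<partial>lborel)"
      unfolding a_def b_def
    proof (rule Prekopa_Leindler_normalized)
      show "\<exists>x. l < f x / F" if "l < 1" for l
      proof -
        have "l * F < Sup (range f)" using that \<open>F > 0\<close> by (simp add: F_def[symmetric])
        then show ?thesis using less_cSup_iff[of "range f" "l * F"] f(3) \<open>F > 0\<close>
          by (auto simp: pos_less_divide_eq)
      qed
      show "\<exists>x. l < g x / G" if "l < 1" for l
      proof -
        have "l * G < Sup (range g)" using that \<open>G > 0\<close> by (simp add: G_def[symmetric])
        then show ?thesis using less_cSup_iff[of "range g" "l * G"] g(3) \<open>G > 0\<close>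
          by (auto simp: pos_less_divide_eq)
      qed
      \<comment> \<open>Writing l as l^(1-t) l^t keeps the inequality strict, as strict superlevel
        sets demand.\<close>
      fix x y l :: real assume l: "0 < l" "l < f x / F" "l < g y / G"
      have "l = l powr (1 - t) * l powr t" using l(1) by (simp add: powr_add[symmetric])
      also have "\<dots> < (f x / F) powr (1 - t) * (g y / G) powr t"
        using l t by (intro mult_strict_mono powr_less_mono2) auto
      also have "\<dots> = (f x powr (1 - t) * g y powr t) / H"
        using f(2) g(2) \<open>F > 0\<close> \<open>G > 0\<close> by (simp add: H_def powr_divide)
      also have "\<dots> \<le> h ((1 - t) * x + t * y) / H"
        using \<open>H > 0\<close> le by (intro divide_right_mono) auto
      finally show "l < h ((1 - t) * x + t * y) / H" .
    qed (use f g h t fF gG \<open>F > 0\<close> \<open>G > 0\<close> \<open>H > 0\<close> in auto)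
    moreover have "0 \<le> a" "0 \<le> b" using f g \<open>F > 0\<close> \<open>G > 0\<close> by (auto simp: a_def b_def)
    then have "a powr (1 - t) * b powr t \<le> (1 - t) * a + t * b"
      using Youngs_inequality_0[of "1 - t" t a b] t
      by (cases "a = 0 \<or> b = 0") auto
    ultimately have "a powr (1 - t) * b powr t \<le> (\<integral>x. h x \<partial>lborel) / H" by simp
    then have "a powr (1 - t) * b powr t * H \<le> (\<integral>x. h x \<partial>lborel)"
      using \<open>H > 0\<close> by (simp add: pos_le_divide_eq)
    also have "a powr (1 - t) * b powr t * H = (a * F) powr (1 - t) * (b * G) powr t"
      using \<open>0 \<le> a\<close> \<open>0 \<le> b\<close> \<open>F > 0\<close> \<open>G > 0\<close> by (simp add: H_def powr_mult)
    also have "a * F = (\<integral>x. f x \<partial>lborel)" using \<open>F > 0\<close> by (simp add: a_def)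
    also have "b * G = (\<integral>x. g x \<partial>lborel)" using \<open>G > 0\<close> by (simp add: b_def)
    finally show ?thesis .
  qed
qed

section \<open>The Gaussian transport inequality\<close>

lemma integrable_gaussian_exp_square:
  assumes "c < 1 / 2"
  shows "integrable std_normal_distribution (\<lambda>x. exp (c * x\<^sup>2))"
proof -
  \<comment> \<open>The standard deviation of the tilted density: - x^2 / 2 + c x^2 = - x^2 / (2
    s^2).\<close>
  define s where "s = 1 / sqrt (1 - 2 * c)"
  have s: "s > 0" "s\<^sup>2 = 1 / (1 - 2 * c)" using assms by (auto simp: s_def power_divide)
  have "std_normal_density x * exp (c * x\<^sup>2) = s * normal_density 0 s x" for x
  proof -
    have "sqrt (2 * pi * s\<^sup>2) = sqrt (2 * pi) * s" using s(1) by (simp add: real_sqrt_mult)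
    moreover have "exp (- x\<^sup>2 / 2) * exp (c * x\<^sup>2) = exp (- x\<^sup>2 / (2 * s\<^sup>2))"
      using assms by (simp add: s(2) exp_add[symmetric] field_simps)
    ultimately show ?thesis using s(1) by (simp add: normal_density_def field_simps)
  qed
  moreover have "integrable lborel (\<lambda>x. s * normal_density 0 s x)"
    using s(1) by (intro integrable_mult_right integrable_normal_density)
  ultimately show ?thesis by (subst integrable_density) auto
qed

lemma integrable_gaussian_square: "integrable std_normal_distribution (\<lambda>x. x\<^sup>2)"
  using integrable_std_normal_moment[of 2] by (subst integrable_density) auto

lemma integrable_gaussian_of_quadratic:
  assumes "f \<in> borel_measurable borel" "\<And>x. \<bar>f x\<bar> \<le> A + B * x\<^sup>2"
  shows "integrable std_normal_distribution (f :: real \<Rightarrow> real)"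
proof -
  interpret prob_space std_normal_distribution by (rule prob_space_normal_density) simp
  show ?thesis
  proof (rule Bochner_Integration.integrable_bound)
    show "integrable std_normal_distribution (\<lambda>x. A + B * x\<^sup>2)"
      by (intro Bochner_Integration.integrable_add integrable_mult_right integrable_gaussian_square) simp
    show "AE x in std_normal_distribution. norm (f x) \<le> norm (A + B * x\<^sup>2)"
      using order_trans[OF assms(2) abs_ge_self] by (intro AE_I2) simp
  qed (use assms(1) in simp)
qed

text \<open>Prekopa--Leindler for \<phi> exp (- t f), \<phi> v^(1-t) and \<phi>. Jensen bounds the
  first integral below by exp (- t m), which leaves J^t \<le> exp (t (1 - t) m); taking the root of
  order t gives a bound that survives t \<rightarrow> 0. The condition
  \<open>t * B \<le> 1 / 4\<close> keeps exp (- t f) integrable against the Gaussian, and the bound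
  M does the same for v.\<close>

lemma gaussian_transport_powr:
  fixes f v :: "real \<Rightarrow> real"
  assumes f [measurable]: "f \<in> borel_measurable borel" and fb: "\<And>x. \<bar>f x\<bar> \<le> A + B * x\<^sup>2"
    and v [measurable]: "v \<in> borel_measurable borel" and v0: "\<And>x. 0 \<le> v x" and vM: "\<And>x. v x \<le> M"
    and vf: "\<And>x y. v x \<le> exp (f y + (x - y)\<^sup>2 / 2)"
    and t: "0 < t" "t < 1" "t * B \<le> 1 / 4"
  shows "(\<integral>\<^sup>+x. ennreal (v x powr (1 - t)) \<partial>std_normal_distribution)
    \<le> ennreal (exp ((1 - t) * (\<integral>x. f x \<partial>std_normal_distribution)))"
proof -
  let ?\<phi> = std_normal_density
  interpret N: prob_space std_normal_distribution by (rule prob_space_normal_density) simp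
  define m where "m = (\<integral>x. f x \<partial>std_normal_distribution)"
  have fint: "integrable std_normal_distribution f"
    by (rule integrable_gaussian_of_quadratic[OF f fb])
  have tf: "- t * f x \<le> t * A + 1 / 4 * x\<^sup>2" for x
  proof -
    have "t * - f x \<le> t * (A + B * x\<^sup>2)"
      using fb[of x] t by (intro mult_left_mono) auto
    then have "- t * f x \<le> t * (A + B * x\<^sup>2)" by simp
    also have "\<dots> = t * A + t * B * x\<^sup>2" by (simp add: algebra_simps)
    also have "\<dots> \<le> t * A + 1 / 4 * x\<^sup>2" using t by (intro add_left_mono mult_right_mono) auto
    finally show ?thesis .
  qed
  have eint: "integrable std_normal_distribution (\<lambda>x. exp (- t * f x))"
  proof (rule Bochner_Integration.integrable_bound)
    show "integrable std_normal_distribution (\<lambda>x. exp (t * A) * exp (1 / 4 * x\<^sup>2))"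
      by (intro integrable_mult_right integrable_gaussian_exp_square) auto
    show "AE x in std_normal_distribution. norm (exp (- t * f x)) \<le> norm (exp (t * A) * exp (1 / 4 * x\<^sup>2))"
      using tf by (intro AE_I2) (simp add: exp_add[symmetric])
  qed measurable
  have pint: "integrable std_normal_distribution (\<lambda>x. v x powr (1 - t))"
    using v0 vM t by (intro N.integrable_const_bound[of _ "M powr (1 - t)"]) (auto intro!: powr_mono2 AE_I2)
  have \<phi>1: "?\<phi> x \<le> 1 / sqrt (2 * pi)" for x
    unfolding std_normal_density_def by (intro mult_left_le) auto
  have PL: "(\<integral>x. ?\<phi> x * exp (- t * f x) \<partial>lborel) powr (1 - t)
      * (\<integral>x. ?\<phi> x * v x powr (1 - t) \<partial>lborel) powr t \<le> (\<integral>x. ?\<phi> x \<partial>lborel)"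
  proof (rule Prekopa_Leindler_real)
    show "integrable lborel (\<lambda>x. ?\<phi> x * exp (- t * f x))"
      using eint by (subst (asm) integrable_density) auto
    show "integrable lborel (\<lambda>x. ?\<phi> x * v x powr (1 - t))"
      using pint by (subst (asm) integrable_density) auto
    show "bdd_above (range (\<lambda>x. ?\<phi> x * exp (- t * f x)))"
    proof (rule bdd_aboveI2)
      fix x
      have "?\<phi> x * exp (- t * f x) \<le> 1 / sqrt (2 * pi) * exp (- x\<^sup>2 / 2) * exp (t * A + 1 / 4 * x\<^sup>2)"
        using tf[of x] unfolding std_normal_density_def by (intro mult_left_mono) auto
      also have "\<dots> = 1 / sqrt (2 * pi) * exp (t * A - 1 / 4 * x\<^sup>2)"
        by (simp add: exp_add[symmetric])
      also have "\<dots> \<le> 1 / sqrt (2 * pi) * exp (t * A)" by (intro mult_left_mono) auto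
      finally show "?\<phi> x * exp (- t * f x) \<le> 1 / sqrt (2 * pi) * exp (t * A)" .
    qed
    show "bdd_above (range (\<lambda>x. ?\<phi> x * v x powr (1 - t)))"
    proof (rule bdd_aboveI2)
      fix x
      show "?\<phi> x * v x powr (1 - t) \<le> 1 / sqrt (2 * pi) * M powr (1 - t)"
        using v0[of x] vM[of x] t by (intro mult_mono powr_mono2 \<phi>1) auto
    qed
    fix x y
    show "(?\<phi> x * exp (- t * f x)) powr (1 - t) * (?\<phi> y * v y powr (1 - t)) powr t
        \<le> ?\<phi> ((1 - t) * x + t * y)"
    proof -
      define c where "c = 1 / sqrt (2 * pi)"
      have c: "c > 0" "c powr (1 - t) * c powr t = c" by (simp_all add: c_def flip: powr_add)
      have dens_powr: "(?\<phi> u * exp Z) powr s = c powr s * exp ((- u\<^sup>2 / 2 + Z) * s)" for u Z s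
      proof -
        have "?\<phi> u * exp Z = c * exp (- u\<^sup>2 / 2 + Z)"
          unfolding exp_add std_normal_density_def c_def by simp
        then show ?thesis using c(1) by (simp only: powr_mult less_imp_le exp_ge_zero exp_powr_real)
      qed
      have "v y powr (1 - t) \<le> exp (f x + (y - x)\<^sup>2 / 2) powr (1 - t)"
        using v0 vf t by (intro powr_mono2) auto
      also have "\<dots> = exp ((f x + (y - x)\<^sup>2 / 2) * (1 - t))"
        by (simp add: powr_def mult.commute)
      finally have "(?\<phi> y * v y powr (1 - t)) powr t
          \<le> (?\<phi> y * exp ((f x + (y - x)\<^sup>2 / 2) * (1 - t))) powr t"
        using t by (intro powr_mono2 mult_left_mono) auto
      also have "\<dots> = c powr t * exp ((- y\<^sup>2 / 2 + (f x + (y - x)\<^sup>2 / 2) * (1 - t)) * t)"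
        by (rule dens_powr)
      finally have 1: "(?\<phi> y * v y powr (1 - t)) powr t
          \<le> c powr t * exp ((- y\<^sup>2 / 2 + (f x + (y - x)\<^sup>2 / 2) * (1 - t)) * t)" .
      have 2: "(?\<phi> x * exp (- t * f x)) powr (1 - t)
          = c powr (1 - t) * exp ((- x\<^sup>2 / 2 + - t * f x) * (1 - t))"
        by (rule dens_powr)
      have "(?\<phi> x * exp (- t * f x)) powr (1 - t) * (?\<phi> y * v y powr (1 - t)) powr t
          \<le> (c powr (1 - t) * exp ((- x\<^sup>2 / 2 + - t * f x) * (1 - t))) *
            (c powr t * exp ((- y\<^sup>2 / 2 + (f x + (y - x)\<^sup>2 / 2) * (1 - t)) * t))"
        unfolding 2 by (intro mult_left_mono 1) auto
      also have "\<dots> = (c powr (1 - t) * c powr t) * exp ((- x\<^sup>2 / 2 + - t * f x) * (1 - t)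
            + (- y\<^sup>2 / 2 + (f x + (y - x)\<^sup>2 / 2) * (1 - t)) * t)"
        by (simp add: exp_add)
      \<comment> \<open>The terms with f cancel. What remains is the identity (1-t) x^2 + t y^2 - t
        (1-t) (x-y)^2 = ((1-t) x + t y)^2: the cost is exactly the strong convexity defect of the
        Gaussian potential.\<close>
      also have "(- x\<^sup>2 / 2 + - t * f x) * (1 - t) + (- y\<^sup>2 / 2 + (f x + (y - x)\<^sup>2 / 2) * (1 - t)) * t
          = - ((1 - t) * x + t * y)\<^sup>2 / 2"
        by (simp add: field_simps power2_eq_square)
      finally show ?thesis unfolding c(2) by (simp add: std_normal_density_def c_def)
    qed
  qed (use t v0 in auto)
  have Jensen: "exp (- t * m) \<le> (\<integral>x. exp (- t * f x) \<partial>std_normal_distribution)"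
  proof -
    have "exp (- t * m) = (\<integral>x. exp (- t * m) * (1 + (t * m - t * f x)) \<partial>std_normal_distribution)"
      using fint N.prob_space by (simp add: m_def[symmetric])
    also have "\<dots> \<le> (\<integral>x. exp (- t * f x) \<partial>std_normal_distribution)"
    proof (rule integral_mono)
      show "exp (- t * m) * (1 + (t * m - t * f x)) \<le> exp (- t * f x)" for x
      proof -
        have "exp (- t * m) * (1 + (t * m - t * f x)) \<le> exp (- t * m) * exp (t * m - t * f x)"
          by (intro mult_left_mono exp_ge_add_one_self) auto
        then show ?thesis by (simp flip: exp_add)
      qed
    qed (use fint eint in auto)
    finally show ?thesis .
  qed
  define J where "J = (\<integral>x. v x powr (1 - t) \<partial>std_normal_distribution)"
  have "J \<ge> 0" by (simp add: J_def)
  have "exp (- t * m) powr (1 - t) * J powr t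
      \<le> (\<integral>x. exp (- t * f x) \<partial>std_normal_distribution) powr (1 - t) * J powr t"
    using Jensen t by (intro mult_right_mono powr_mono2) auto
  also have "\<dots> \<le> 1"
    using PL by (simp add: J_def integral_density)
  finally have "exp ((- t * m) * (1 - t)) * J powr t \<le> 1" by (simp add: powr_def mult.commute)
  then have "exp (t * ((1 - t) * m)) * (exp ((- t * m) * (1 - t)) * J powr t) \<le> exp (t * ((1 - t) * m)) * 1"
    by (intro mult_left_mono) auto
  then have "J powr t \<le> exp (t * ((1 - t) * m))"
    unfolding mult.assoc[symmetric] exp_add[symmetric] by (simp add: algebra_simps)
  then have "J powr t \<le> exp ((1 - t) * m) powr t" by (simp add: powr_def)
  then have "J \<le> exp ((1 - t) * m)"
    using t powr_less_mono2[of t "exp ((1 - t) * m)" J] by (auto simp: not_le[symmetric])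
  moreover have "(\<integral>\<^sup>+x. ennreal (v x powr (1 - t)) \<partial>std_normal_distribution) = ennreal J"
    unfolding J_def using pint by (intro nn_integral_eq_integral) auto
  ultimately show ?thesis by (simp add: m_def ennreal_leI)
qed

text \<open>Limit t \<rightarrow> 0 by Fatou's lemma. The left function takes values in
  \<open>ennreal\<close> because in the product it is itself an integral over another coordinate,
  whose finiteness is part of the conclusion.\<close>

lemma gaussian_transport_real:
  fixes f :: "real \<Rightarrow> real" and w :: "real \<Rightarrow> ennreal"
  assumes f [measurable]: "f \<in> borel_measurable borel" and fb: "\<And>x. \<bar>f x\<bar> \<le> A + B * x\<^sup>2"
    and w [measurable]: "w \<in> borel_measurable borel"
    and wf: "\<And>x y. w x \<le> ennreal (exp (f y + (x - y)\<^sup>2 / 2))"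
  shows "(\<integral>\<^sup>+x. w x \<partial>std_normal_distribution)
    \<le> ennreal (exp (\<integral>x. f x \<partial>std_normal_distribution))"
proof -
  define m where "m = (\<integral>x. f x \<partial>std_normal_distribution)"
  define r where "r x = enn2real (w x)" for x
  have [measurable]: "r \<in> borel_measurable borel" by (simp add: r_def[abs_def])
  have w_eq: "w x = ennreal (r x)" and rf: "r x \<le> exp (f y + (x - y)\<^sup>2 / 2)" for x y
  proof -
    show "w x = ennreal (r x)"
      using wf[of x 0] by (auto simp: r_def ennreal_enn2real_if top_unique)
    then show "r x \<le> exp (f y + (x - y)\<^sup>2 / 2)"
      using wf[of x y] by simp
  qed
  \<comment> \<open>The hypothesis with y = 0 bounds r only on bounded sets, hence the truncation.
    Outside the interval v vanishes, so the transport hypothesis persists.\<close>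
  define v where "v k x = r x * indicator {-real k..real k} x" for k :: nat and x
  \<comment> \<open>Tends to 0 while staying below 1 and satisfying t B \<le> 1/4 for every
    k.\<close>
  define t where "t k = 1 / (real k + 2 + 4 * \<bar>B\<bar>)" for k :: nat
  have t: "0 < t k" "t k < 1" "t k * B \<le> 1 / 4" for k
    by (auto simp: t_def field_simps)
  have step: "(\<integral>\<^sup>+x. ennreal (v k x powr (1 - t k)) \<partial>std_normal_distribution)
      \<le> ennreal (exp ((1 - t k) * m))" for k
    unfolding m_def
  proof (rule gaussian_transport_powr)
    show "v k x \<le> exp (f 0 + (real k)\<^sup>2 / 2)" for x
    proof (cases "x \<in> {-real k..real k}")
      case True
      then have "x\<^sup>2 \<le> (real k)\<^sup>2" by (auto simp: abs_le_square_iff[symmetric])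
      then have "exp (f 0 + (x - 0)\<^sup>2 / 2) \<le> exp (f 0 + (real k)\<^sup>2 / 2)" by simp
      with rf[of x 0] have "r x \<le> exp (f 0 + (real k)\<^sup>2 / 2)" by (rule order_trans)
      then show ?thesis using True by (simp add: v_def)
    qed (simp add: v_def)
    show "v k x \<le> exp (f y + (x - y)\<^sup>2 / 2)" for x y
      using rf[of x y] by (simp add: v_def indicator_def)
    show "0 \<le> v k x" for x by (simp add: v_def r_def)
    show "v k \<in> borel_measurable borel" unfolding v_def by measurable
  qed (use fb t in auto)
  have t0: "t \<longlonglongrightarrow> 0" unfolding t_def by real_asymp
  have lim: "(\<lambda>k. ennreal (v k x powr (1 - t k))) \<longlonglongrightarrow> w x" for x
  proof -
    obtain k0 where k0: "\<bar>x\<bar> \<le> real k0" using real_arch_simple by blast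
    have "(\<lambda>k. r x powr (1 - t k)) \<longlonglongrightarrow> r x"
    proof (cases "r x = 0")
      case False
      then have "(\<lambda>k. r x powr (1 - t k)) \<longlonglongrightarrow> r x powr (1 - 0)"
        by (intro tendsto_powr tendsto_const tendsto_diff t0) simp
      then show ?thesis using False by (simp add: r_def)
    qed simp
    moreover have "eventually (\<lambda>k. r x powr (1 - t k) = v k x powr (1 - t k)) sequentially"
      using eventually_ge_at_top[of k0] by eventually_elim (use k0 in \<open>auto simp: v_def indicator_def abs_le_iff\<close>)
    ultimately have "(\<lambda>k. v k x powr (1 - t k)) \<longlonglongrightarrow> r x"
      by (rule Lim_transform_eventually)
    then show ?thesis unfolding w_eq by (rule tendsto_ennrealI)
  qed
  have "(\<integral>\<^sup>+x. w x \<partial>std_normal_distribution)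
      = (\<integral>\<^sup>+x. liminf (\<lambda>k. ennreal (v k x powr (1 - t k))) \<partial>std_normal_distribution)"
    using lim_imp_Liminf[OF trivial_limit_sequentially lim] by simp
  also have "\<dots> \<le> liminf (\<lambda>k. \<integral>\<^sup>+x. ennreal (v k x powr (1 - t k)) \<partial>std_normal_distribution)"
    by (intro nn_integral_liminf) (simp add: v_def)
  also have "\<dots> \<le> liminf (\<lambda>k. ennreal (exp ((1 - t k) * m)))"
    using step by (intro Liminf_mono always_eventually) auto
  also have "\<dots> = ennreal (exp ((1 - 0) * m))"
    by (intro lim_imp_Liminf tendsto_ennrealI tendsto_intros t0) auto
  finally show ?thesis by (simp add: m_def)
qed

section \<open>From the line to finite products\<close>

abbreviation gauss_PiM :: "nat set \<Rightarrow> (nat \<Rightarrow> real) measure"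
  where "gauss_PiM I \<equiv> \<Pi>\<^sub>M i\<in>I. std_normal_distribution"

interpretation gauss: product_prob_space "\<lambda>i::nat. std_normal_distribution" UNIV
  by (intro product_prob_spaceI prob_space_normal_density) simp

lemma integral_gaussian_square: "(\<integral>x. x\<^sup>2 \<partial>std_normal_distribution) = 1"
  using integral_std_normal_moment_even[of 1] by (subst integral_density) auto

lemma integrable_gauss_PiM_component:
  assumes "finite I" "i \<in> I" and f: "integrable std_normal_distribution f"
  shows "integrable (gauss_PiM I) (\<lambda>x. f (x i) :: real)"
proof -
  have "distr (gauss_PiM I) std_normal_distribution (\<lambda>x. x i) = std_normal_distribution"
    using assms by (intro distr_PiM_component prob_space_normal_density) auto
  then have "integrable (distr (gauss_PiM I) std_normal_distribution (\<lambda>x. x i)) f"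
    using f by simp
  then show ?thesis
    by (rule integrable_distr[rotated]) (use assms in \<open>auto intro: measurable_component_singleton\<close>)
qed

lemma integrable_gauss_PiM_sum_square:
  assumes "finite I" "J \<subseteq> I"
  shows "integrable (gauss_PiM I) (\<lambda>x. \<Sum>i\<in>J. (x i)\<^sup>2 :: real)"
  using assms by (intro Bochner_Integration.integrable_sum
      integrable_gauss_PiM_component[OF _ _ integrable_gaussian_square]) auto

lemma integrable_gauss_PiM_of_quadratic:
  assumes "finite I" "f \<in> borel_measurable (gauss_PiM I)"
    and fb: "\<And>x. x \<in> space (gauss_PiM I) \<Longrightarrow> \<bar>f x\<bar> \<le> A + B * (\<Sum>i\<in>I. (x i)\<^sup>2)"
  shows "integrable (gauss_PiM I) (f :: _ \<Rightarrow> real)"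
proof (rule Bochner_Integration.integrable_bound)
  interpret prob_space "gauss_PiM I" by (intro prob_space_PiM prob_space_normal_density) simp
  show "integrable (gauss_PiM I) (\<lambda>x. A + B * (\<Sum>i\<in>I. (x i)\<^sup>2))"
    using \<open>finite I\<close> by (intro Bochner_Integration.integrable_add integrable_mult_right
        integrable_gauss_PiM_sum_square) auto
  show "AE x in gauss_PiM I. norm (f x) \<le> norm (A + B * (\<Sum>i\<in>I. (x i)\<^sup>2))"
    using order_trans[OF fb abs_ge_self] by (intro AE_I2) simp
qed (use assms in simp)

text \<open>The dual form of Talagrand's transport inequality. It passes from the factors to the product
  because the quadratic cost is additive over the coordinates.\<close>

lemma gaussian_transport:
  fixes f :: "(nat \<Rightarrow> real) \<Rightarrow> real" and w :: "(nat \<Rightarrow> real) \<Rightarrow> ennreal"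
  assumes "finite I"
    and "f \<in> borel_measurable (gauss_PiM I)"
    and "\<And>x. x \<in> space (gauss_PiM I) \<Longrightarrow> \<bar>f x\<bar> \<le> A + B * (\<Sum>i\<in>I. (x i)\<^sup>2)"
    and "w \<in> borel_measurable (gauss_PiM I)"
    and "\<And>x y. x \<in> space (gauss_PiM I) \<Longrightarrow> y \<in> space (gauss_PiM I) \<Longrightarrow>
      w x \<le> ennreal (exp (f y + (\<Sum>i\<in>I. (x i - y i)\<^sup>2) / 2))"
  shows "(\<integral>\<^sup>+x. w x \<partial>gauss_PiM I) \<le> ennreal (exp (\<integral>x. f x \<partial>gauss_PiM I))"
  using assms
proof (induction I arbitrary: f w A B rule: finite_induct)
  case empty
  \<comment> \<open>The empty product is a point mass at the constant function
    \<open>undefined\<close>, and there the cost is an empty sum.\<close>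
  show ?case
    using empty(4)[of "\<lambda>x. undefined" "\<lambda>x. undefined"]
    by (simp add: PiM_empty nn_integral_count_space_finite lebesgue_integral_count_space_finite)
next
  case (insert j I)
  note [measurable] = insert.prems(1,3)
  have jI: "j \<notin> I" "finite I" by (fact insert.hyps)+
  have upd: "(\<lambda>(x, s). x(j := s)) \<in> gauss_PiM I \<Otimes>\<^sub>M std_normal_distribution \<rightarrow>\<^sub>M gauss_PiM (insert j I)"
    by (intro measurable_add_dim)
  \<comment> \<open>Coordinate j is integrated out on both sides. The one-dimensional inequality,
    applied in j, shows that F and W again satisfy the hypothesis over I.\<close>
  define F where "F x = (\<integral>s. f (x(j := s)) \<partial>std_normal_distribution)" for x
  define W where "W x = (\<integral>\<^sup>+s. w (x(j := s)) \<partial>std_normal_distribution)" for x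
  have [measurable]: "(\<lambda>(x, s). f (x(j := s))) \<in> borel_measurable (gauss_PiM I \<Otimes>\<^sub>M std_normal_distribution)"
    using measurable_comp[OF upd insert.prems(1)] by (simp add: comp_def case_prod_beta')
  have [measurable]: "(\<lambda>(x, s). w (x(j := s))) \<in> borel_measurable (gauss_PiM I \<Otimes>\<^sub>M std_normal_distribution)"
    using measurable_comp[OF upd insert.prems(3)] by (simp add: comp_def case_prod_beta')
  have sum_upd: "(\<Sum>i\<in>insert j I. ((x(j := s)) i)\<^sup>2) = s\<^sup>2 + (\<Sum>i\<in>I. (x i)\<^sup>2)" for x :: "nat \<Rightarrow> real" and s
  proof -
    have "(\<Sum>i\<in>I. ((x(j := s)) i)\<^sup>2) = (\<Sum>i\<in>I. (x i)\<^sup>2)" using jI by (intro sum.cong) auto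
    then show ?thesis using jI by simp
  qed
  have upd_space: "x(j := s) \<in> space (gauss_PiM (insert j I))" if "x \<in> space (gauss_PiM I)" for x s
    using that by (auto simp: space_PiM PiE_def extensional_def)
  have f_upd: "(\<lambda>s. f (x(j := s))) \<in> borel_measurable borel"
    and w_upd: "(\<lambda>s. w (x(j := s))) \<in> borel_measurable borel" if "x \<in> space (gauss_PiM I)" for x
    using measurable_Pair2[OF \<open>(\<lambda>(x, s). f (x(j := s))) \<in> _\<close> that]
      measurable_Pair2[OF \<open>(\<lambda>(x, s). w (x(j := s))) \<in> _\<close> that] by simp_all
  have f_bound: "\<bar>f (x(j := s))\<bar> \<le> (A + B * (\<Sum>i\<in>I. (x i)\<^sup>2)) + B * s\<^sup>2"
    if "x \<in> space (gauss_PiM I)" for x s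
    using insert.prems(2)[OF upd_space[OF that], of s] unfolding sum_upd by (simp add: algebra_simps del: fun_upd_apply)
  have "(\<integral>\<^sup>+x. W x \<partial>gauss_PiM I) \<le> ennreal (exp (\<integral>x. F x \<partial>gauss_PiM I))"
  proof (rule insert.IH)
    show "F \<in> borel_measurable (gauss_PiM I)" "W \<in> borel_measurable (gauss_PiM I)"
      unfolding F_def W_def by measurable
    fix x assume x: "x \<in> space (gauss_PiM I)"
    have int: "integrable std_normal_distribution (\<lambda>s. f (x(j := s)))"
      by (rule integrable_gaussian_of_quadratic[OF f_upd[OF x] f_bound[OF x]])
    have "\<bar>F x\<bar> \<le> (\<integral>s. \<bar>f (x(j := s))\<bar> \<partial>std_normal_distribution)"
      unfolding F_def by (rule integral_abs_bound)
    also have "\<dots> \<le> (\<integral>s. (A + B * (\<Sum>i\<in>I. (x i)\<^sup>2)) + B * s\<^sup>2 \<partial>std_normal_distribution)"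
      using int f_bound[OF x]
      by (intro integral_mono integrable_abs Bochner_Integration.integrable_add integrable_mult_right
          integrable_gaussian_square) auto
    \<comment> \<open>The integrated coordinate contributes its second moment 1, so the quadratic
      growth bound persists with A + B in place of A.\<close>
    also have "\<dots> = (A + B) + B * (\<Sum>i\<in>I. (x i)\<^sup>2)"
      using integrable_gaussian_square integral_gaussian_square prob_space.prob_space[OF prob_space_normal_density, of 1 0] by simp
    finally show "\<bar>F x\<bar> \<le> (A + B) + B * (\<Sum>i\<in>I. (x i)\<^sup>2)" .
    fix y assume y: "y \<in> space (gauss_PiM I)"
    \<comment> \<open>The cost in the other coordinates is constant while coordinate j varies, so it
      can be added to f.\<close>
    define c where "c = (\<Sum>i\<in>I. (x i - y i)\<^sup>2) / 2"
    have int_y: "integrable std_normal_distribution (\<lambda>s. f (y(j := s)))"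
      by (rule integrable_gaussian_of_quadratic[OF f_upd[OF y] f_bound[OF y]])
    have "W x \<le> ennreal (exp (\<integral>s. f (y(j := s)) + c \<partial>std_normal_distribution))"
      unfolding W_def
    proof (rule gaussian_transport_real)
      show "(\<lambda>s. w (x(j := s))) \<in> borel_measurable borel" by (rule w_upd[OF x])
      show "(\<lambda>s. f (y(j := s)) + c) \<in> borel_measurable borel"
        using f_upd[OF y] by simp
      show "\<bar>f (y(j := s)) + c\<bar> \<le> (A + B * (\<Sum>i\<in>I. (y i)\<^sup>2) + \<bar>c\<bar>) + B * s\<^sup>2" for s
        using f_bound[OF y, of s] by linarith
      show "w (x(j := s)) \<le> ennreal (exp (f (y(j := r)) + c + (s - r)\<^sup>2 / 2))" for s r
      proof -
        have "(\<Sum>i\<in>I. ((x(j := s)) i - (y(j := r)) i)\<^sup>2) = (\<Sum>i\<in>I. (x i - y i)\<^sup>2)"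
          using jI by (intro sum.cong) auto
        moreover have "(\<Sum>i\<in>insert j I. ((x(j := s)) i - (y(j := r)) i)\<^sup>2)
            = (s - r)\<^sup>2 + (\<Sum>i\<in>I. ((x(j := s)) i - (y(j := r)) i)\<^sup>2)"
          using jI by simp
        ultimately show ?thesis
          using insert.prems(4)[OF upd_space[OF x, of s] upd_space[OF y, of r]]
          by (simp only: c_def add_divide_distrib add_ac)
      qed
    qed
    also have "(\<integral>s. f (y(j := s)) + c \<partial>std_normal_distribution) = F y + c"
      using int_y prob_space.prob_space[OF prob_space_normal_density, of 1 0] by (simp add: F_def)
    finally show "W x \<le> ennreal (exp (F y + (\<Sum>i\<in>I. (x i - y i)\<^sup>2) / 2))"
      by (simp add: c_def)
  qed
  also have "(\<integral>x. F x \<partial>gauss_PiM I) = (\<integral>x. f x \<partial>gauss_PiM (insert j I))"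
    unfolding F_def using insert.prems(1,2) jI
    by (intro gauss.product_integral_insert[symmetric] integrable_gauss_PiM_of_quadratic) auto
  also have "(\<integral>\<^sup>+x. W x \<partial>gauss_PiM I) = (\<integral>\<^sup>+x. w x \<partial>gauss_PiM (insert j I))"
    unfolding W_def using insert.prems(3) jI
    by (intro gauss.product_nn_integral_insert[symmetric]) auto
  finally show ?case .
qed

section \<open>Almost everywhere differentiability\<close>

lemma negligible_UN_countable:
  assumes "countable I" "\<And>i. i \<in> I \<Longrightarrow> negligible (S i)"
  shows "negligible (\<Union>i\<in>I. S i)"
  using assms by (intro negligible_countable_Union) auto

text \<open>Stated for every measure on the Borel sets, since it is applied both to Lebesgue measure
  and to the Stieltjes measure of g.\<close>

lemma emeasure_disjoint_cballs:
  fixes a :: "'i \<Rightarrow> real"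
  assumes C: "countable C" "pairwise (\<lambda>i j. disjnt (cball (a i) (r i)) (cball (a j) (r j))) C"
    and M: "sets M = sets borel"
  shows "emeasure M (\<Union>i\<in>C. cball (a i) (r i)) = (\<integral>\<^sup>+i. emeasure M (cball (a i) (r i)) \<partial>count_space C)"
  using assms
  by (intro emeasure_UN_countable)
    (auto simp: M disjoint_family_on_def pairwise_def disjnt_def)

lemma emeasure_lborel_cball_real:
  "emeasure lborel (cball (a::real) r) = ennreal (2 * r)" if "0 \<le> r"
  using that by (simp add: cball_eq_atLeastAtMost)

text \<open>If every point of \<open>S\<close> lies in arbitrarily short intervals over which \<open>g\<close> has mean slope at
  most \<open>p\<close>, and in arbitrarily short ones with mean slope at least \<open>q > p\<close>, then two successive
  Vitali coverings give \<open>q |S| \<le> p |S|\<close> up to \<open>\<epsilon>\<close>; the increments of \<open>g\<close> are compared through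
  the Stieltjes measure of \<open>g\<close>.\<close>

lemma negligible_of_slope_gap:
  fixes g :: "real \<Rightarrow> real"
  assumes mono: "\<And>x y. x \<le> y \<Longrightarrow> g x \<le> g y" and cont: "continuous_on UNIV g"
    and pq: "0 \<le> p" "p < q" and bounded: "S \<subseteq> {-R<..<R}"
    and lo: "\<And>x d. x \<in> S \<Longrightarrow> 0 < d \<Longrightarrow>
      \<exists>u v. u \<le> x \<and> x \<le> v \<and> u < v \<and> v - u < d \<and> g v - g u \<le> p * (v - u)"
    and hi: "\<And>x d. x \<in> S \<Longrightarrow> 0 < d \<Longrightarrow>
      \<exists>u v. u \<le> x \<and> x \<le> v \<and> u < v \<and> v - u < d \<and> q * (v - u) \<le> g v - g u"
  shows "negligible S"
proof -
  let ?out = "outer_measure_of lebesgue"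
  let ?\<mu> = "interval_measure g"
  define I where "I i = cball (fst i) (snd i)" for i :: "real \<times> real"
  have ball_eq: "cball ((u + v) / 2) ((v - u) / 2) = {u..v}" for u v :: real
    by (auto simp: cball_eq_atLeastAtMost field_simps)
  have \<mu>_ball: "emeasure ?\<mu> (I i) = ennreal (g (fst i + snd i) - g (fst i - snd i))" if "0 < snd i" for i
    using that mono cont unfolding I_def
    by (simp add: cball_eq_atLeastAtMost emeasure_interval_measure_Icc)
  \<comment> \<open>Outer measure is used because S is not known to be measurable, and a Vitali
    covering catches it only up to a null set.\<close>
  have null_le: "?out T \<le> emeasure lborel V" if "V \<in> sets borel" "negligible (T - V)" for T V :: "real set"
  proof -
    have "?out T \<le> ?out (V \<union> (T - V))" by (intro outer_measure_of_mono) auto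
    also have "\<dots> = emeasure lebesgue (V \<union> (T - V))"
      using that by (intro outer_measure_of_eq sets.Un) (auto simp: negligible_iff_null_sets)
    also have "\<dots> = emeasure lebesgue V"
      using that by (intro emeasure_Un_null_set) (auto simp: negligible_iff_null_sets)
    also have "\<dots> = emeasure lborel V" using that by simp
    finally show ?thesis .
  qed
  have "?out S \<le> emeasure lborel {-R<..<R}"
    using null_le[of "{-R<..<R}" S] bounded by (simp add: Diff_eq_empty_iff[THEN iffD2])
  also have "\<dots> < \<infinity>" by (cases "-R \<le> R") auto
  finally have out_fin: "?out S < \<infinity>" .
  define m where "m = enn2real (?out S)"
  have out_eq: "?out S = ennreal m" "0 \<le> m"
    using out_fin by (auto simp: m_def)
  have main: "ennreal q * ?out S \<le> ennreal p * (?out S + ennreal e)" if "0 < e" for e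
  proof -
    \<comment> \<open>A measurable hull B of S and an open U around it: the first covering stays in
      U and so has total length at most the outer measure of S plus e.\<close>
    obtain B where B: "B \<in> sets lebesgue" "S \<subseteq> B" "?out S = emeasure lebesgue B"
      using outer_measure_of_attain[of S lebesgue] by auto
    obtain U where U: "open U" "B \<subseteq> U" "U - B \<in> lmeasurable" "emeasure lebesgue (U - B) < ennreal e"
      using sets_lebesgue_outer_open[OF B(1) \<open>0 < e\<close>] by metis
    have "emeasure lborel U = emeasure lebesgue (B \<union> (U - B))"
      using U by (simp add: Un_absorb1)
    also have "\<dots> \<le> emeasure lebesgue B + emeasure lebesgue (U - B)"
      using U B by (intro emeasure_subadditive) (auto simp: fmeasurable_def)
    also have "\<dots> \<le> ?out S + ennreal e"
      using U B by (intro add_mono) auto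
    finally have Ule: "emeasure lborel U \<le> ?out S + ennreal e" .
    \<comment> \<open>Vitali's theorem speaks of balls, so an interval is a pair of centre and
      radius. The slope property is a parameter P because the covering is used twice.\<close>
    have cover: "\<exists>C. countable C \<and> C \<subseteq> {i. 0 < snd i \<and> I i \<subseteq> W \<and> P (fst i - snd i) (fst i + snd i)} \<and>
        pairwise (\<lambda>i j. disjnt (I i) (I j)) C \<and> negligible (T - (\<Union>i\<in>C. I i))"
      if W: "open W" "T \<subseteq> W" and P: "\<And>x d. x \<in> T \<Longrightarrow> 0 < d \<Longrightarrow>
        \<exists>u v. u \<le> x \<and> x \<le> v \<and> u < v \<and> v - u < d \<and> P u v" for T W and P :: "real \<Rightarrow> real \<Rightarrow> bool"
    proof -
      define K where "K = {i. 0 < snd i \<and> I i \<subseteq> W \<and> P (fst i - snd i) (fst i + snd i)}"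
      have "\<exists>i. i \<in> K \<and> x \<in> cball (fst i) (snd i) \<and> snd i < d" if x: "x \<in> T" and d: "0 < d" for x d
      proof -
        obtain e where e: "0 < e" "ball x e \<subseteq> W" using W x open_contains_ball by blast
        obtain u v where uv: "u \<le> x" "x \<le> v" "u < v" "v - u < min d e" "P u v"
          using P[OF x, of "min d e"] d e by auto
        have "{u..v} \<subseteq> ball x e" using uv by (auto simp: dist_real_def)
        then have "((u + v) / 2, (v - u) / 2) \<in> K"
          using uv e by (auto simp: K_def I_def ball_eq field_simps)
        then show ?thesis using uv by (intro exI[of _ "((u + v) / 2, (v - u) / 2)"]) (auto simp: ball_eq)
      qed
      from Vitali_covering_theorem_cballs[of K snd T fst, OF _ this]
      obtain C where "countable C" "C \<subseteq> K" "pairwise (\<lambda>i j. disjnt (I i) (I j)) C"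
        "negligible (T - (\<Union>i\<in>C. I i))" by (auto simp: K_def I_def)
      then show ?thesis unfolding K_def by blast
    qed
    have len: "emeasure lborel (I i) = ennreal (2 * snd i)" if "0 < snd i" for i
      using that by (simp add: I_def emeasure_lborel_cball_real)
    obtain C where C: "countable C" "pairwise (\<lambda>i j. disjnt (I i) (I j)) C" "negligible (S - (\<Union>i\<in>C. I i))"
      and CK: "\<And>i. i \<in> C \<Longrightarrow> 0 < snd i \<and> I i \<subseteq> U \<and>
        g (fst i + snd i) - g (fst i - snd i) \<le> p * ((fst i + snd i) - (fst i - snd i))"
      using cover[OF U(1) order_trans[OF B(2) U(2)], of "\<lambda>u v. g v - g u \<le> p * (v - u)", OF lo]
      by blast
    \<comment> \<open>Open balls, so that the second covering fits in an open set and its intervals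
      lie inside those of the first.\<close>
    define W where "W = (\<Union>i\<in>C. ball (fst i) (snd i))"
    have "open W" by (auto simp: W_def)
    obtain D where D: "countable D" "pairwise (\<lambda>i j. disjnt (I i) (I j)) D" "negligible (S \<inter> W - (\<Union>i\<in>D. I i))"
      and DK: "\<And>i. i \<in> D \<Longrightarrow> 0 < snd i \<and> I i \<subseteq> W \<and>
        q * ((fst i + snd i) - (fst i - snd i)) \<le> g (fst i + snd i) - g (fst i - snd i)"
      using cover[OF \<open>open W\<close> Int_lower2, of S "\<lambda>u v. q * (v - u) \<le> g v - g u"] hi by blast
    have meas: "(\<Union>i\<in>C. I i) \<in> sets borel" "(\<Union>i\<in>D. I i) \<in> sets borel"
      using C(1) D(1) by (auto simp: I_def)
    \<comment> \<open>Passing to open balls loses only the end points of countably many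
      intervals.\<close>
    have "sphere a r = {a - r, a + r}" if "0 < r" for a r :: real
      using that by (auto simp: dist_real_def)
    then have "negligible (\<Union>i\<in>C. sphere (fst i) (snd i))"
      using C(1) CK by (intro negligible_UN_countable) auto
    moreover have "S - (\<Union>i\<in>D. I i) \<subseteq> (S - (\<Union>i\<in>C. I i)) \<union> (S \<inter> W - (\<Union>i\<in>D. I i))
        \<union> (\<Union>i\<in>C. sphere (fst i) (snd i))"
      by (force simp: W_def I_def)
    ultimately have negD: "negligible (S - (\<Union>i\<in>D. I i))"
      using C(3) D(3) by (meson negligible_Un negligible_subset)
    have "ennreal q * ?out S \<le> ennreal q * emeasure lborel (\<Union>i\<in>D. I i)"
      by (intro mult_left_mono null_le meas negD) auto
    also have "\<dots> = (\<integral>\<^sup>+i. ennreal q * emeasure lborel (I i) \<partial>count_space D)"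
      using D unfolding I_def by (subst emeasure_disjoint_cballs) (auto simp: nn_integral_cmult)
    also have "\<dots> \<le> (\<integral>\<^sup>+i. emeasure ?\<mu> (I i) \<partial>count_space D)"
    proof (intro nn_integral_mono)
      fix i assume "i \<in> space (count_space D)"
      then show "ennreal q * emeasure lborel (I i) \<le> emeasure ?\<mu> (I i)"
        using DK[of i] pq by (simp add: \<mu>_ball len ennreal_leI flip: ennreal_mult)
    qed
    also have "\<dots> = emeasure ?\<mu> (\<Union>i\<in>D. I i)"
      using D unfolding I_def by (subst emeasure_disjoint_cballs) auto
    also have "\<dots> \<le> emeasure ?\<mu> (\<Union>i\<in>C. I i)"
    proof (rule emeasure_mono)
      show "(\<Union>i\<in>D. I i) \<subseteq> (\<Union>i\<in>C. I i)" using DK by (force simp: W_def I_def)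
    qed (use meas in simp)
    also have "\<dots> = (\<integral>\<^sup>+i. emeasure ?\<mu> (I i) \<partial>count_space C)"
      using C unfolding I_def by (subst emeasure_disjoint_cballs) auto
    also have "\<dots> \<le> (\<integral>\<^sup>+i. ennreal p * emeasure lborel (I i) \<partial>count_space C)"
    proof (intro nn_integral_mono)
      fix i assume "i \<in> space (count_space C)"
      then show "emeasure ?\<mu> (I i) \<le> ennreal p * emeasure lborel (I i)"
        using CK[of i] pq by (simp add: \<mu>_ball len ennreal_leI flip: ennreal_mult)
    qed
    also have "\<dots> = ennreal p * emeasure lborel (\<Union>i\<in>C. I i)"
      using C unfolding I_def by (subst emeasure_disjoint_cballs) (auto simp: nn_integral_cmult)
    also have "\<dots> \<le> ennreal p * emeasure lborel U"
      using CK U by (intro mult_left_mono emeasure_mono) auto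
    also have "\<dots> \<le> ennreal p * (?out S + ennreal e)" by (intro mult_left_mono Ule) auto
    finally show ?thesis .
  qed
  have "q * m \<le> p * m"
  proof (rule field_le_epsilon)
    fix e :: real assume "0 < e"
    \<comment> \<open>The error e / (p + 1) is chosen so that the factor p turns it into at most e,
      even for p = 0.\<close>
    have "ennreal (q * m) \<le> ennreal (p * (m + e / (p + 1)))"
      using main[of "e / (p + 1)"] \<open>0 < e\<close> pq out_eq(2) unfolding out_eq(1)
      by (simp add: ennreal_mult[symmetric] ennreal_plus[symmetric] del: ennreal_plus)
    then have "q * m \<le> p * (m + e / (p + 1))"
      using pq out_eq(2) \<open>0 < e\<close> by (subst (asm) ennreal_le_iff) auto
    also have "\<dots> = p * m + p / (p + 1) * e" by (simp add: algebra_simps)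
    also have "\<dots> \<le> p * m + 1 * e" using pq \<open>0 < e\<close> by (intro add_left_mono mult_right_mono) auto
    finally show "q * m \<le> p * m + e" by simp
  qed
  then have "m = 0" using pq out_eq(2) by (auto simp: mult_le_cancel_right)
  then have "?out S = 0" using out_eq by simp
  moreover obtain B where "B \<in> sets lebesgue" "S \<subseteq> B" "?out S = emeasure lebesgue B"
    using outer_measure_of_attain[of S lebesgue] by auto
  ultimately have "B \<in> null_sets lebesgue" "S \<subseteq> B" by auto
  then show ?thesis using negligible_iff_null_sets negligible_subset by blast
qed

text \<open>Stated for Lipschitz functions: the bounds on the difference quotients give finite Dini
  derivatives.\<close>

lemma AE_differentiable_mono_Lipschitz:
  fixes g :: "real \<Rightarrow> real"
  assumes mono: "\<And>x y. x \<le> y \<Longrightarrow> g x \<le> g y" and lip: "\<And>x y. \<bar>g x - g y\<bar> \<le> L * \<bar>x - y\<bar>"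
  shows "AE x in lborel. g differentiable (at x)"
proof -
  define N where "N = {x. \<not> g differentiable (at x)}"
  define Q where "Q x y = (g y - g x) / (y - x)" for x y
  define lower where "lower x = Liminf (at x) (\<lambda>y. ereal (Q x y))" for x
  define upper where "upper x = Limsup (at x) (\<lambda>y. ereal (Q x y))" for x
  have cont: "continuous_on UNIV g"
  proof (rule continuous_at_imp_continuous_on, rule ballI)
    fix x
    have "((\<lambda>y. g y - g x) \<longlongrightarrow> 0) (at x)"
    proof (rule Lim_null_comparison)
      show "eventually (\<lambda>y. norm (g y - g x) \<le> L * \<bar>y - x\<bar>) (at x)"
        using lip by simp
      show "((\<lambda>y. L * \<bar>y - x\<bar>) \<longlongrightarrow> 0) (at x)" by (auto intro!: tendsto_eq_intros)
    qed
    then show "isCont g x" by (simp add: isCont_def LIM_zero_iff)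
  qed
  have "0 \<le> L" using lip[of 1 0] by (simp add: order_trans[OF abs_ge_zero])
  have Q0: "0 \<le> Q x y" for x y
    using mono[of x y] mono[of y x] by (cases "x \<le> y") (auto simp: Q_def divide_nonneg_nonneg divide_nonpos_nonpos)
  have QL: "Q x y \<le> L" if "y \<noteq> x" for x y
  proof -
    have "\<bar>Q x y\<bar> \<le> L"
      using lip[of y x] that by (simp add: Q_def abs_divide pos_divide_le_eq)
    then show ?thesis by simp
  qed
  have lower0: "0 \<le> lower x" for x
    unfolding lower_def by (intro Liminf_bounded always_eventually) (simp add: Q0 zero_ereal_def)
  have upperL: "upper x \<le> ereal L" for x
    unfolding upper_def by (intro Limsup_bounded) (auto simp: eventually_at intro!: exI[of _ 1] QL)
  have diff: "g differentiable (at x)" if "\<not> lower x < upper x" for x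
  proof -
    have le: "lower x \<le> upper x"
      unfolding lower_def upper_def by (intro Liminf_le_Limsup) simp
    then have eq: "lower x = upper x" using that by simp
    obtain l where l: "lower x = ereal l"
    proof (cases "lower x")
      case MInf then show thesis using lower0[of x] by simp
    next
      case PInf then show thesis using upperL[of x] eq by simp
    qed
    have "((\<lambda>y. ereal (Q x y)) \<longlongrightarrow> ereal l) (at x)"
      using l eq by (intro Liminf_eq_Limsup) (auto simp: lower_def upper_def)
    then have "((\<lambda>y. Q x y) \<longlongrightarrow> l) (at x)" by simp
    then have "(g has_real_derivative l) (at x)"
      unfolding has_field_derivative_iff Q_def .
    then show ?thesis by (auto simp: real_differentiable_def)
  qed
  \<comment> \<open>Points where rationals p < q fit strictly between the Dini derivatives; the
    cut-off R makes each set bounded, so that its outer measure is finite.\<close>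
  define G where "G p q R = {x \<in> {-R<..<R}. lower x < ereal p \<and> ereal q < upper x}" for p q R
  have negG: "negligible (G p q R)" if "0 \<le> p" "p < q" for p q R
  proof (rule negligible_of_slope_gap[OF mono cont that])
    show "G p q R \<subseteq> {-R<..<R}" by (auto simp: G_def)
    fix x d :: real assume x: "x \<in> G p q R" and "0 < d"
    have near: "eventually (\<lambda>y. y \<noteq> x \<and> \<bar>y - x\<bar> < d) (at x)"
      using \<open>0 < d\<close> by (auto simp: eventually_at dist_real_def)
    \<comment> \<open>The increment may have either sign, so the interval runs between the minimum
      and the maximum of x and y.\<close>
    have slope: "g (max x y) - g (min x y) = Q x y * (max x y - min x y)" if "y \<noteq> x" for y
      using that by (simp add: Q_def max_def min_def field_simps)
    have "\<exists>\<^sub>F y in at x. Q x y < p"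
      using x Liminf_bounded[where C="ereal p" and F="at x" and X="\<lambda>y. ereal (Q x y)"]
      by (auto simp: G_def lower_def frequently_def not_less)
    then have "\<exists>\<^sub>F y in at x. (y \<noteq> x \<and> \<bar>y - x\<bar> < d) \<and> Q x y < p"
      using near by (rule frequently_eventually_conj)
    then obtain y where y: "Q x y < p" "y \<noteq> x" "\<bar>y - x\<bar> < d"
      using frequently_ex by blast
    then show "\<exists>u v. u \<le> x \<and> x \<le> v \<and> u < v \<and> v - u < d \<and> g v - g u \<le> p * (v - u)"
      using slope[OF y(2)]
      by (intro exI[of _ "min x y"] exI[of _ "max x y"]) (auto intro!: mult_right_mono)
    have "\<exists>\<^sub>F y in at x. q < Q x y"
      using x Limsup_bounded[where C="ereal q" and F="at x" and X="\<lambda>y. ereal (Q x y)"]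
      by (auto simp: G_def upper_def frequently_def not_less)
    then have "\<exists>\<^sub>F y in at x. (y \<noteq> x \<and> \<bar>y - x\<bar> < d) \<and> q < Q x y"
      using near by (rule frequently_eventually_conj)
    then obtain y where y: "q < Q x y" "y \<noteq> x" "\<bar>y - x\<bar> < d"
      using frequently_ex by blast
    then show "\<exists>u v. u \<le> x \<and> x \<le> v \<and> u < v \<and> v - u < d \<and> q * (v - u) \<le> g v - g u"
      using slope[OF y(2)]
      by (intro exI[of _ "min x y"] exI[of _ "max x y"]) (auto intro!: mult_right_mono)
  qed
  have "N \<subseteq> (\<Union>p\<in>\<rat> \<inter> {0..}. \<Union>q\<in>\<rat> \<inter> {p<..}. \<Union>k::nat. G p q (real k))"
  proof
    fix x assume "x \<in> N"
    then have "lower x < upper x" using diff by (auto simp: N_def)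
    then obtain b where b: "lower x < ereal b" "ereal b < upper x"
      using ereal_dense2 by blast
    obtain a where a: "lower x < ereal a" "a < b"
      using ereal_dense2[OF b(1)] by auto
    obtain p where p: "p \<in> \<rat>" "a < p" "p < b" using Rats_dense_in_real[OF a(2)] by auto
    obtain q where q: "q \<in> \<rat>" "p < q" "q < b" using Rats_dense_in_real[OF p(3)] by auto
    have 1: "lower x < ereal p" using a(1) p(2) by (metis ereal_less_eq(3) less_imp_le order_less_le_trans)
    have 2: "ereal q < upper x" using b(2) q(3) by (metis ereal_less_eq(3) less_imp_le order_le_less_trans)
    have "0 \<le> p" using order_le_less_trans[OF lower0 1] by simp
    obtain k :: nat where "\<bar>x\<bar> < real k" using reals_Archimedean2 by blast
    then have "x \<in> G p q (real k)" using 1 2 by (auto simp: G_def)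
    then show "x \<in> (\<Union>p\<in>\<rat> \<inter> {0..}. \<Union>q\<in>\<rat> \<inter> {p<..}. \<Union>k::nat. G p q (real k))"
      using p q \<open>0 \<le> p\<close> by auto
  qed
  moreover have "negligible (\<Union>p\<in>\<rat> \<inter> {0..}. \<Union>q\<in>\<rat> \<inter> {p<..}. \<Union>k::nat. G p q (real k))"
    using countable_rat
    by (intro negligible_UN_countable countable_Int1) (auto intro!: negG)
  ultimately have "negligible N" using negligible_subset by blast
  then have "AE x in lebesgue. x \<notin> N"
    by (intro AE_not_in) (simp add: negligible_iff_null_sets)
  then show ?thesis by (simp add: AE_completion_iff N_def)
qed

section \<open>Stein's identity\<close>

lemma exp_minus_one_bound: "\<bar>exp u - 1\<bar> \<le> \<bar>u\<bar> * exp \<bar>u\<bar>" for u :: real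
proof (cases "0 \<le> u")
  case True
  have "exp u * (1 - u) \<le> exp u * exp (- u)"
    using exp_ge_add_one_self[of "- u"] by (intro mult_left_mono) auto
  then show ?thesis using True by (simp add: algebra_simps exp_minus)
next
  case False
  have "1 - exp u \<le> - u" using exp_ge_add_one_self[of u] by linarith
  also have "\<dots> \<le> - u * exp (- u)" using False mult_left_mono[of 1 "exp (- u)" "- u"] by simp
  finally show ?thesis using False by simp
qed

text \<open>A translation argument in place of integration by parts: shifting the Gaussian by e
  multiplies its density by exp (e x - e^2 / 2), so the integrals of (G (x + e) - G x) / e and of G
  x (exp (e x - e^2 / 2) - 1) / e agree. As e \<rightarrow> 0 dominated convergence gives D on one
  side and x G x on the other; the Lipschitz constant dominates the first.\<close>

lemma gaussian_Stein_real:
  fixes G D :: "real \<Rightarrow> real"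
  assumes lip: "\<And>x y. \<bar>G x - G y\<bar> \<le> L * \<bar>x - y\<bar>"
    and D [measurable]: "D \<in> borel_measurable borel"
    and deriv: "AE x in lborel. (G has_real_derivative D x) (at x)"
  shows "(\<integral>x. x * G x \<partial>std_normal_distribution) = (\<integral>x. D x \<partial>std_normal_distribution)"
proof -
  let ?N = std_normal_distribution
  interpret N: prob_space ?N by (rule prob_space_normal_density) simp
  have "0 \<le> L" using lip[of 1 0] by (simp add: order_trans[OF abs_ge_zero])
  have cont: "isCont G x" for x
  proof -
    have "((\<lambda>y. G y - G x) \<longlongrightarrow> 0) (at x)"
    proof (rule Lim_null_comparison)
      show "eventually (\<lambda>y. norm (G y - G x) \<le> L * \<bar>y - x\<bar>) (at x)"
        using lip by simp
      show "((\<lambda>y. L * \<bar>y - x\<bar>) \<longlongrightarrow> 0) (at x)" by (auto intro!: tendsto_eq_intros)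
    qed
    then show ?thesis by (simp add: isCont_def LIM_zero_iff)
  qed
  then have [measurable]: "G \<in> borel_measurable borel"
    by (intro borel_measurable_continuous_onI) (simp add: continuous_at_imp_continuous_on)
  define C where "C = \<bar>G 0\<bar> + L"
  have G_growth: "\<bar>G x\<bar> \<le> C * exp \<bar>x\<bar>" for x
  proof -
    have "\<bar>G x\<bar> \<le> \<bar>G 0\<bar> + L * \<bar>x\<bar>" using lip[of x 0] by simp
    also have "\<dots> \<le> \<bar>G 0\<bar> * exp \<bar>x\<bar> + L * exp \<bar>x\<bar>"
    proof (rule add_mono)
      show "\<bar>G 0\<bar> \<le> \<bar>G 0\<bar> * exp \<bar>x\<bar>" using mult_left_mono[of 1 "exp \<bar>x\<bar>" "\<bar>G 0\<bar>"] by simp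
      have "\<bar>x\<bar> \<le> exp \<bar>x\<bar>" using exp_ge_add_one_self[of "\<bar>x\<bar>"] by linarith
      then show "L * \<bar>x\<bar> \<le> L * exp \<bar>x\<bar>" using \<open>0 \<le> L\<close> by (rule mult_left_mono)
    qed
    finally show ?thesis by (simp add: C_def algebra_simps)
  qed
  have "0 \<le> C" using \<open>0 \<le> L\<close> by (simp add: C_def)
  \<comment> \<open>Needed to dominate B: the growth of G and the two exponentials bounding the
    density increment multiply to exp (3 |x| + 1). Expanding (|x| / 2 - 3)^2 \<ge> 0 gives the
    constant 10.\<close>
  have exp_bound: "exp (3 * \<bar>x\<bar> + 1) \<le> exp 10 * exp (1 / 4 * x\<^sup>2)" for x :: real
  proof -
    have "0 \<le> (\<bar>x\<bar> / 2 - 3)\<^sup>2" by simp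
    then have "3 * \<bar>x\<bar> + 1 \<le> 10 + 1 / 4 * x\<^sup>2" by (simp add: power2_eq_square algebra_simps)
    then show ?thesis by (simp flip: exp_add)
  qed
  have dom: "integrable ?N (\<lambda>x. C * (exp 10 * exp (1 / 4 * x\<^sup>2)))"
    by (intro integrable_mult_right integrable_gaussian_exp_square) simp
  have G_int: "integrable ?N (\<lambda>x. G (x + e))" for e
  proof (rule integrable_gaussian_of_quadratic)
    fix x
    have "\<bar>G (x + e)\<bar> \<le> \<bar>G e\<bar> + L * \<bar>x\<bar>" using lip[of "x + e" e] by simp
    also have "\<dots> \<le> \<bar>G e\<bar> + L * (1 + x\<^sup>2)"
    proof (intro add_left_mono mult_left_mono)
      have "0 \<le> (\<bar>x\<bar> - 1)\<^sup>2" by simp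
      then show "\<bar>x\<bar> \<le> 1 + x\<^sup>2" by (simp add: power2_eq_square algebra_simps)
    qed (fact \<open>0 \<le> L\<close>)
    finally show "\<bar>G (x + e)\<bar> \<le> (\<bar>G e\<bar> + L) + L * x\<^sup>2" by (simp add: algebra_simps)
  qed measurable
  define e where "e k = 1 / real (Suc k)" for k
  have e: "0 < e k" "e k \<le> 1" for k by (auto simp: e_def field_simps)
  have e_lim: "filterlim e (at 0) sequentially"
    unfolding filterlim_at e_def by (auto intro!: always_eventually) real_asymp
  define A where "A k x = (G (x + e k) - G x) / e k" for k x
  define B where "B k x = G x * ((exp (e k * x - (e k)\<^sup>2 / 2) - 1) / e k)" for k x
  have B_bound: "\<bar>B k x\<bar> \<le> C * (exp 10 * exp (1 / 4 * x\<^sup>2))" for k x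
  proof -
    define u where "u = e k * x - (e k)\<^sup>2 / 2"
    have "\<bar>u\<bar> \<le> e k * \<bar>x\<bar> + (e k)\<^sup>2"
      using e[of k] by (auto simp: u_def abs_mult intro!: order_trans[OF abs_triangle_ineq4])
    also have "\<dots> = e k * (\<bar>x\<bar> + e k)" by (simp add: power2_eq_square algebra_simps)
    also have "\<dots> \<le> e k * (\<bar>x\<bar> + 1)" using e[of k] by (intro mult_left_mono) auto
    finally have u: "\<bar>u\<bar> \<le> e k * (\<bar>x\<bar> + 1)" .
    also have "\<dots> \<le> 1 * (\<bar>x\<bar> + 1)" using e[of k] by (intro mult_right_mono) auto
    finally have u1: "\<bar>u\<bar> \<le> \<bar>x\<bar> + 1" by simp
    have "\<bar>exp u - 1\<bar> \<le> (e k * (\<bar>x\<bar> + 1)) * exp (\<bar>x\<bar> + 1)"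
      using u u1 e[of k] by (intro order_trans[OF exp_minus_one_bound] mult_mono) auto
    also have "\<dots> \<le> (e k * exp \<bar>x\<bar>) * exp (\<bar>x\<bar> + 1)"
      using e[of k] exp_ge_add_one_self[of "\<bar>x\<bar>"]
      by (intro mult_right_mono mult_left_mono) (auto simp: add.commute)
    finally have "\<bar>exp u - 1\<bar> / e k \<le> exp \<bar>x\<bar> * exp (\<bar>x\<bar> + 1)"
      using e[of k] by (simp add: pos_divide_le_eq mult_ac)
    then have "\<bar>G x\<bar> * (\<bar>exp u - 1\<bar> / e k) \<le> (C * exp \<bar>x\<bar>) * (exp \<bar>x\<bar> * exp (\<bar>x\<bar> + 1))"
      using G_growth[of x] \<open>0 \<le> C\<close> e[of k] by (intro mult_mono) auto
    also have "\<dots> = C * exp (3 * \<bar>x\<bar> + 1)" by (simp add: exp_add[symmetric] mult_ac)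
    also have "\<dots> \<le> C * (exp 10 * exp (1 / 4 * x\<^sup>2))"
      using \<open>0 \<le> C\<close> by (intro mult_left_mono exp_bound)
    finally show ?thesis using e[of k] by (simp add: B_def u_def abs_mult)
  qed
  have [measurable]: "A k \<in> borel_measurable borel" "B k \<in> borel_measurable borel" for k
    unfolding A_def B_def by measurable
  have B_int: "integrable ?N (B k)" for k
    by (rule Bochner_Integration.integrable_bound[OF dom])
      (use B_bound in \<open>auto intro!: AE_I2 order_trans[OF _ abs_ge_self]\<close>)
  have AB: "(\<integral>x. A k x \<partial>?N) = (\<integral>x. B k x \<partial>?N)" for k
  proof -
    have shift: "std_normal_density (x - e k) = std_normal_density x * exp (e k * x - (e k)\<^sup>2 / 2)" for x
    proof -
      have "- (x - e k)\<^sup>2 / 2 = - x\<^sup>2 / 2 + (e k * x - (e k)\<^sup>2 / 2)"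
        by (simp add: power2_eq_square field_simps)
      then show ?thesis unfolding std_normal_density_def by (simp only: exp_add mult.assoc)
    qed
    have "(\<integral>x. G (x + e k) \<partial>?N) = (\<integral>x. std_normal_density x * G (x + e k) \<partial>lborel)"
      by (subst integral_density) auto
    also have "\<dots> = (\<integral>x. std_normal_density (x - e k) * G x \<partial>lborel)"
      by (subst lborel_integral_real_affine[where c=1 and t="- e k"]) (auto simp: algebra_simps)
    also have "\<dots> = (\<integral>x. std_normal_density x * (e k * B k x + G x) \<partial>lborel)"
    proof (intro Bochner_Integration.integral_cong refl)
      fix x
      have "e k * B k x = G x * (exp (e k * x - (e k)\<^sup>2 / 2) - 1)"
        using e[of k] by (simp add: B_def)
      then show "std_normal_density (x - e k) * G x = std_normal_density x * (e k * B k x + G x)"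
        by (simp add: shift algebra_simps)
    qed
    also have "\<dots> = (\<integral>x. e k * B k x + G x \<partial>?N)"
      by (subst integral_density) auto
    also have "\<dots> = e k * (\<integral>x. B k x \<partial>?N) + (\<integral>x. G x \<partial>?N)"
      using B_int G_int[of 0] by simp
    finally have "(\<integral>x. G (x + e k) \<partial>?N) - (\<integral>x. G x \<partial>?N) = e k * (\<integral>x. B k x \<partial>?N)" by simp
    moreover have "(\<integral>x. A k x \<partial>?N) = ((\<integral>x. G (x + e k) \<partial>?N) - (\<integral>x. G x \<partial>?N)) / e k"
      using G_int[of 0] G_int[of "e k"] by (simp add: A_def)
    ultimately show ?thesis using e[of k] by simp
  qed
  have "(\<lambda>k. \<integral>x. A k x \<partial>?N) \<longlonglongrightarrow> (\<integral>x. D x \<partial>?N)"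
  proof (rule integral_dominated_convergence)
    show "integrable ?N (\<lambda>x. L)" by simp
    show "AE x in ?N. norm (A k x) \<le> L" for k
      using lip[of _ _] e[of k]
      by (intro AE_I2) (simp add: A_def abs_divide pos_divide_le_eq order_trans[OF lip])
    show "AE x in ?N. (\<lambda>k. A k x) \<longlonglongrightarrow> D x"
    proof -
      have "AE x in lborel. (\<lambda>k. A k x) \<longlonglongrightarrow> D x"
        using deriv
      proof eventually_elim
        case (elim x)
        then have "((\<lambda>r. (G (x + r) - G x) / r) \<longlongrightarrow> D x) (at 0)" by (simp add: DERIV_def)
        from filterlim_compose[OF this e_lim] show ?case by (simp add: A_def)
      qed
      then show ?thesis by (subst AE_density) (auto elim: eventually_mono)
    qed
  qed auto
  moreover have "(\<lambda>k. \<integral>x. B k x \<partial>?N) \<longlonglongrightarrow> (\<integral>x. x * G x \<partial>?N)"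
  proof (rule integral_dominated_convergence[OF _ _ dom])
    show "AE x in ?N. norm (B k x) \<le> C * (exp 10 * exp (1 / 4 * x\<^sup>2))" for k
      using B_bound by (intro AE_I2) simp
    show "AE x in ?N. (\<lambda>k. B k x) \<longlonglongrightarrow> x * G x"
    proof (rule AE_I2)
      fix x
      have "((\<lambda>r. exp (r * x - r\<^sup>2 / 2)) has_real_derivative x) (at 0)"
        by (auto intro!: derivative_eq_intros)
      then have "((\<lambda>r. (exp (r * x - r\<^sup>2 / 2) - 1) / r) \<longlongrightarrow> x) (at 0)"
        by (simp add: DERIV_def)
      from tendsto_mult[OF tendsto_const[of "G x"] filterlim_compose[OF this e_lim]]
      show "(\<lambda>k. B k x) \<longlonglongrightarrow> x * G x" by (simp add: B_def mult.commute)
    qed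
  qed auto
  ultimately show ?thesis
    unfolding AB by (rule LIMSEQ_unique[symmetric])
qed

text \<open>Only rational increments occur on the right, so the points of differentiability form a
  Borel set when \<open>g\<close> depends measurably on a parameter.\<close>

lemma differentiable_iff_Cauchy_rational:
  fixes g :: "real \<Rightarrow> real"
  assumes cont: "continuous_on UNIV g"
  defines "Q \<equiv> \<lambda>x r. (g (x + r) - g x) / r"
  shows "g differentiable (at x) \<longleftrightarrow> (\<forall>k::nat. \<exists>m::nat. \<forall>r\<in>\<rat>. \<forall>s\<in>\<rat>.
    r \<noteq> 0 \<and> s \<noteq> 0 \<and> \<bar>r\<bar> < 1 / real (Suc m) \<and> \<bar>s\<bar> < 1 / real (Suc m) \<longrightarrow>
      \<bar>Q x r - Q x s\<bar> \<le> 1 / real (Suc k))" (is "_ \<longleftrightarrow> ?Cauchy")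
proof
  assume "g differentiable (at x)"
  then obtain l where "(g has_real_derivative l) (at x)" by (auto simp: real_differentiable_def)
  then have lim: "(Q x \<longlongrightarrow> l) (at 0)" by (simp add: DERIV_def Q_def)
  show ?Cauchy
  proof
    fix k :: nat
    define a where "a = 1 / real (Suc k)"
    have "0 < a" by (simp add: a_def)
    then have "eventually (\<lambda>r. dist (Q x r) l < a / 2) (at 0)"
      using lim by (intro tendstoD) auto
    then obtain d where d: "0 < d" "\<And>r. r \<noteq> 0 \<Longrightarrow> \<bar>r\<bar> < d \<Longrightarrow> \<bar>Q x r - l\<bar> < a / 2"
      by (auto simp: eventually_at dist_real_def)
    obtain m where m: "1 / real (Suc m) < d" using nat_approx_posE[OF d(1)] by metis
    have "\<bar>Q x r - Q x s\<bar> \<le> 1 / real (Suc k)"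
      if "r \<noteq> 0" "s \<noteq> 0" "\<bar>r\<bar> < 1 / real (Suc m)" "\<bar>s\<bar> < 1 / real (Suc m)" for r s
    proof -
      have "\<bar>Q x r - l\<bar> < a / 2" "\<bar>Q x s - l\<bar> < a / 2"
        using d(2) that m by auto
      then have "\<bar>Q x r - Q x s\<bar> \<le> a" by linarith
      then show ?thesis by (simp add: a_def)
    qed
    then show "\<exists>m::nat. \<forall>r\<in>\<rat>. \<forall>s\<in>\<rat>.
      r \<noteq> 0 \<and> s \<noteq> 0 \<and> \<bar>r\<bar> < 1 / real (Suc m) \<and> \<bar>s\<bar> < 1 / real (Suc m) \<longrightarrow>
      \<bar>Q x r - Q x s\<bar> \<le> 1 / real (Suc k)" by blast
  qed
next
  assume C: ?Cauchy
  \<comment> \<open>Rational increments approximate real ones, and the difference quotient is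
    continuous in a nonzero increment, so the Cauchy condition extends to all increments.\<close>
  have C': "\<exists>m::nat. \<forall>r s. r \<noteq> 0 \<and> s \<noteq> 0 \<and> \<bar>r\<bar> < 1 / real (Suc m) \<and> \<bar>s\<bar> < 1 / real (Suc m) \<longrightarrow>
      \<bar>Q x r - Q x s\<bar> \<le> 1 / real (Suc k)" for k
  proof -
    obtain m where m: "\<And>r s. r \<in> \<rat> \<Longrightarrow> s \<in> \<rat> \<Longrightarrow> r \<noteq> 0 \<Longrightarrow> s \<noteq> 0 \<Longrightarrow> \<bar>r\<bar> < 1 / real (Suc m)
      \<Longrightarrow> \<bar>s\<bar> < 1 / real (Suc m) \<Longrightarrow> \<bar>Q x r - Q x s\<bar> \<le> 1 / real (Suc k)"
      using C by meson
    have app: "\<exists>f. (\<forall>j. f j \<in> \<rat> \<and> f j \<noteq> 0 \<and> \<bar>f j\<bar> < 1 / real (Suc m)) \<and> f \<longlonglongrightarrow> r"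
      if "r \<noteq> 0" "\<bar>r\<bar> < 1 / real (Suc m)" for r :: real
    proof -
      define S where "S = ball 0 (1 / real (Suc m)) - {0::real}"
      have "open S" "r \<in> S" using that by (auto simp: S_def dist_real_def)
      moreover have "closure (\<rat> :: real set) = UNIV" by (rule Rats_closure_real)
      ultimately have "r \<in> closure (S \<inter> \<rat>)"
        using open_Int_closure_subset[of S \<rat>] by auto
      then obtain f where "\<And>j. f j \<in> S \<inter> \<rat>" "f \<longlonglongrightarrow> r" by (auto simp: closure_sequential)
      then show ?thesis by (intro exI[of _ f]) (auto simp: S_def dist_real_def)
    qed
    have Qlim: "(\<lambda>j. Q x (f j)) \<longlonglongrightarrow> Q x r" if "r \<noteq> 0" "f \<longlonglongrightarrow> r" for f r
    proof -
      have "isCont g (x + r)" using cont by (simp add: continuous_on_eq_continuous_at)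
      then have "(\<lambda>j. g (x + f j)) \<longlonglongrightarrow> g (x + r)"
        using that(2) by (intro isCont_tendsto_compose[of _ g] tendsto_intros)
      then show ?thesis using that unfolding Q_def by (intro tendsto_intros) auto
    qed
    have "\<bar>Q x r - Q x s\<bar> \<le> 1 / real (Suc k)"
      if rs: "r \<noteq> 0" "s \<noteq> 0" "\<bar>r\<bar> < 1 / real (Suc m)" "\<bar>s\<bar> < 1 / real (Suc m)" for r s
    proof -
      obtain f where f: "\<And>j. f j \<in> \<rat> \<and> f j \<noteq> 0 \<and> \<bar>f j\<bar> < 1 / real (Suc m)" "f \<longlonglongrightarrow> r"
        using app[OF rs(1,3)] by blast
      obtain h where h: "\<And>j. h j \<in> \<rat> \<and> h j \<noteq> 0 \<and> \<bar>h j\<bar> < 1 / real (Suc m)" "h \<longlonglongrightarrow> s"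
        using app[OF rs(2,4)] by blast
      have "(\<lambda>j. \<bar>Q x (f j) - Q x (h j)\<bar>) \<longlonglongrightarrow> \<bar>Q x r - Q x s\<bar>"
        by (intro tendsto_intros Qlim rs f h)
      then show ?thesis
        by (rule LIMSEQ_le_const2) (use m f h in blast)
    qed
    then show ?thesis by blast
  qed
  \<comment> \<open>The double successor makes e j strictly smaller than 1 / (m + 1) already for j =
    m.\<close>
  define e where "e j = 1 / real (Suc (Suc j))" for j
  have e: "e j \<noteq> 0" "\<bar>e j\<bar> < 1 / real (Suc m)" if "m \<le> j" for j m
    using that by (auto simp: e_def field_simps)
  have "Cauchy (\<lambda>j. Q x (e j))"
    unfolding Cauchy_altdef2
  proof (intro allI impI)
    fix d :: real assume "0 < d"
    obtain k where k: "1 / real (Suc k) < d" using nat_approx_posE[OF \<open>0 < d\<close>] by metis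
    obtain m where m: "\<And>r s. r \<noteq> 0 \<and> s \<noteq> 0 \<and> \<bar>r\<bar> < 1 / real (Suc m) \<and> \<bar>s\<bar> < 1 / real (Suc m) \<Longrightarrow>
      \<bar>Q x r - Q x s\<bar> \<le> 1 / real (Suc k)" using C'[of k] by blast
    show "\<exists>N. \<forall>n\<ge>N. dist (Q x (e n)) (Q x (e N)) < d"
      using m[of "e _" "e m"] e k
      by (intro exI[of _ m]) (auto simp: dist_real_def intro!: le_less_trans[OF m k])
  qed
  then obtain l where l: "(\<lambda>j. Q x (e j)) \<longlonglongrightarrow> l" by (auto simp: Cauchy_convergent_iff convergent_def)
  have "(Q x \<longlongrightarrow> l) (at 0)"
  proof (rule tendstoI)
    fix d :: real assume "0 < d"
    obtain k where k: "1 / real (Suc k) < d" using nat_approx_posE[OF \<open>0 < d\<close>] by metis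
    obtain m where m: "\<And>r s. r \<noteq> 0 \<and> s \<noteq> 0 \<and> \<bar>r\<bar> < 1 / real (Suc m) \<and> \<bar>s\<bar> < 1 / real (Suc m) \<Longrightarrow>
      \<bar>Q x r - Q x s\<bar> \<le> 1 / real (Suc k)" using C'[of k] by blast
    have "\<bar>Q x r - l\<bar> \<le> 1 / real (Suc k)" if "r \<noteq> 0" "\<bar>r\<bar> < 1 / real (Suc m)" for r
    proof (rule LIMSEQ_le_const2)
      show "(\<lambda>j. \<bar>Q x r - Q x (e j)\<bar>) \<longlonglongrightarrow> \<bar>Q x r - l\<bar>" by (intro tendsto_intros l)
      show "\<exists>N. \<forall>j\<ge>N. \<bar>Q x r - Q x (e j)\<bar> \<le> 1 / real (Suc k)"
        using that e by (intro exI[of _ m] allI impI m) auto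
    qed
    then have "\<bar>Q x r - l\<bar> < d" if "r \<noteq> 0" "\<bar>r\<bar> < 1 / real (Suc m)" for r
      using that k by (meson le_less_trans)
    then show "eventually (\<lambda>r. dist (Q x r) l < d) (at 0)"
      by (auto simp: eventually_at dist_real_def intro!: exI[of _ "1 / real (Suc m)"])
  qed
  then show "g differentiable (at x)"
    unfolding real_differentiable_def DERIV_def Q_def by blast
qed

text \<open>Where g is not differentiable, \<open>deriv\<close> chooses from the empty predicate,
  and this value is the same for all g and x. Hence \<open>deriv\<close> is a sequential limit on a
  measurable set and constant off it.\<close>

lemma deriv_eq_lim:
  fixes g :: "real \<Rightarrow> real"
  shows "deriv g x = (if g differentiable (at x)
    then lim (\<lambda>j. (g (x + 1 / real (Suc j)) - g x) / (1 / real (Suc j))) else (SOME D. False))"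
proof (cases "g differentiable (at x)")
  case True
  then obtain l where l: "(g has_real_derivative l) (at x)" by (auto simp: real_differentiable_def)
  have "filterlim (\<lambda>j. 1 / real (Suc j)) (at 0) sequentially"
    unfolding filterlim_at by (auto intro!: always_eventually) real_asymp
  moreover have "((\<lambda>r. (g (x + r) - g x) / r) \<longlongrightarrow> l) (at 0)" using l by (simp add: DERIV_def)
  ultimately have "(\<lambda>j. (g (x + 1 / real (Suc j)) - g x) / (1 / real (Suc j))) \<longlonglongrightarrow> l"
    by (rule filterlim_compose[rotated])
  then show ?thesis using True DERIV_imp_deriv[OF l] by (simp add: limI del: of_nat_Suc)
next
  case False
  then have "(\<lambda>D. (g has_real_derivative D) (at x)) = (\<lambda>D. False)"
    by (auto simp: real_differentiable_def)
  then show ?thesis using False by (simp add: deriv_def)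
qed

lemma pred_countable_Ball:
  assumes "countable X" "\<And>i. i \<in> X \<Longrightarrow> Measurable.pred M (\<lambda>x. P x i)"
  shows "Measurable.pred M (\<lambda>x. \<forall>i\<in>X. P x i)"
proof (cases "X = {}")
  case False
  then have "(\<forall>i\<in>X. P x i) \<longleftrightarrow> (\<forall>n. P x (from_nat_into X n))" for x
    using assms(1) by (metis from_nat_into from_nat_into_surj)
  then show ?thesis
    using assms(2)[OF from_nat_into[OF False]] by (simp only: pred_intros_countable)
qed simp

text \<open>The evaluation point c y moves with the parameter, because a partial derivative is taken
  at the current value of its own coordinate.\<close>

lemma borel_measurable_deriv_family:
  fixes g :: "'a \<Rightarrow> real \<Rightarrow> real"
  assumes cont: "\<And>y. continuous_on UNIV (g y)"
    and meas: "\<And>r. (\<lambda>y. g y (c y + r)) \<in> borel_measurable M"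
  shows "(\<lambda>y. deriv (g y) (c y)) \<in> borel_measurable M"
    and "Measurable.pred M (\<lambda>y. g y differentiable (at (c y)))"
proof -
  note [measurable] = meas meas[of 0, simplified]
  show [measurable]: "Measurable.pred M (\<lambda>y. g y differentiable (at (c y)))"
    unfolding differentiable_iff_Cauchy_rational[OF cont]
    by (intro pred_intros_countable pred_countable_Ball countable_rat) measurable
  show "(\<lambda>y. deriv (g y) (c y)) \<in> borel_measurable M"
    unfolding deriv_eq_lim by measurable
qed

section \<open>Partial derivatives of the projection under the Gaussian law\<close>

definition zero_extend :: "nat \<Rightarrow> (nat \<Rightarrow> real) \<Rightarrow> nat \<Rightarrow> real"
  where "zero_extend n x = (\<lambda>i. if i < n then x i else 0)"

lemma measurable_zero_extend' [measurable]:
  "zero_extend n \<in> borel_measurable (gauss_PiM {..<n})"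
  unfolding zero_extend_def by (rule measurable_zero_extend)

lemma std_gaussian_eq: "std_gaussian n = distr (gauss_PiM {..<n}) borel (zero_extend n)"
  by (simp add: std_gaussian_def zero_extend_def[abs_def])

lemma zero_extend_component: "i < n \<Longrightarrow> zero_extend n x i = x i"
  by (simp add: zero_extend_def)

lemma zero_extend_upd: "i < n \<Longrightarrow> zero_extend n (x(i := s)) = (zero_extend n x)(i := s)"
  by (auto simp: zero_extend_def)

lemma vnorm_zero_extend_square: "(vnorm n (zero_extend n x))\<^sup>2 = (\<Sum>i<n. (x i)\<^sup>2)"
  unfolding vnorm_square vinner_def zero_extend_def by (intro sum.cong) (auto simp: power2_eq_square)

lemma continuous_on_fun_upd:
  fixes i :: 'b
  assumes "continuous_on S f" "continuous_on S g"
  shows "continuous_on S (\<lambda>x. (f x)(i := g x :: real))"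
proof (rule continuous_on_coordinatewise_then_product)
  fix j
  have "continuous_on S (\<lambda>x. f x j)"
    using assms(1) by (rule continuous_on_product_then_coordinatewise)
  then show "continuous_on S (\<lambda>x. ((f x)(i := g x)) j)"
    using assms(2) by (cases "j = i") auto
qed

lemma continuous_on_shift_scale:
  "continuous_on S (\<lambda>h. \<mu>\<^sub>0 + \<sigma> *\<^sub>R h :: nat \<Rightarrow> real)"
proof (rule continuous_on_coordinatewise_then_product)
  fix i
  have "continuous_on S (\<lambda>h::nat \<Rightarrow> real. \<mu>\<^sub>0 i + \<sigma> * h i)"
    by (intro continuous_on_add continuous_on_mult continuous_on_const
        continuous_on_product_then_coordinatewise[OF continuous_on_id])
  then show "continuous_on S (\<lambda>h. (\<mu>\<^sub>0 + \<sigma> *\<^sub>R h) i)"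
    by (simp add: scaleR_fun_def)
qed

context closed_convex_set
begin

lemma continuous_on_proj_comp:
  assumes "continuous_on S f"
  shows "continuous_on S (\<lambda>x. proj (f x) i)"
  using continuous_on_product_then_coordinatewise[OF continuous_on_proj, of UNIV i] assms
  by (rule continuous_on_compose2) auto

lemma borel_measurable_mu_seq [measurable]: "(\<lambda>h. mu_seq n K \<mu>\<^sub>0 \<sigma> h i) \<in> borel_measurable borel"
  unfolding mu_seq_def
  by (intro borel_measurable_continuous_onI continuous_on_proj_comp continuous_on_shift_scale)

lemma borel_measurable_component [measurable]: "(\<lambda>h::nat \<Rightarrow> real. h i) \<in> borel_measurable borel"
  by (intro borel_measurable_continuous_onI) simp

lemma borel_measurable_err [measurable]: "err n K \<mu>\<^sub>0 \<sigma> \<in> borel_measurable borel"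
  unfolding err_def[abs_def] L2_set_def by simp

lemma borel_measurable_lrt [measurable]: "lrt n K \<mu>\<^sub>0 \<sigma> \<in> borel_measurable borel"
  unfolding lrt_def[abs_def] L2_set_def scaleR_fun_def by simp

lemma proj_center: "i < n \<Longrightarrow> proj \<mu>\<^sub>0 i = \<mu>\<^sub>0 i"
proof -
  assume "i < n"
  have "vnorm n (\<mu>\<^sub>0 - proj \<mu>\<^sub>0) \<le> vnorm n (\<mu>\<^sub>0 - \<mu>\<^sub>0)"
    using proj_minimizes center_in_K by blast
  also have "\<dots> = 0" by (simp add: L2_set_def)
  finally show ?thesis using abs_le_vnorm[OF \<open>i < n\<close>, of "\<mu>\<^sub>0 - proj \<mu>\<^sub>0"] by simp
qed

text \<open>\<open>proj_monotone\<close> for two points that differ only in coordinate i: the inner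
  product collapses to (t - s) times the increment of the i-th component.\<close>

lemma proj_section_mono:
  assumes "i < n" "s \<le> t"
  shows "proj (y(i := s)) i \<le> proj (y(i := t)) i"
proof -
  define p where "p = proj (y(i := t)) - proj (y(i := s))"
  have "0 \<le> vinner n (y(i := t) - y(i := s)) p"
    unfolding p_def by (rule order_trans[OF vinner_self_nonneg proj_monotone])
  also have "\<dots> = (\<Sum>j<n. if j = i then (t - s) * p i else 0)"
    unfolding vinner_def by (intro sum.cong) auto
  also have "\<dots> = (t - s) * p i" using assms by simp
  finally have "0 \<le> (t - s) * p i" .
  show ?thesis
  proof (cases "s = t")
    case False
    then have "0 \<le> p i" using \<open>0 \<le> (t - s) * p i\<close> assms(2) by (simp add: zero_le_mult_iff)
    then show ?thesis by (simp add: p_def)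
  qed simp
qed

lemma proj_section_Lipschitz:
  assumes "i < n"
  shows "\<bar>proj (y(i := s)) i - proj (y(i := t)) i\<bar> \<le> \<bar>s - t\<bar>"
proof -
  have "vnorm n (y(i := s) - y(i := t)) = L2_set (\<lambda>j. if j = i then s - t else 0) {..<n}"
    by (intro L2_set_cong) auto
  also have "\<dots> = \<bar>s - t\<bar>"
  proof -
    have "(\<Sum>j<n. (if j = i then s - t else 0)\<^sup>2) = (\<Sum>j<n. if j = i then (s - t)\<^sup>2 else 0)"
      by (intro sum.cong) auto
    then show ?thesis using assms by (simp add: L2_set_def)
  qed
  finally show ?thesis using proj_component_lipschitz[of "y(i := s)" i "y(i := t)"] by simp
qed

definition partial_proj :: "real \<Rightarrow> nat \<Rightarrow> (nat \<Rightarrow> real) \<Rightarrow> real"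
  where "partial_proj \<sigma> i h =
    deriv (\<lambda>t. proj ((\<mu>\<^sub>0 + \<sigma> *\<^sub>R h)(i := t)) i) ((\<mu>\<^sub>0 + \<sigma> *\<^sub>R h) i)"

lemma div_mu_seq_eq: "div_mu_seq n K \<mu>\<^sub>0 \<sigma> h = (\<Sum>i<n. partial_proj \<sigma> i h)"
  by (simp add: div_mu_seq_def divergence_def partial_proj_def)

lemma borel_measurable_partial_proj [measurable]: "partial_proj \<sigma> i \<in> borel_measurable borel"
  unfolding partial_proj_def[abs_def]
proof (rule borel_measurable_deriv_family)
  show "continuous_on UNIV (\<lambda>t. proj ((\<mu>\<^sub>0 + \<sigma> *\<^sub>R h)(i := t)) i)" for h
    by (intro continuous_on_proj_comp continuous_on_fun_upd continuous_intros)
  show "(\<lambda>h. proj ((\<mu>\<^sub>0 + \<sigma> *\<^sub>R h)(i := (\<mu>\<^sub>0 + \<sigma> *\<^sub>R h) i + r)) i) \<in> borel_measurable borel" for r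
    by (intro borel_measurable_continuous_onI continuous_on_proj_comp continuous_on_fun_upd
        continuous_on_shift_scale continuous_on_add continuous_on_const
        continuous_on_product_then_coordinatewise[OF continuous_on_shift_scale])
qed

text \<open>Differentiability is obtained in the noise coordinate s, over which Gaussian integration
  takes place; the chain rule produces the factor \<sigma>. The bounds 0 and 1 are inherited from
  the difference quotients of the projection along the line.\<close>

lemma AE_partial_proj_section:
  fixes h :: "nat \<Rightarrow> real"
  assumes "i < n" "0 < \<sigma>"
  defines "G \<equiv> \<lambda>s. mu_seq n K \<mu>\<^sub>0 \<sigma> (h(i := s)) i - \<mu>\<^sub>0 i"
  shows "AE s in lborel. (G has_real_derivative \<sigma> * partial_proj \<sigma> i (h(i := s))) (at s)
    \<and> 0 \<le> partial_proj \<sigma> i (h(i := s)) \<and> partial_proj \<sigma> i (h(i := s)) \<le> 1"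
    and "\<bar>G s - G t\<bar> \<le> \<sigma> * \<bar>s - t\<bar>"
proof -
  define y where "y = \<mu>\<^sub>0 + \<sigma> *\<^sub>R h"
  define g where "g = (\<lambda>t. proj (y(i := t)) i)"
  have arg: "\<mu>\<^sub>0 + \<sigma> *\<^sub>R (h(i := s)) = y(i := \<mu>\<^sub>0 i + \<sigma> * s)" for s
    by (auto simp: y_def scaleR_fun_def fun_eq_iff)
  have G_eq: "G s = g (\<mu>\<^sub>0 i + \<sigma> * s) - \<mu>\<^sub>0 i" for s
    by (simp add: G_def mu_seq_def arg g_def)
  have pp: "partial_proj \<sigma> i (h(i := s)) = deriv g (\<mu>\<^sub>0 i + \<sigma> * s)" for s
    by (simp add: partial_proj_def arg g_def)
  have g_mono: "g s \<le> g t" if "s \<le> t" for s t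
    using proj_section_mono[OF assms(1) that] by (simp add: g_def)
  have g_lip: "\<bar>g s - g t\<bar> \<le> \<bar>s - t\<bar>" for s t
    using proj_section_Lipschitz[OF assms(1)] by (simp add: g_def)
  show G_lip: "\<bar>G s - G t\<bar> \<le> \<sigma> * \<bar>s - t\<bar>" for s t
  proof -
    have "\<bar>G s - G t\<bar> \<le> \<bar>\<sigma> * (s - t)\<bar>"
      using g_lip[of "\<mu>\<^sub>0 i + \<sigma> * s" "\<mu>\<^sub>0 i + \<sigma> * t"] by (simp add: G_eq right_diff_distrib)
    then show ?thesis using assms(2) by (simp add: abs_mult)
  qed
  have "AE s in lborel. G differentiable (at s)"
    using G_lip assms(2)
    by (intro AE_differentiable_mono_Lipschitz[of G \<sigma>]) (auto simp: G_eq intro!: g_mono)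
  then show "AE s in lborel. (G has_real_derivative \<sigma> * partial_proj \<sigma> i (h(i := s))) (at s)
    \<and> 0 \<le> partial_proj \<sigma> i (h(i := s)) \<and> partial_proj \<sigma> i (h(i := s)) \<le> 1"
  proof eventually_elim
    case (elim s)
    then obtain d where d: "(G has_real_derivative d) (at s)" by (auto simp: real_differentiable_def)
    define a where "a = \<mu>\<^sub>0 i + \<sigma> * s"
    have s_eq: "(a - \<mu>\<^sub>0 i) / \<sigma> = s" using assms(2) by (simp add: a_def)
    \<comment> \<open>Inverting a = mu0 i + \<sigma> s turns the derivative of G into a genuine
      partial derivative of the projection at a, so \<open>deriv\<close> takes the value d /
      \<sigma> there and not its default.\<close>
    have "((\<lambda>t. G ((t - \<mu>\<^sub>0 i) / \<sigma>) + \<mu>\<^sub>0 i) has_real_derivative d * (1 / \<sigma>)) (at a)"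
      using d assms(2) by (auto intro!: derivative_eq_intros DERIV_chain2[of G d] simp: s_eq)
    also have "(\<lambda>t. G ((t - \<mu>\<^sub>0 i) / \<sigma>) + \<mu>\<^sub>0 i) = g" using assms(2) by (auto simp: G_eq)
    finally have g': "(g has_real_derivative d / \<sigma>) (at a)" by simp
    then have pd: "partial_proj \<sigma> i (h(i := s)) = d / \<sigma>"
      unfolding pp a_def by (rule DERIV_imp_deriv)
    have lim: "((\<lambda>r. (g (a + r) - g a) / r) \<longlongrightarrow> d / \<sigma>) (at 0)" using g' by (simp add: DERIV_def)
    have "0 \<le> (g (a + r) - g a) / r" for r
      using g_mono[of a "a + r"] g_mono[of "a + r" a]
      by (cases "0 \<le> r") (auto simp: divide_nonneg_nonneg divide_nonpos_nonpos)
    then have "0 \<le> d / \<sigma>" by (intro tendsto_lowerbound[OF lim]) auto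
    moreover have "(g (a + r) - g a) / r \<le> 1" for r
    proof -
      have "\<bar>(g (a + r) - g a) / r\<bar> \<le> 1"
        using g_lip[of "a + r" a] by (cases "r = 0") (auto simp: abs_divide)
      then show ?thesis by (rule order_trans[OF abs_ge_self])
    qed
    then have "d / \<sigma> \<le> 1" by (intro tendsto_upperbound[OF lim]) auto
    ultimately show ?case using d assms(2) by (simp add: pd)
  qed
qed

text \<open>Fubini: on each line parallel to axis i the exceptional set is null, so the integral of
  its measurable indicator vanishes.\<close>

lemma AE_partial_proj_bounds:
  assumes "i < n" "0 < \<sigma>"
  shows "AE x in gauss_PiM {..<n}. 0 \<le> partial_proj \<sigma> i (zero_extend n x)
    \<and> partial_proj \<sigma> i (zero_extend n x) \<le> 1"
proof -
  define I where "I = {..<n} - {i}"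
  have I: "finite I" "i \<notin> I" "insert i I = {..<n}" using assms by (auto simp: I_def)
  define P where "P h \<longleftrightarrow> 0 \<le> partial_proj \<sigma> i h \<and> partial_proj \<sigma> i h \<le> 1" for h
  have [measurable]: "Measurable.pred borel P" unfolding P_def by measurable
  define f where "f x = (indicator {h. \<not> P h} (zero_extend n x) :: ennreal)" for x
  have fm: "f \<in> borel_measurable (gauss_PiM (insert i I))"
    unfolding f_def I(3) by measurable
  have "(\<integral>\<^sup>+x. f x \<partial>gauss_PiM (insert i I)) = (\<integral>\<^sup>+x. (\<integral>\<^sup>+s. f (x(i := s)) \<partial>std_normal_distribution) \<partial>gauss_PiM I)"
    using I fm by (intro gauss.product_nn_integral_insert) auto
  also have "\<dots> = (\<integral>\<^sup>+x. 0 \<partial>gauss_PiM I)"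
  proof (rule nn_integral_cong)
    fix x :: "nat \<Rightarrow> real"
    have "AE s in lborel. P ((zero_extend n x)(i := s))"
      using AE_partial_proj_section(1)[OF assms, of "zero_extend n x"] unfolding P_def
      by eventually_elim simp
    then have "AE s in std_normal_distribution. P ((zero_extend n x)(i := s))"
      by (subst AE_density) (auto elim: eventually_mono)
    then have "AE s in std_normal_distribution. f (x(i := s)) = 0"
      by eventually_elim (simp add: f_def zero_extend_upd[OF assms(1)])
    then have "(\<integral>\<^sup>+s. f (x(i := s)) \<partial>std_normal_distribution) = (\<integral>\<^sup>+s. 0 \<partial>std_normal_distribution)"
      by (rule nn_integral_cong_AE)
    then show "(\<integral>\<^sup>+s. f (x(i := s)) \<partial>std_normal_distribution) = 0" by simp
  qed
  finally have "(\<integral>\<^sup>+x. f x \<partial>gauss_PiM {..<n}) = 0" by (simp add: I)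
  then have "AE x in gauss_PiM {..<n}. f x = 0"
    using fm I by (subst (asm) nn_integral_0_iff_AE) auto
  then show ?thesis
    by eventually_elim (auto simp: f_def P_def indicator_def split: if_splits)
qed

lemma integrable_partial_proj:
  assumes "i < n" "0 < \<sigma>"
  shows "integrable (gauss_PiM {..<n}) (\<lambda>x. partial_proj \<sigma> i (zero_extend n x))"
proof -
  interpret prob_space "gauss_PiM {..<n}" by (intro prob_space_PiM prob_space_normal_density) simp
  show ?thesis
    using AE_partial_proj_bounds[OF assms]
    by (intro integrable_const_bound[of _ 1]) (auto elim: eventually_mono)
qed

lemma mu_seq_component_bound:
  "i < n \<Longrightarrow> \<bar>mu_seq n K \<mu>\<^sub>0 \<sigma> h i - \<mu>\<^sub>0 i\<bar> \<le> \<bar>\<sigma>\<bar> * vnorm n h"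
proof -
  assume "i < n"
  have "\<bar>mu_seq n K \<mu>\<^sub>0 \<sigma> h i - \<mu>\<^sub>0 i\<bar> \<le> vnorm n (\<sigma> *\<^sub>R h)"
    using proj_component_lipschitz[of "\<mu>\<^sub>0 + \<sigma> *\<^sub>R h" i \<mu>\<^sub>0] proj_center[OF \<open>i < n\<close>]
    by (simp add: mu_seq_def)
  also have "\<dots> = \<bar>\<sigma>\<bar> * vnorm n h"
    by (rule power2_eq_imp_eq) (simp_all add: vnorm_scaleR_square power_mult_distrib L2_set_nonneg)
  finally show ?thesis .
qed

lemma integrable_component_times_mu_seq:
  assumes "i < n"
  shows "integrable (gauss_PiM {..<n}) (\<lambda>x. x i * (mu_seq n K \<mu>\<^sub>0 \<sigma> (zero_extend n x) i - \<mu>\<^sub>0 i))"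
proof (rule integrable_gauss_PiM_of_quadratic)
  have "(\<lambda>x. x i) \<in> gauss_PiM {..<n} \<rightarrow>\<^sub>M std_normal_distribution"
    using assms by (intro measurable_component_singleton) auto
  then have [measurable]: "(\<lambda>x. x i) \<in> borel_measurable (gauss_PiM {..<n})" by simp
  show "(\<lambda>x. x i * (mu_seq n K \<mu>\<^sub>0 \<sigma> (zero_extend n x) i - \<mu>\<^sub>0 i)) \<in> borel_measurable (gauss_PiM {..<n})"
    by measurable
  fix x :: "nat \<Rightarrow> real"
  define h where "h = zero_extend n x"
  have "\<bar>h i * (mu_seq n K \<mu>\<^sub>0 \<sigma> h i - \<mu>\<^sub>0 i)\<bar> \<le> vnorm n h * (\<bar>\<sigma>\<bar> * vnorm n h)"
    unfolding abs_mult using assms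
    by (intro mult_mono abs_le_vnorm mu_seq_component_bound) (auto simp: L2_set_nonneg)
  also have "\<dots> = 0 + \<bar>\<sigma>\<bar> * (\<Sum>i<n. (x i)\<^sup>2)"
    unfolding vnorm_zero_extend_square[symmetric] by (simp add: h_def power2_eq_square)
  finally show "\<bar>x i * (mu_seq n K \<mu>\<^sub>0 \<sigma> (zero_extend n x) i - \<mu>\<^sub>0 i)\<bar> \<le> 0 + \<bar>\<sigma>\<bar> * (\<Sum>i<n. (x i)\<^sup>2)"
    using assms by (simp add: h_def zero_extend_component)
qed simp

text \<open>Coordinate i is integrated first, where the one-dimensional identity applies with
  Lipschitz constant \<sigma>.\<close>

lemma Stein_component:
  assumes "i < n" "0 < \<sigma>"
  shows "(\<integral>x. x i * (mu_seq n K \<mu>\<^sub>0 \<sigma> (zero_extend n x) i - \<mu>\<^sub>0 i) \<partial>gauss_PiM {..<n})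
    = \<sigma> * (\<integral>x. partial_proj \<sigma> i (zero_extend n x) \<partial>gauss_PiM {..<n})"
proof -
  define I where "I = {..<n} - {i}"
  have I: "finite I" "i \<notin> I" "insert i I = {..<n}" using assms by (auto simp: I_def)
  have "(\<integral>x. x i * (mu_seq n K \<mu>\<^sub>0 \<sigma> (zero_extend n x) i - \<mu>\<^sub>0 i) \<partial>gauss_PiM (insert i I))
      = (\<integral>x. (\<integral>s. (x(i := s)) i * (mu_seq n K \<mu>\<^sub>0 \<sigma> (zero_extend n (x(i := s))) i - \<mu>\<^sub>0 i)
          \<partial>std_normal_distribution) \<partial>gauss_PiM I)"
    using I integrable_component_times_mu_seq[OF assms(1), of \<sigma>]
    by (intro gauss.product_integral_insert) auto
  also have "\<dots> = (\<integral>x. (\<integral>s. \<sigma> * partial_proj \<sigma> i (zero_extend n (x(i := s)))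
      \<partial>std_normal_distribution) \<partial>gauss_PiM I)"
  proof (rule Bochner_Integration.integral_cong[OF refl])
    fix x :: "nat \<Rightarrow> real"
    define h where "h = zero_extend n x"
    have "(\<lambda>s. h(i := s)) \<in> borel_measurable borel"
      by (intro borel_measurable_continuous_onI continuous_on_fun_upd) auto
    then have [measurable]: "(\<lambda>s. partial_proj \<sigma> i (h(i := s))) \<in> borel_measurable borel"
      by (rule measurable_compose[OF _ borel_measurable_partial_proj])
    have "(\<integral>s. s * (mu_seq n K \<mu>\<^sub>0 \<sigma> (h(i := s)) i - \<mu>\<^sub>0 i) \<partial>std_normal_distribution)
        = (\<integral>s. \<sigma> * partial_proj \<sigma> i (h(i := s)) \<partial>std_normal_distribution)"
    proof (rule gaussian_Stein_real[where L=\<sigma>])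
      show "AE s in lborel. ((\<lambda>s. mu_seq n K \<mu>\<^sub>0 \<sigma> (h(i := s)) i - \<mu>\<^sub>0 i) has_real_derivative
          \<sigma> * partial_proj \<sigma> i (h(i := s))) (at s)"
        using AE_partial_proj_section(1)[OF assms, of h] by eventually_elim simp
    qed (use AE_partial_proj_section(2)[OF assms, of h] in auto)
    then show "(\<integral>s. (x(i := s)) i * (mu_seq n K \<mu>\<^sub>0 \<sigma> (zero_extend n (x(i := s))) i - \<mu>\<^sub>0 i)
          \<partial>std_normal_distribution)
      = (\<integral>s. \<sigma> * partial_proj \<sigma> i (zero_extend n (x(i := s))) \<partial>std_normal_distribution)"
      by (simp add: zero_extend_upd[OF assms(1)] h_def)
  qed
  also have "\<dots> = (\<integral>x. \<sigma> * partial_proj \<sigma> i (zero_extend n x) \<partial>gauss_PiM (insert i I))"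
    using I integrable_partial_proj[OF assms]
    by (intro gauss.product_integral_insert[symmetric]) auto
  finally show ?thesis by (simp add: I)
qed

end

section \<open>Moment generating function and concentration\<close>

text \<open>The left-over exp x + exp (- x) - 2 is the square of exp z - exp (- z) with z = x / 2,
  and this difference is at least x for x \<ge> 0.\<close>

lemma exp_plus_exp_minus_ge: "2 + x\<^sup>2 \<le> exp x + exp (- x)" for x :: real
proof -
  have *: "2 + x\<^sup>2 \<le> exp x + exp (- x)" if "0 \<le> x" for x :: real
  proof -
    define z where "z = x / 2"
    have z: "0 \<le> z" using that by (simp add: z_def)
    have low: "1 + z + z\<^sup>2 / 2 \<le> exp z" using z by (rule exp_lower_Taylor_quadratic)
    \<comment> \<open>The product of the two quadratic Taylor polynomials is at least 1, so the
      lower bound for exp z yields the upper bound 1 - z + z^2 / 2 for exp (- z).\<close>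
    have "(1 + z + z\<^sup>2 / 2) * (1 - z + z\<^sup>2 / 2) = 1 + (z\<^sup>2 / 2)\<^sup>2"
      by (simp add: power2_eq_square algebra_simps)
    then have "1 \<le> (1 + z + z\<^sup>2 / 2) * (1 - z + z\<^sup>2 / 2)" by simp
    also have "\<dots> \<le> exp z * (1 - z + z\<^sup>2 / 2)"
    proof (rule mult_right_mono[OF low])
      have "0 \<le> (1 - z)\<^sup>2" by simp
      then show "0 \<le> 1 - z + z\<^sup>2 / 2" by (simp add: power2_eq_square algebra_simps)
    qed
    finally have "exp (- z) \<le> 1 - z + z\<^sup>2 / 2" by (simp add: exp_minus field_simps)
    then have "x \<le> exp z - exp (- z)" using low by (simp add: z_def)
    then have "x\<^sup>2 \<le> (exp z - exp (- z))\<^sup>2" using that by (intro power_mono) auto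
    also have "\<dots> = exp x + exp (- x) - 2"
      by (simp add: power2_eq_square algebra_simps z_def flip: exp_add)
    finally show ?thesis by simp
  qed
  show ?thesis using *[of x] *[of "- x"] by (cases "0 \<le> x") auto
qed

text \<open>Adding the bounds at \<theta> and - \<theta> gives 2 + \<theta>^2 V \<le> 2 exp
  (\<theta>^2 q(\<theta>)), and division by \<theta>^2 isolates V in the limit. The coefficient q
  depends on \<theta> because the sharp constant is reached only as \<theta> \<rightarrow>
  0.\<close>

lemma (in prob_space) second_moment_le_of_mgf:
  fixes Y :: "'a \<Rightarrow> real" and q :: "real \<Rightarrow> real"
  assumes Y2: "integrable M (\<lambda>x. (Y x)\<^sup>2)" and "0 < c"
    and int: "\<And>\<theta>. \<bar>\<theta>\<bar> \<le> c \<Longrightarrow> integrable M (\<lambda>x. exp (\<theta> * Y x))"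
    and mgf: "\<And>\<theta>. \<bar>\<theta>\<bar> \<le> c \<Longrightarrow> expectation (\<lambda>x. exp (\<theta> * Y x)) \<le> exp (\<theta>\<^sup>2 * q \<bar>\<theta>\<bar>)"
    and q: "(q \<longlongrightarrow> v) (at_right 0)"
  shows "expectation (\<lambda>x. (Y x)\<^sup>2) \<le> 2 * v"
proof -
  define V where "V = expectation (\<lambda>x. (Y x)\<^sup>2)"
  have bound: "V \<le> 2 * ((exp (\<theta>\<^sup>2 * q \<theta>) - 1) / \<theta>\<^sup>2)" if \<theta>: "0 < \<theta>" "\<theta> \<le> c" for \<theta>
  proof -
    have "2 + \<theta>\<^sup>2 * V = expectation (\<lambda>x. 2 + (\<theta> * Y x)\<^sup>2)"
      using Y2 by (simp add: V_def power_mult_distrib prob_space)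
    also have "\<dots> \<le> expectation (\<lambda>x. exp (\<theta> * Y x) + exp (- \<theta> * Y x))"
      using Y2 int[of \<theta>] int[of "- \<theta>"] \<theta> exp_plus_exp_minus_ge[of "\<theta> * Y _"]
      by (intro integral_mono) (auto simp: power_mult_distrib)
    also have "\<dots> = expectation (\<lambda>x. exp (\<theta> * Y x)) + expectation (\<lambda>x. exp (- \<theta> * Y x))"
      using int[of \<theta>] int[of "- \<theta>"] \<theta> by (intro Bochner_Integration.integral_add) auto
    also have "\<dots> \<le> 2 * exp (\<theta>\<^sup>2 * q \<theta>)"
      using mgf[of \<theta>] mgf[of "- \<theta>"] \<theta> by simp
    finally show ?thesis using \<theta> by (simp add: field_simps)
  qed
  have "((\<lambda>\<theta>. 2 * ((exp (\<theta>\<^sup>2 * q \<theta>) - 1) / \<theta>\<^sup>2)) \<longlongrightarrow> 2 * v) (at_right 0)"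
  proof (rule tendsto_mult[OF tendsto_const])
    have u: "((\<lambda>\<theta>. \<theta>\<^sup>2 * q \<theta>) \<longlongrightarrow> 0) (at_right 0)"
    proof -
      have "((\<lambda>\<theta>. \<theta>\<^sup>2 * q \<theta>) \<longlongrightarrow> 0\<^sup>2 * v) (at_right 0)"
        by (intro tendsto_mult tendsto_power tendsto_ident_at q)
      then show ?thesis by simp
    qed
    \<comment> \<open>The singularity of (exp u - 1) / u is removed because u = \<theta>^2
      q(\<theta>) can vanish for \<theta> > 0.\<close>
    define E where "E u = (if u = 0 then 1 else (exp u - 1) / u)" for u :: real
    have "((\<lambda>u::real. (exp u - 1) / u) \<longlongrightarrow> 1) (at 0)"
      using DERIV_exp[of 0] by (simp add: DERIV_def)
    then have "(E \<longlongrightarrow> 1) (at 0)"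
      by (rule Lim_transform_eventually) (auto simp: E_def eventually_at intro!: exI[of _ 1])
    then have "isCont E 0" by (simp add: isCont_def E_def)
    then have "((\<lambda>\<theta>. E (\<theta>\<^sup>2 * q \<theta>)) \<longlongrightarrow> E 0) (at_right 0)"
      using u by (rule isCont_tendsto_compose)
    then have "((\<lambda>\<theta>. q \<theta> * E (\<theta>\<^sup>2 * q \<theta>)) \<longlongrightarrow> v * 1) (at_right 0)"
      using q by (intro tendsto_mult) (simp_all add: E_def)
    then have "((\<lambda>\<theta>. q \<theta> * E (\<theta>\<^sup>2 * q \<theta>)) \<longlongrightarrow> v) (at_right 0)" by simp
    moreover have "eventually (\<lambda>\<theta>. q \<theta> * E (\<theta>\<^sup>2 * q \<theta>) = (exp (\<theta>\<^sup>2 * q \<theta>) - 1) / \<theta>\<^sup>2) (at_right 0)"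
      using eventually_at_right_less[of 0] by eventually_elim (auto simp: E_def)
    ultimately show "((\<lambda>\<theta>. (exp (\<theta>\<^sup>2 * q \<theta>) - 1) / \<theta>\<^sup>2) \<longlongrightarrow> v) (at_right 0)"
      by (rule Lim_transform_eventually)
  qed
  moreover have "eventually (\<lambda>\<theta>. V \<le> 2 * ((exp (\<theta>\<^sup>2 * q \<theta>) - 1) / \<theta>\<^sup>2)) (at_right 0)"
    using bound \<open>0 < c\<close> by (auto simp: eventually_at_right_field intro!: exI[of _ c])
  ultimately show ?thesis
    unfolding V_def[symmetric] by (rule tendsto_lowerbound) simp
qed

text \<open>The Chernoff parameter is \<open>sqrt (t / v)\<close>, cut off at the end \<open>1 / (4 s)\<close> of the range in which
  the moment generating function is controlled.\<close>

lemma (in prob_space) Bernstein_tail_of_mgf: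
  fixes Y :: "'a \<Rightarrow> real"
  assumes Y [measurable]: "Y \<in> borel_measurable M" and "0 < s" "0 \<le> v" "0 \<le> t"
    and int: "\<And>\<theta>. \<bar>\<theta>\<bar> * s \<le> 1 / 4 \<Longrightarrow> integrable M (\<lambda>x. exp (\<theta> * Y x))"
    and mgf: "\<And>\<theta>. \<bar>\<theta>\<bar> * s \<le> 1 / 4 \<Longrightarrow> expectation (\<lambda>x. exp (\<theta> * Y x)) \<le> exp (4 * \<theta>\<^sup>2 * v)"
  shows "prob {x\<in>space M. \<bar>Y x\<bar> / 32 \<ge> sqrt (v * t) + s * t} \<le> 32 * exp (- t / 32)"
proof -
  define r where "r = 32 * (sqrt (v * t) + s * t)"
  show ?thesis
  proof (cases "t = 0")
    case True
    show ?thesis by (rule order_trans[OF prob_le_1]) (simp add: True)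
  next
    case False
    then have "0 < t" using \<open>0 \<le> t\<close> by simp
    have "\<exists>\<theta>. 0 < \<theta> \<and> \<theta> * s \<le> 1 / 4 \<and> 4 * \<theta>\<^sup>2 * v - \<theta> * r \<le> - (4 * t)"
    \<comment> \<open>For v > 0 this says that sqrt (t / v) is at least the cut-off 1 / (4 s). In
      the first case 4 \<theta>^2 v \<le> 4 t is set against \<theta> r \<ge> 8 t, in the second 4 t
      against 32 t.\<close>
    proof (cases "v \<le> 16 * s\<^sup>2 * t")
      case True
      define \<theta> where "\<theta> = 1 / (4 * s)"
      have "4 * \<theta>\<^sup>2 * v = v / (4 * s\<^sup>2)"
        using \<open>0 < s\<close> by (simp add: \<theta>_def power2_eq_square field_simps)
      also have "\<dots> \<le> 4 * t"
        using True \<open>0 < s\<close> by (simp add: divide_le_eq mult_ac)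
      finally have 1: "4 * \<theta>\<^sup>2 * v \<le> 4 * t" .
      have "\<theta> * (32 * (s * t)) \<le> \<theta> * r"
        using \<open>0 < s\<close> \<open>0 \<le> v\<close> \<open>0 \<le> t\<close> by (intro mult_left_mono) (auto simp: r_def \<theta>_def)
      moreover have "\<theta> * (32 * (s * t)) = 8 * t" using \<open>0 < s\<close> by (simp add: \<theta>_def)
      ultimately show ?thesis
        using 1 \<open>0 < s\<close> by (intro exI[of _ \<theta>]) (auto simp: \<theta>_def)
    next
      case False
      then have v: "16 * s\<^sup>2 * t < v" by simp
      then have "0 < v" using \<open>0 < t\<close> by (meson le_less_trans mult_nonneg_nonneg zero_le_numeral
          zero_le_power2 less_imp_le)
      define \<theta> where "\<theta> = sqrt (t / v)"
      have "0 < \<theta>" using \<open>0 < t\<close> \<open>0 < v\<close> by (simp add: \<theta>_def)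
      have \<theta>2: "\<theta>\<^sup>2 * v = t" using \<open>0 < t\<close> \<open>0 < v\<close> by (simp add: \<theta>_def)
      have "(\<theta> * s)\<^sup>2 \<le> (1 / 4)\<^sup>2"
      proof -
        have "(\<theta> * s)\<^sup>2 = s\<^sup>2 * t / v"
          using \<open>0 < t\<close> \<open>0 < v\<close> by (simp add: power_mult_distrib \<theta>_def)
        also have "\<dots> \<le> 1 / 16" using v \<open>0 < v\<close> by (simp add: divide_le_eq)
        finally show ?thesis by (simp add: power2_eq_square)
      qed
      then have \<theta>s: "\<theta> * s \<le> 1 / 4" by (rule power2_le_imp_le) simp
      have "\<theta> * (32 * sqrt (v * t)) \<le> \<theta> * r"
        using \<open>0 < s\<close> \<open>0 \<le> t\<close> \<open>0 < \<theta>\<close> by (intro mult_left_mono) (auto simp: r_def)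
      moreover have "\<theta> * (32 * sqrt (v * t)) = 32 * t"
      proof -
        have "\<theta> * sqrt (v * t) = sqrt (t / v * (v * t))" by (simp only: \<theta>_def real_sqrt_mult)
        also have "t / v * (v * t) = t\<^sup>2" using \<open>0 < v\<close> by (simp add: power2_eq_square)
        finally show ?thesis using \<open>0 < t\<close> by simp
      qed
      ultimately have "4 * \<theta>\<^sup>2 * v - \<theta> * r \<le> - (4 * t)" using \<theta>2 \<open>0 < t\<close> by (simp add: mult.assoc)
      then show ?thesis using \<open>0 < \<theta>\<close> \<theta>s by blast
    qed
    then obtain \<theta> where \<theta>: "0 < \<theta>" "\<theta> * s \<le> 1 / 4" "4 * \<theta>\<^sup>2 * v - \<theta> * r \<le> - (4 * t)" by blast
    have side: "prob {x\<in>space M. exp (\<theta> * r) \<le> exp (\<eta> * Y x)} \<le> exp (- (4 * t))"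
      if "\<eta> = \<theta> \<or> \<eta> = - \<theta>" for \<eta>
    proof -
      have \<eta>: "\<bar>\<eta>\<bar> * s \<le> 1 / 4" "\<eta>\<^sup>2 = \<theta>\<^sup>2" using that \<theta> by auto
      have "prob {x\<in>space M. exp (\<theta> * r) \<le> exp (\<eta> * Y x)}
          \<le> expectation (\<lambda>x. exp (\<eta> * Y x)) / exp (\<theta> * r)"
        by (rule integral_Markov_inequality_measure[OF int[OF \<eta>(1)] sets.top]) auto
      also have "\<dots> \<le> exp (4 * \<theta>\<^sup>2 * v) / exp (\<theta> * r)"
        using mgf[OF \<eta>(1)] \<eta>(2) by (intro divide_right_mono) auto
      also have "\<dots> = exp (4 * \<theta>\<^sup>2 * v - \<theta> * r)" by (simp add: exp_diff)
      also have "\<dots> \<le> exp (- (4 * t))" using \<theta>(3) by simp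
      finally show ?thesis .
    qed
    have "{x\<in>space M. \<bar>Y x\<bar> / 32 \<ge> sqrt (v * t) + s * t}
        \<subseteq> {x\<in>space M. exp (\<theta> * r) \<le> exp (\<theta> * Y x)} \<union> {x\<in>space M. exp (\<theta> * r) \<le> exp (- \<theta> * Y x)}"
    proof
      fix x assume "x \<in> {x\<in>space M. \<bar>Y x\<bar> / 32 \<ge> sqrt (v * t) + s * t}"
      then have x: "x \<in> space M" "r \<le> \<bar>Y x\<bar>" by (auto simp: r_def)
      then have "r \<le> Y x \<or> r \<le> - Y x" by linarith
      then have "\<theta> * r \<le> \<theta> * Y x \<or> \<theta> * r \<le> \<theta> * - Y x"
        using \<theta>(1) mult_le_cancel_left_pos by blast
      then show "x \<in> {x\<in>space M. exp (\<theta> * r) \<le> exp (\<theta> * Y x)}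
          \<union> {x\<in>space M. exp (\<theta> * r) \<le> exp (- \<theta> * Y x)}" using x by auto
    qed
    then have "prob {x\<in>space M. \<bar>Y x\<bar> / 32 \<ge> sqrt (v * t) + s * t}
        \<le> prob ({x\<in>space M. exp (\<theta> * r) \<le> exp (\<theta> * Y x)} \<union> {x\<in>space M. exp (\<theta> * r) \<le> exp (- \<theta> * Y x)})"
      by (intro finite_measure_mono) auto
    also have "\<dots> \<le> prob {x\<in>space M. exp (\<theta> * r) \<le> exp (\<theta> * Y x)}
        + prob {x\<in>space M. exp (\<theta> * r) \<le> exp (- \<theta> * Y x)}"
      by (intro measure_Un_le) auto
    also have "\<dots> \<le> exp (- (4 * t)) + exp (- (4 * t))"
      by (intro add_mono side) auto
    also have "\<dots> \<le> 32 * exp (- t / 32)"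
    proof -
      have "exp (- (4 * t)) \<le> exp (- t / 32)" using \<open>0 < t\<close> by simp
      moreover have "0 < exp (- t / 32)" by simp
      ultimately show ?thesis by linarith
    qed
    finally show ?thesis .
  qed
qed

section \<open>Exponential moments of the likelihood ratio statistic\<close>

context closed_convex_set
begin

lemma std_gaussian_transfer:
  assumes [measurable]: "f \<in> borel_measurable borel"
  shows "integrable (std_gaussian n) f \<longleftrightarrow> integrable (gauss_PiM {..<n}) (\<lambda>x. f (zero_extend n x) :: real)"
    and "(\<integral>h. f h \<partial>std_gaussian n) = (\<integral>x. f (zero_extend n x) \<partial>gauss_PiM {..<n})"
  unfolding std_gaussian_eq by (simp_all add: integrable_distr_eq integral_distr)

lemma integrable_of_vnorm_square:
  assumes [measurable]: "f \<in> borel_measurable borel" and b: "\<And>h. \<bar>f h\<bar> \<le> C * (vnorm n h)\<^sup>2"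
  shows "integrable (std_gaussian n) (f :: _ \<Rightarrow> real)"
  unfolding std_gaussian_transfer(1)[OF assms(1)]
proof (rule integrable_gauss_PiM_of_quadratic)
  show "\<bar>f (zero_extend n x)\<bar> \<le> 0 + C * (\<Sum>i<n. (x i)\<^sup>2)" for x
    using b[of "zero_extend n x"] unfolding vnorm_zero_extend_square by simp
qed simp_all

lemma lrt_abs_bound: "\<bar>lrt n K \<mu>\<^sub>0 \<sigma> h\<bar> \<le> \<sigma>\<^sup>2 * (vnorm n h)\<^sup>2"
  using lrt_le_vnorm lrt_nonneg by simp

lemma err_abs_bound: "\<bar>err n K \<mu>\<^sub>0 \<sigma> h\<bar> \<le> \<sigma>\<^sup>2 * (vnorm n h)\<^sup>2"
  using order_trans[OF err_le_lrt lrt_le_vnorm] err_nonneg by simp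

lemma integrable_lrt: "integrable (std_gaussian n) (lrt n K \<mu>\<^sub>0 \<sigma>)"
  by (rule integrable_of_vnorm_square[OF borel_measurable_lrt lrt_abs_bound])

lemma integrable_err: "integrable (std_gaussian n) (err n K \<mu>\<^sub>0 \<sigma>)"
  by (rule integrable_of_vnorm_square[OF borel_measurable_err err_abs_bound])

lemma expectation_div:
  assumes "0 < \<sigma>"
  shows "integrable (std_gaussian n) (div_mu_seq n K \<mu>\<^sub>0 \<sigma>)"
    and "(\<integral>h. lrt n K \<mu>\<^sub>0 \<sigma> h \<partial>std_gaussian n) \<le> 2 * \<sigma>\<^sup>2 * (\<integral>h. div_mu_seq n K \<mu>\<^sub>0 \<sigma> h \<partial>std_gaussian n)"
    and "(\<integral>h. div_mu_seq n K \<mu>\<^sub>0 \<sigma> h \<partial>std_gaussian n) \<le> real n"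
proof -
  let ?P = "gauss_PiM {..<n}"
  interpret P: prob_space ?P by (intro prob_space_PiM prob_space_normal_density) simp
  have div_fun: "div_mu_seq n K \<mu>\<^sub>0 \<sigma> = (\<lambda>h. \<Sum>i<n. partial_proj \<sigma> i h)"
    by (rule ext) (rule div_mu_seq_eq)
  have meas: "(\<lambda>h. \<Sum>i<n. partial_proj \<sigma> i h) \<in> borel_measurable borel" by simp
  show "integrable (std_gaussian n) (div_mu_seq n K \<mu>\<^sub>0 \<sigma>)"
    unfolding div_fun std_gaussian_transfer(1)[OF meas]
    by (intro Bochner_Integration.integrable_sum integrable_partial_proj assms) simp
  have Ediv: "(\<integral>h. div_mu_seq n K \<mu>\<^sub>0 \<sigma> h \<partial>std_gaussian n)
      = (\<Sum>i<n. \<integral>x. partial_proj \<sigma> i (zero_extend n x) \<partial>?P)"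
    unfolding div_fun std_gaussian_transfer(2)[OF meas]
    by (intro Bochner_Integration.integral_sum integrable_partial_proj assms) simp
  have "(\<integral>x. partial_proj \<sigma> i (zero_extend n x) \<partial>?P) \<le> 1" if "i < n" for i
  proof -
    have "(\<integral>x. partial_proj \<sigma> i (zero_extend n x) \<partial>?P) \<le> (\<integral>x. 1 \<partial>?P)"
      using AE_partial_proj_bounds[OF that assms]
      by (intro integral_mono_AE integrable_partial_proj[OF that assms]) (auto elim: eventually_mono)
    then show ?thesis by (simp add: P.prob_space)
  qed
  then show "(\<integral>h. div_mu_seq n K \<mu>\<^sub>0 \<sigma> h \<partial>std_gaussian n) \<le> real n"
    unfolding Ediv using sum_bounded_above[of "{..<n}" _ "1::real"] by fastforce
  have "(\<integral>h. lrt n K \<mu>\<^sub>0 \<sigma> h \<partial>std_gaussian n) = (\<integral>x. lrt n K \<mu>\<^sub>0 \<sigma> (zero_extend n x) \<partial>?P)"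
    by (rule std_gaussian_transfer(2)) simp
  also have "\<dots> \<le> (\<integral>x. 2 * \<sigma> * (\<Sum>i<n. x i * (mu_seq n K \<mu>\<^sub>0 \<sigma> (zero_extend n x) i - \<mu>\<^sub>0 i)) \<partial>?P)"
  proof (rule integral_mono)
    show "integrable ?P (\<lambda>x. lrt n K \<mu>\<^sub>0 \<sigma> (zero_extend n x))"
      using integrable_lrt by (subst std_gaussian_transfer(1)[symmetric]) auto
    show "integrable ?P (\<lambda>x. 2 * \<sigma> * (\<Sum>i<n. x i * (mu_seq n K \<mu>\<^sub>0 \<sigma> (zero_extend n x) i - \<mu>\<^sub>0 i)))"
      by (intro integrable_mult_right Bochner_Integration.integrable_sum
          integrable_component_times_mu_seq) simp
    fix x :: "nat \<Rightarrow> real"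
    have "vinner n (zero_extend n x) (mu_seq n K \<mu>\<^sub>0 \<sigma> (zero_extend n x) - \<mu>\<^sub>0)
        = (\<Sum>i<n. x i * (mu_seq n K \<mu>\<^sub>0 \<sigma> (zero_extend n x) i - \<mu>\<^sub>0 i))"
      unfolding vinner_def by (intro sum.cong) (auto simp: zero_extend_component)
    then show "lrt n K \<mu>\<^sub>0 \<sigma> (zero_extend n x)
        \<le> 2 * \<sigma> * (\<Sum>i<n. x i * (mu_seq n K \<mu>\<^sub>0 \<sigma> (zero_extend n x) i - \<mu>\<^sub>0 i))"
      using err_nonneg[of n K \<mu>\<^sub>0 \<sigma> "zero_extend n x"] by (simp add: lrt_eq_minus_err)
  qed
  also have "\<dots> = 2 * \<sigma> * (\<Sum>i<n. \<integral>x. x i * (mu_seq n K \<mu>\<^sub>0 \<sigma> (zero_extend n x) i - \<mu>\<^sub>0 i) \<partial>?P)"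
    by (simp add: Bochner_Integration.integral_sum integrable_component_times_mu_seq)
  also have "\<dots> = 2 * \<sigma>\<^sup>2 * (\<integral>h. div_mu_seq n K \<mu>\<^sub>0 \<sigma> h \<partial>std_gaussian n)"
    unfolding Ediv using assms
    by (simp add: Stein_component sum_distrib_left power2_eq_square mult_ac)
  finally show "(\<integral>h. lrt n K \<mu>\<^sub>0 \<sigma> h \<partial>std_gaussian n)
      \<le> 2 * \<sigma>\<^sup>2 * (\<integral>h. div_mu_seq n K \<mu>\<^sub>0 \<sigma> h \<partial>std_gaussian n)" .
qed

text \<open>For \<theta> \<ge> 0 the upper tangent bound applies and spends \<theta> \<sigma>^2 |x -
  y|^2; for \<theta> < 0 multiplication reverses the lower tangent bound, which has no quadratic
  term. In both cases b |x - y|^2 of the cost is left.\<close>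

lemma lrt_transport_bound:
  assumes "0 < b" "b \<le> 1 / 2" "\<theta> * \<sigma>\<^sup>2 + b \<le> 1 / 2"
  shows "\<theta> * lrt n K \<mu>\<^sub>0 \<sigma> x \<le> \<theta> * lrt n K \<mu>\<^sub>0 \<sigma> y + \<theta>\<^sup>2 * \<sigma>\<^sup>2 / b * err n K \<mu>\<^sub>0 \<sigma> y
    + (vnorm n (x - y))\<^sup>2 / 2"
proof -
  define a r where "a = mu_seq n K \<mu>\<^sub>0 \<sigma> y - \<mu>\<^sub>0" and "r = x - y"
  define c where "c = \<theta> * \<sigma> / b"
  have "\<theta> * lrt n K \<mu>\<^sub>0 \<sigma> x \<le> \<theta> * lrt n K \<mu>\<^sub>0 \<sigma> y + 2 * (\<theta> * \<sigma>) * vinner n r a + (1 / 2 - b) * vinner n r r"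
  proof (cases "0 \<le> \<theta>")
    case True
    then have "\<theta> * lrt n K \<mu>\<^sub>0 \<sigma> x \<le> \<theta> * (lrt n K \<mu>\<^sub>0 \<sigma> y + 2 * \<sigma> * vinner n r a + \<sigma>\<^sup>2 * vinner n r r)"
      using lrt_upper_tangent[of \<sigma> x y] by (intro mult_left_mono) (simp_all add: a_def r_def vnorm_square)
    also have "\<dots> = \<theta> * lrt n K \<mu>\<^sub>0 \<sigma> y + 2 * (\<theta> * \<sigma>) * vinner n r a + (\<theta> * \<sigma>\<^sup>2) * vinner n r r"
      by (simp add: algebra_simps)
    also have "\<dots> \<le> \<theta> * lrt n K \<mu>\<^sub>0 \<sigma> y + 2 * (\<theta> * \<sigma>) * vinner n r a + (1 / 2 - b) * vinner n r r"
      using assms(3) by (intro add_left_mono mult_right_mono vinner_self_nonneg) simp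
    finally show ?thesis .
  next
    case False
    then have "\<theta> * lrt n K \<mu>\<^sub>0 \<sigma> x \<le> \<theta> * (lrt n K \<mu>\<^sub>0 \<sigma> y + 2 * \<sigma> * vinner n r a)"
      using lrt_lower_tangent[of \<sigma> y x] by (intro mult_left_mono_neg) (simp_all add: a_def r_def)
    also have "\<dots> = \<theta> * lrt n K \<mu>\<^sub>0 \<sigma> y + 2 * (\<theta> * \<sigma>) * vinner n r a"
      by (simp add: algebra_simps)
    also have "\<dots> \<le> \<theta> * lrt n K \<mu>\<^sub>0 \<sigma> y + 2 * (\<theta> * \<sigma>) * vinner n r a + (1 / 2 - b) * vinner n r r"
      using mult_nonneg_nonneg[of "1 / 2 - b", OF _ vinner_self_nonneg[of n r]] assms(2) by simp
    finally show ?thesis .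
  qed
  moreover have "0 \<le> b * vinner n r r - 2 * (\<theta> * \<sigma>) * vinner n r a + \<theta>\<^sup>2 * \<sigma>\<^sup>2 / b * vinner n a a"
  proof -
    \<comment> \<open>Completing the square; c = \<theta> \<sigma> / b is the value that matches the
      cross term.\<close>
    have "0 \<le> b * vinner n (r - c *\<^sub>R a) (r - c *\<^sub>R a)"
      using assms(1) vinner_self_nonneg by simp
    also have "\<dots> = b * vinner n r r - 2 * (b * c) * vinner n r a + b * c * c * vinner n a a"
      unfolding vinner_simps by (simp add: vinner_commute[of n a r] algebra_simps)
    also have "b * c = \<theta> * \<sigma>" using assms(1) by (simp add: c_def)
    also have "\<theta> * \<sigma> * c = \<theta>\<^sup>2 * \<sigma>\<^sup>2 / b"
      by (simp add: c_def power2_eq_square)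
    finally show ?thesis .
  qed
  moreover have "err n K \<mu>\<^sub>0 \<sigma> y = vinner n a a" by (simp add: err_def a_def vnorm_square)
  ultimately show ?thesis
    unfolding r_def[symmetric] vnorm_square by (simp only: left_diff_distrib)
qed

lemma mgf_lrt:
  assumes b: "0 < b" "b \<le> 1 / 2" "\<theta> * \<sigma>\<^sup>2 + b \<le> 1 / 2"
  defines "Y \<equiv> \<lambda>h. lrt n K \<mu>\<^sub>0 \<sigma> h - (\<integral>h. lrt n K \<mu>\<^sub>0 \<sigma> h \<partial>std_gaussian n)"
  shows "integrable (std_gaussian n) (\<lambda>h. exp (\<theta> * Y h))"
    and "(\<integral>h. exp (\<theta> * Y h) \<partial>std_gaussian n)
      \<le> exp (\<theta>\<^sup>2 * (\<sigma>\<^sup>2 * (\<integral>h. err n K \<mu>\<^sub>0 \<sigma> h \<partial>std_gaussian n) / b))"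
proof -
  let ?P = "gauss_PiM {..<n}"
  define E where "E = (\<integral>h. lrt n K \<mu>\<^sub>0 \<sigma> h \<partial>std_gaussian n)"
  define m where "m = (\<integral>h. err n K \<mu>\<^sub>0 \<sigma> h \<partial>std_gaussian n)"
  define c where "c = \<theta>\<^sup>2 * \<sigma>\<^sup>2 / b"
  define f where "f h = \<theta> * lrt n K \<mu>\<^sub>0 \<sigma> h + c * err n K \<mu>\<^sub>0 \<sigma> h" for h
  have [measurable]: "f \<in> borel_measurable borel" unfolding f_def by measurable
  have "(\<integral>\<^sup>+x. ennreal (exp (\<theta> * lrt n K \<mu>\<^sub>0 \<sigma> (zero_extend n x))) \<partial>?P)
      \<le> ennreal (exp (\<integral>x. f (zero_extend n x) \<partial>?P))"
  proof (rule gaussian_transport)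
    show "\<bar>f (zero_extend n x)\<bar> \<le> 0 + (\<bar>\<theta>\<bar> * \<sigma>\<^sup>2 + \<bar>c\<bar> * \<sigma>\<^sup>2) * (\<Sum>i<n. (x i)\<^sup>2)" for x
    proof -
      have "\<bar>f (zero_extend n x)\<bar> \<le> \<bar>\<theta>\<bar> * \<bar>lrt n K \<mu>\<^sub>0 \<sigma> (zero_extend n x)\<bar>
          + \<bar>c\<bar> * \<bar>err n K \<mu>\<^sub>0 \<sigma> (zero_extend n x)\<bar>"
        unfolding f_def abs_mult[symmetric] by (rule abs_triangle_ineq)
      also have "\<dots> \<le> \<bar>\<theta>\<bar> * (\<sigma>\<^sup>2 * (\<Sum>i<n. (x i)\<^sup>2)) + \<bar>c\<bar> * (\<sigma>\<^sup>2 * (\<Sum>i<n. (x i)\<^sup>2))"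
        unfolding vnorm_zero_extend_square[symmetric]
        by (intro add_mono mult_left_mono lrt_abs_bound err_abs_bound) auto
      finally show ?thesis by (simp add: algebra_simps)
    qed
    show "ennreal (exp (\<theta> * lrt n K \<mu>\<^sub>0 \<sigma> (zero_extend n x)))
        \<le> ennreal (exp (f (zero_extend n y) + (\<Sum>i<n. (x i - y i)\<^sup>2) / 2))" for x y
    proof -
      have "zero_extend n x - zero_extend n y = zero_extend n (\<lambda>i. x i - y i)"
        by (auto simp: zero_extend_def)
      then have "(vnorm n (zero_extend n x - zero_extend n y))\<^sup>2 = (\<Sum>i<n. (x i - y i)\<^sup>2)"
        using vnorm_zero_extend_square[of n "\<lambda>i. x i - y i"] by simp
      then show ?thesis
        using lrt_transport_bound[OF b, of "zero_extend n x" "zero_extend n y"]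
        by (intro ennreal_leI) (simp add: f_def c_def)
    qed
  qed measurable
  also have "(\<integral>x. f (zero_extend n x) \<partial>?P) = (\<integral>h. f h \<partial>std_gaussian n)"
    by (rule std_gaussian_transfer(2)[symmetric]) simp
  also have "\<dots> = \<theta> * E + c * m"
    unfolding f_def E_def m_def using integrable_lrt integrable_err by simp
  finally have le: "(\<integral>\<^sup>+x. ennreal (exp (\<theta> * lrt n K \<mu>\<^sub>0 \<sigma> (zero_extend n x))) \<partial>?P)
      \<le> ennreal (exp (\<theta> * E + c * m))" .
  \<comment> \<open>The transport inequality bounds an integral in \<open>ennreal\<close>, so
    exponential integrability is a consequence and not a prerequisite.\<close>
  have int: "integrable (std_gaussian n) (\<lambda>h. exp (\<theta> * lrt n K \<mu>\<^sub>0 \<sigma> h))"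
  proof (subst std_gaussian_transfer(1))
    show "integrable ?P (\<lambda>x. exp (\<theta> * lrt n K \<mu>\<^sub>0 \<sigma> (zero_extend n x)))"
      using le by (intro integrableI_nonneg) (auto intro: le_less_trans)
  qed simp
  have "ennreal (\<integral>h. exp (\<theta> * lrt n K \<mu>\<^sub>0 \<sigma> h) \<partial>std_gaussian n) \<le> ennreal (exp (\<theta> * E + c * m))"
  proof -
    have "ennreal (\<integral>h. exp (\<theta> * lrt n K \<mu>\<^sub>0 \<sigma> h) \<partial>std_gaussian n)
        = ennreal (\<integral>x. exp (\<theta> * lrt n K \<mu>\<^sub>0 \<sigma> (zero_extend n x)) \<partial>?P)"
      by (subst std_gaussian_transfer(2)) simp_all
    also have "\<dots> = (\<integral>\<^sup>+x. ennreal (exp (\<theta> * lrt n K \<mu>\<^sub>0 \<sigma> (zero_extend n x))) \<partial>?P)"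
      using int by (subst (asm) std_gaussian_transfer(1)) (simp_all add: nn_integral_eq_integral)
    finally show ?thesis using le by simp
  qed
  then have mgf: "(\<integral>h. exp (\<theta> * lrt n K \<mu>\<^sub>0 \<sigma> h) \<partial>std_gaussian n) \<le> exp (\<theta> * E + c * m)"
    by (subst (asm) ennreal_le_iff) auto
  have split: "exp (\<theta> * Y h) = exp (- \<theta> * E) * exp (\<theta> * lrt n K \<mu>\<^sub>0 \<sigma> h)" for h
    by (simp add: Y_def E_def algebra_simps flip: exp_add)
  show "integrable (std_gaussian n) (\<lambda>h. exp (\<theta> * Y h))"
    unfolding split using int by (rule integrable_mult_right)
  have "(\<integral>h. exp (\<theta> * Y h) \<partial>std_gaussian n)
      = exp (- \<theta> * E) * (\<integral>h. exp (\<theta> * lrt n K \<mu>\<^sub>0 \<sigma> h) \<partial>std_gaussian n)"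
    unfolding split by simp
  also have "\<dots> \<le> exp (- \<theta> * E) * exp (\<theta> * E + c * m)"
    by (intro mult_left_mono mgf) simp
  also have "\<dots> = exp (\<theta>\<^sup>2 * (\<sigma>\<^sup>2 * m / b))" by (simp add: c_def flip: exp_add)
  finally show "(\<integral>h. exp (\<theta> * Y h) \<partial>std_gaussian n)
      \<le> exp (\<theta>\<^sup>2 * (\<sigma>\<^sup>2 * (\<integral>h. err n K \<mu>\<^sub>0 \<sigma> h \<partial>std_gaussian n) / b))"
    by (simp add: m_def)
qed

end

context closed_convex_set
begin

lemma lrt_centered_moments:
  assumes "0 < \<sigma>"
  defines "E \<equiv> \<integral>h. lrt n K \<mu>\<^sub>0 \<sigma> h \<partial>std_gaussian n" and "m \<equiv> \<integral>h. err n K \<mu>\<^sub>0 \<sigma> h \<partial>std_gaussian n"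
  shows "integrable (std_gaussian n) (\<lambda>h. (lrt n K \<mu>\<^sub>0 \<sigma> h)\<^sup>2)"
    and "prob_space.variance (std_gaussian n) (lrt n K \<mu>\<^sub>0 \<sigma>) \<le> 4 * \<sigma>\<^sup>2 * m"
proof -
  interpret prob_space "std_gaussian n" by (rule prob_space_std_gaussian)
  define Y where "Y h = lrt n K \<mu>\<^sub>0 \<sigma> h - E" for h
  \<comment> \<open>For |\<theta>| \<le> c the parameter b = 1/2 - |\<theta>| \<sigma>^2 is at least
    1/4. It tends to 1/2 with \<theta> \<rightarrow> 0, which produces 2 \<sigma>^2 m / (1/2) = 4
    \<sigma>^2 m.\<close>
  define c where "c = 1 / (4 * \<sigma>\<^sup>2)"
  have c: "0 < c" "\<And>\<theta>. \<bar>\<theta>\<bar> \<le> c \<Longrightarrow> \<bar>\<theta>\<bar> * \<sigma>\<^sup>2 \<le> 1 / 4"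
    using assms(1) by (auto simp: c_def field_simps)
  have b: "0 < 1 / 2 - \<bar>\<theta>\<bar> * \<sigma>\<^sup>2" "1 / 2 - \<bar>\<theta>\<bar> * \<sigma>\<^sup>2 \<le> 1 / 2" "\<theta> * \<sigma>\<^sup>2 + (1 / 2 - \<bar>\<theta>\<bar> * \<sigma>\<^sup>2) \<le> 1 / 2"
    if "\<bar>\<theta>\<bar> \<le> c" for \<theta>
    using c(2)[OF that] mult_right_mono[OF abs_ge_self, of "\<sigma>\<^sup>2" \<theta>] by auto
  have int_exp: "integrable (std_gaussian n) (\<lambda>h. exp (\<theta> * Y h))" if "\<bar>\<theta>\<bar> \<le> c" for \<theta>
    using mgf_lrt(1)[OF b[OF that]] by (simp add: Y_def E_def)
  have Y2: "integrable (std_gaussian n) (\<lambda>h. (Y h)\<^sup>2)"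
  proof (rule Bochner_Integration.integrable_bound)
    show "integrable (std_gaussian n) (\<lambda>h. (exp (c * Y h) + exp (- c * Y h)) / c\<^sup>2)"
      using int_exp[of c] int_exp[of "- c"] c(1) by simp
    show "AE h in std_gaussian n. norm ((Y h)\<^sup>2) \<le> norm ((exp (c * Y h) + exp (- c * Y h)) / c\<^sup>2)"
    proof (rule AE_I2)
      fix h
      have "c\<^sup>2 * (Y h)\<^sup>2 \<le> exp (c * Y h) + exp (- c * Y h)"
        using exp_plus_exp_minus_ge[of "c * Y h"] by (simp add: power_mult_distrib)
      then have "(Y h)\<^sup>2 \<le> (exp (c * Y h) + exp (- c * Y h)) / c\<^sup>2"
        using c(1) by (simp add: pos_le_divide_eq mult.commute)
      then show "norm ((Y h)\<^sup>2) \<le> norm ((exp (c * Y h) + exp (- c * Y h)) / c\<^sup>2)" by simp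
    qed
  qed (simp add: Y_def std_gaussian_def)
  have "(lrt n K \<mu>\<^sub>0 \<sigma> h)\<^sup>2 = (Y h)\<^sup>2 + 2 * E * lrt n K \<mu>\<^sub>0 \<sigma> h - E\<^sup>2" for h
    by (simp add: Y_def power2_eq_square algebra_simps)
  then show "integrable (std_gaussian n) (\<lambda>h. (lrt n K \<mu>\<^sub>0 \<sigma> h)\<^sup>2)"
    using Y2 integrable_lrt by simp
  have "expectation (\<lambda>h. (Y h)\<^sup>2) \<le> 2 * (\<sigma>\<^sup>2 * m / (1 / 2 - 0 * \<sigma>\<^sup>2))"
  proof (rule second_moment_le_of_mgf[OF Y2 c(1) int_exp])
    show "expectation (\<lambda>h. exp (\<theta> * Y h)) \<le> exp (\<theta>\<^sup>2 * (\<sigma>\<^sup>2 * m / (1 / 2 - \<bar>\<theta>\<bar> * \<sigma>\<^sup>2)))"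
      if "\<bar>\<theta>\<bar> \<le> c" for \<theta>
      using mgf_lrt(2)[OF b[OF that]] by (simp add: Y_def E_def m_def)
    show "((\<lambda>\<theta>. \<sigma>\<^sup>2 * m / (1 / 2 - \<theta> * \<sigma>\<^sup>2)) \<longlongrightarrow> \<sigma>\<^sup>2 * m / (1 / 2 - 0 * \<sigma>\<^sup>2)) (at_right 0)"
      by (intro tendsto_intros) simp
  qed
  then show "variance (lrt n K \<mu>\<^sub>0 \<sigma>) \<le> 4 * \<sigma>\<^sup>2 * m"
    by (simp add: Y_def E_def)
qed

lemma mgf_lrt_normalized:
  assumes "0 < \<sigma>"
  defines "E \<equiv> \<integral>h. lrt n K \<mu>\<^sub>0 \<sigma> h \<partial>std_gaussian n" and "m \<equiv> \<integral>h. err n K \<mu>\<^sub>0 \<sigma> h \<partial>std_gaussian n"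
  assumes l: "l\<^sup>2 < m / (8 * \<sigma>\<^sup>2)"
  shows "integrable (std_gaussian n) (\<lambda>h. exp (l * ((lrt n K \<mu>\<^sub>0 \<sigma> h - E) / (\<sigma> * sqrt m))))"
    and "(\<integral>h. exp (l * ((lrt n K \<mu>\<^sub>0 \<sigma> h - E) / (\<sigma> * sqrt m))) \<partial>std_gaussian n)
      \<le> exp (4 * l\<^sup>2 / (1 - 8 * (\<sigma>\<^sup>2 / m) * l\<^sup>2))"
proof -
  have "0 < m / (8 * \<sigma>\<^sup>2)" using l zero_le_power2[of l] by linarith
  then have "0 < m" using assms(1) by (simp add: zero_less_divide_iff)
  \<comment> \<open>In terms of z the exponent is l^2 / b, so this b yields the required
    denominator, and the hypothesis on l says 8 z^2 < 1, that is b > 0.\<close>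
  define \<theta> z b where "\<theta> = l / (\<sigma> * sqrt m)" and "z = \<theta> * \<sigma>\<^sup>2" and "b = (1 - 8 * z\<^sup>2) / 4"
  have z2: "z\<^sup>2 = (\<sigma>\<^sup>2 / m) * l\<^sup>2"
    using \<open>0 < m\<close> assms(1) by (simp add: z_def \<theta>_def power_mult_distrib power_divide field_simps power2_eq_square)
  have "8 * z\<^sup>2 < 1"
    using l \<open>0 < m\<close> assms(1) unfolding z2 by (simp add: field_simps)
  \<comment> \<open>The constraint z + b \<le> 1/2 amounts to 8 z^2 - 4 z + 1 \<ge> 0, and this is
    half of the sum displayed here.\<close>
  moreover have "0 \<le> (4 * z - 1)\<^sup>2 + 1" by (intro add_nonneg_nonneg) auto
  then have "0 \<le> 8 * z\<^sup>2 - 4 * z + 1" by (simp add: power2_eq_square algebra_simps)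
  ultimately have b: "0 < b" "b \<le> 1 / 2" "\<theta> * \<sigma>\<^sup>2 + b \<le> 1 / 2"
    using zero_le_power2[of z] unfolding z_def[symmetric] by (auto simp: b_def field_simps)
  have arg: "l * ((lrt n K \<mu>\<^sub>0 \<sigma> h - E) / (\<sigma> * sqrt m)) = \<theta> * (lrt n K \<mu>\<^sub>0 \<sigma> h - E)" for h
    by (simp add: \<theta>_def)
  show "integrable (std_gaussian n) (\<lambda>h. exp (l * ((lrt n K \<mu>\<^sub>0 \<sigma> h - E) / (\<sigma> * sqrt m))))"
    unfolding arg unfolding E_def by (rule mgf_lrt(1)[OF b])
  have "(\<integral>h. exp (l * ((lrt n K \<mu>\<^sub>0 \<sigma> h - E) / (\<sigma> * sqrt m))) \<partial>std_gaussian n)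
      \<le> exp (\<theta>\<^sup>2 * (\<sigma>\<^sup>2 * m / b))"
    unfolding arg unfolding E_def m_def by (rule mgf_lrt(2)[OF b])
  also have "\<theta>\<^sup>2 * (\<sigma>\<^sup>2 * m / b) = l\<^sup>2 / b"
    using \<open>0 < m\<close> assms(1) by (simp add: \<theta>_def power_mult_distrib power_divide)
  also have "\<dots> = 4 * l\<^sup>2 / (1 - 8 * (\<sigma>\<^sup>2 / m) * l\<^sup>2)"
    unfolding b_def z2 by (simp add: mult.assoc)
  finally show "(\<integral>h. exp (l * ((lrt n K \<mu>\<^sub>0 \<sigma> h - E) / (\<sigma> * sqrt m))) \<partial>std_gaussian n)
      \<le> exp (4 * l\<^sup>2 / (1 - 8 * (\<sigma>\<^sup>2 / m) * l\<^sup>2))" .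
qed

lemma lrt_tail:
  assumes "0 < \<sigma>" "0 \<le> t"
  defines "E \<equiv> \<integral>h. lrt n K \<mu>\<^sub>0 \<sigma> h \<partial>std_gaussian n" and "m \<equiv> \<integral>h. err n K \<mu>\<^sub>0 \<sigma> h \<partial>std_gaussian n"
  shows "prob_space.prob (std_gaussian n) {h \<in> space (std_gaussian n).
      \<bar>lrt n K \<mu>\<^sub>0 \<sigma> h - E\<bar> / 32 \<ge> sqrt (\<sigma>\<^sup>2 * m * t) + \<sigma>\<^sup>2 * t} \<le> 32 * exp (- t / 32)"
proof -
  interpret prob_space "std_gaussian n" by (rule prob_space_std_gaussian)
  \<comment> \<open>With b fixed at 1/4 the exponent is 4 \<theta>^2 \<sigma>^2 m on the whole range
    |\<theta>| \<sigma>^2 \<le> 1/4. This also covers m = 0, where the normalised form says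
    nothing.\<close>
  have b: "0 < (1 / 4 :: real)" "1 / 4 \<le> (1 / 2 :: real)" "\<theta> * \<sigma>\<^sup>2 + 1 / 4 \<le> 1 / 2"
    if "\<bar>\<theta>\<bar> * \<sigma>\<^sup>2 \<le> 1 / 4" for \<theta>
    using that mult_right_mono[OF abs_ge_self, of "\<sigma>\<^sup>2" \<theta>] by auto
  show ?thesis
  proof (rule Bernstein_tail_of_mgf)
    show "integrable (std_gaussian n) (\<lambda>h. exp (\<theta> * (lrt n K \<mu>\<^sub>0 \<sigma> h - E)))"
      if "\<bar>\<theta>\<bar> * \<sigma>\<^sup>2 \<le> 1 / 4" for \<theta>
      unfolding E_def by (rule mgf_lrt(1)[OF b[OF that]])
    show "expectation (\<lambda>h. exp (\<theta> * (lrt n K \<mu>\<^sub>0 \<sigma> h - E))) \<le> exp (4 * \<theta>\<^sup>2 * (\<sigma>\<^sup>2 * m))"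
      if "\<bar>\<theta>\<bar> * \<sigma>\<^sup>2 \<le> 1 / 4" for \<theta>
      using mgf_lrt(2)[OF b[OF that]] by (simp add: E_def m_def mult_ac)
  qed (use assms err_nonneg in \<open>auto simp: m_def std_gaussian_def intro!: integral_nonneg\<close>)
qed

end

theorem proposition4p7:
  shows "\<exists>L::real. 0 < L \<and> (\<forall>(n::nat) (K::(nat \<Rightarrow> real) set) (\<mu>\<^sub>0::nat \<Rightarrow> real) (\<sigma>::real).
    closedin (Euclidean_space n) K \<and> convex K \<and> \<mu>\<^sub>0 \<in> K \<and> 0 < \<sigma> \<longrightarrow>
    (let \<gamma> = std_gaussian n;
         \<mu> = mu_seq n K \<mu>\<^sub>0 \<sigma>;
         Lrt = lrt n K \<mu>\<^sub>0 \<sigma>;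
         Err = err n K \<mu>\<^sub>0;
         Div = div_mu_seq n K \<mu>\<^sub>0 \<sigma>;
         ELrt = prob_space.expectation \<gamma> Lrt;
         EErr = prob_space.expectation \<gamma> (Err \<sigma>);
         EDiv = prob_space.expectation \<gamma> Div
     in
      \<comment> \<open>(1)\<close>
      (integrable \<gamma> Lrt \<and> integrable \<gamma> Div \<and>
        ELrt \<le> 2 * \<sigma>\<^sup>2 * EDiv \<and> 2 * \<sigma>\<^sup>2 * EDiv \<le> 2 * \<sigma>\<^sup>2 * real n) \<and>
      \<comment> \<open>(2)\<close>
      (\<forall>h \<in> topspace (Euclidean_space n).
        Err \<sigma> h \<le> Lrt h \<and>
        (\<lambda>\<tau>. Err \<tau> h / \<tau>\<^sup>2 - Err \<sigma> h / \<sigma>\<^sup>2) integrable_on {0..\<sigma>} \<and>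
        Lrt h \<le> Err \<sigma> h
          + 2 * \<sigma> * integral {0..\<sigma>} (\<lambda>\<tau>. Err \<tau> h / \<tau>\<^sup>2 - Err \<sigma> h / \<sigma>\<^sup>2)) \<and>
      (cone K \<longrightarrow>
        (\<forall>h \<in> topspace (Euclidean_space n).
          (\<forall>\<nu> \<in> topspace (Euclidean_space n).
            (\<forall>x\<in>K. x + \<nu> \<in> K) \<and> \<mu> h - \<nu> \<in> K \<longrightarrow>
            Err \<sigma> h \<le> Lrt h \<and>
            Lrt h \<le> Err \<sigma> h + 2 * vinner n (\<mu> h - \<mu>\<^sub>0 - \<sigma> *\<^sub>R h) (\<mu>\<^sub>0 - \<nu>)) \<and>
          Lrt h = Err \<sigma> h + 2 * vinner n (\<mu> h - \<mu>\<^sub>0 - \<sigma> *\<^sub>R h) (\<mu>\<^sub>0 - \<mu> h))) \<and>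
      \<comment> \<open>(3)\<close>
      (integrable \<gamma> (\<lambda>h. (Lrt h)\<^sup>2) \<and> integrable \<gamma> (Err \<sigma>) \<and>
        prob_space.variance \<gamma> Lrt \<le> 4 * \<sigma>\<^sup>2 * EErr) \<and>
      \<comment> \<open>(4)\<close>
      (\<forall>l::real. l\<^sup>2 < EErr / (8 * \<sigma>\<^sup>2) \<longrightarrow>
        integrable \<gamma> (\<lambda>h. exp (l * ((Lrt h - ELrt) / (\<sigma> * sqrt EErr)))) \<and>
        prob_space.expectation \<gamma> (\<lambda>h. exp (l * ((Lrt h - ELrt) / (\<sigma> * sqrt EErr))))
          \<le> exp (4 * l\<^sup>2 / (1 - 8 * (\<sigma>\<^sup>2 / EErr) * l\<^sup>2))) \<and>
      (\<forall>t\<ge>0. prob_space.prob \<gamma>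
          {h \<in> space \<gamma>. \<bar>Lrt h - ELrt\<bar> / L \<ge> sqrt (\<sigma>\<^sup>2 * EErr * t) + \<sigma>\<^sup>2 * t}
          \<le> L * exp (- t / L))))"
proof (intro exI[of _ "32::real"] conjI allI impI, goal_cases)
  \<comment> \<open>The witness 32 is the constant of \<open>lrt_tail\<close>, fixed before the
    dimension, the set, the centre and the scale.\<close>
  case (2 n K \<mu>\<^sub>0 \<sigma>)
  interpret closed_convex_set n K \<mu>\<^sub>0 using 2 by unfold_locales auto
  have \<sigma>: "0 < \<sigma>" using 2 by simp
  show ?case
    unfolding Let_def
  proof (intro conjI ballI allI impI)
    show "2 * \<sigma>\<^sup>2 * (\<integral>h. div_mu_seq n K \<mu>\<^sub>0 \<sigma> h \<partial>std_gaussian n) \<le> 2 * \<sigma>\<^sup>2 * real n"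
      by (intro mult_left_mono expectation_div \<sigma>) simp
  qed ((rule mgf_lrt_normalized[OF \<sigma>] lrt_tail[OF \<sigma>], assumption)
      | (auto intro: integrable_lrt integrable_err expectation_div[OF \<sigma>] err_le_lrt lrt_eq_err_plus
          lrt_upper_integral[OF \<sigma>] lrt_upper_cone lrt_centered_moments[OF \<sigma>])[1])+
qed simp

end
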